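(* Let $a\in\mathbb N$, $\mathbf b=(b_1,\dots,b_n)\in\mathbb N^n$, $\phi=\phi^{a\times\mathbf b}$ the universal tensor, and $Y(\phi)\subseteq\mathbb A^{a\times\mathbf b}$ its hyperdeterminantal variety. Put $a'=1+\sum_{i=1}^n(b_i-1)$. Then $Y(\phi)$ is set-theoretically defined by the ideal $$\left\langle\ \text{hyperdeterminant of }\phi'\ \mid\ \phi'\text{ is an }(a'\times\mathbf b)\text{-subtensor of }\phi\ \right\rangle ,$$ in the following sense: for every algebraically closed field $\Bbbk$, after base change to $\Bbbk$, the zero locus in $\mathbb A^{a\times\mathbf b}_\Bbbk$ of the ideal of $S\otimes\Bbbk$ generated by the hyperdeterminants $\Delta_{a'\times\mathbf b}(\phi')$, with $\phi'$ ranging over all $(a'\times\mathbf b)$-subtensors of $\phi$ over $\Bbbk$, equals $Y(\phi)_\Bbbk$ as a set.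
   Context: $\mathbb N$ denotes the positive integers. $S=\mathbb Z[x_{i,J}]$ with $1\le i\le a$, $J=(j_1,\dots,j_n)$, $1\le j_\ell\le b_\ell$; the universal tensor is $\phi=\phi^{a\times\mathbf b}=(x_{i,J})$; $\mathbb A^{a\times\mathbf b}=\mathrm{Spec}\,S$. Let $P=\mathbb P^{b_1-1}\times\cdots\times\mathbb P^{b_n-1}$ (over $\mathbb Z$) with homogeneous coordinates $y_{\ell,1},\dots,y_{\ell,b_\ell}$ on the $\ell$-th factor, $y_J=y_{1,j_1}\cdots y_{n,j_n}$, and $f_i=\sum_Jx_{i,J}y_J$ for $1\le i\le a$. Let $Z(\phi)=V(f_1,\dots,f_a)\subseteq\mathbb A^{a\times\mathbf b}\times P$ and let $Y(\phi)$ be the image of $Z(\phi)$ under the projection to $\mathbb A^{a\times\mathbf b}$. Subtensors: over a field $\Bbbk$, an $(a'\times\mathbf b)$-subtensor of $\phi$ is a tensor of the form $\phi'=\left(\sum_{i=1}^ac_{k,i}x_{i,J}\right)_{1\le k\le a',\,J}$, where $(c_{k,i})$ is an $a'\times a$ matrix over $\Bbbk$ of rank $a'$; i.e. it corresponds to $a'$ linearly independent elements of the span of $f_1,\dots,f_a$. (If $a<a'$ there are none and the ideal is zero.) Hyperdeterminant: $\Delta_{a'\times\mathbf b}$ is the hyperdeterminant of the boundary format $a'\times b_1\times\cdots\times b_n$ (where $a'-1=\sum(b_i-1)$): the irreducible polynomial with integer coefficients in the entries of an $a'\times b_1\times\cdots\times b_n$ tensor defining the projective dual variety of the Segre variety $\mathbb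 P^{a'-1}\times\mathbb P^{b_1-1}\times\cdots\times\mathbb P^{b_n-1}$ in characteristic $0$, normalized (up to sign) to be not divisible by any prime number. *)

theory Defs
  imports
    "HOL-Library.Poly_Mapping"
    "HOL-Computational_Algebra.Computational_Algebra"
    "HOL-Algebra.Ideal"
    "HOL-Algebra.Ring_Divisibility"
    "Jordan_Normal_Form.DL_Rank"
begin

type_synonym ('v, 'k) mpoly = "('v \<Rightarrow>\<^sub>0 nat) \<Rightarrow>\<^sub>0 'k"

definition mvar :: "'v \<Rightarrow> ('v, 'k::comm_ring_1) mpoly" where
  "mvar v = Poly_Mapping.single (Poly_Mapping.single v 1) 1"

definition mconst :: "'k \<Rightarrow> ('v, 'k::comm_ring_1) mpoly" where
  "mconst c = Poly_Mapping.single 0 c"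

definition mvars :: "('v, 'k::zero) mpoly \<Rightarrow> 'v set" where
  "mvars p = (\<Union>m\<in>Poly_Mapping.keys p. Poly_Mapping.keys m)"

definition mpoly_ring :: "'v set \<Rightarrow> ('v, 'k::comm_ring_1) mpoly ring" where
  "mpoly_ring V =
     \<lparr>carrier = {p. mvars p \<subseteq> V}, mult = (*), one = 1, zero = 0, add = (+)\<rparr>"

text \<open>The value of \<^term>\<open>p\<close> at \<^term>\<open>x\<close> after applying \<^term>\<open>h\<close> to the coefficients; the target may
  itself be a polynomial ring, which gives substitution of polynomials for the variables.\<close>

definition meval :: "('k::zero \<Rightarrow> 'r::comm_ring_1) \<Rightarrow> ('v \<Rightarrow> 'r) \<Rightarrow> ('v, 'k) mpoly \<Rightarrow> 'r" where
  "meval h x p = (\<Sum>m\<in>Poly_Mapping.keys p.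
     h (Poly_Mapping.lookup p m) *
     (\<Prod>v\<in>Poly_Mapping.keys m. x v ^ Poly_Mapping.lookup m v))"

definition mderiv :: "'v \<Rightarrow> ('v, 'k::comm_ring_1) mpoly \<Rightarrow> ('v, 'k) mpoly" where
  "mderiv v p = (\<Sum>m\<in>Poly_Mapping.keys p.
     Poly_Mapping.single (m - Poly_Mapping.single v 1)
       (of_nat (Poly_Mapping.lookup m v) * Poly_Mapping.lookup p m))"

lemma mvars_add: "mvars (p + q) \<subseteq> mvars p \<union> mvars q"
  using Poly_Mapping.keys_add[of p q] unfolding mvars_def by blast

lemma mvars_uminus: "mvars (- p) = mvars p" for p :: "('v, 'k::comm_ring_1) mpoly"
proof -
  have "Poly_Mapping.keys (- p) = Poly_Mapping.keys p"
    by (auto simp: Poly_Mapping.in_keys_iff)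
  then show ?thesis by (simp add: mvars_def)
qed

lemma mvars_mult: "mvars (p * q) \<subseteq> mvars p \<union> mvars q" for p q :: "('v, 'k::comm_ring_1) mpoly"
proof
  fix v assume "v \<in> mvars (p * q)"
  then obtain m where m: "m \<in> Poly_Mapping.keys (p * q)" "v \<in> Poly_Mapping.keys m"
    by (auto simp: mvars_def)
  then obtain a b where ab: "m = a + b" "a \<in> Poly_Mapping.keys p" "b \<in> Poly_Mapping.keys q"
    using Poly_Mapping.keys_mult[of p q] by blast
  then show "v \<in> mvars p \<union> mvars q"
    using m(2) Poly_Mapping.keys_add[of a b] unfolding mvars_def by blast
qed

lemma cring_mpoly_ring: "cring (mpoly_ring V :: ('v, 'k::comm_ring_1) mpoly ring)"
proof (rule cringI)
  show "abelian_group (mpoly_ring V :: ('v, 'k) mpoly ring)"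
  proof (rule abelian_groupI)
    fix p :: "('v, 'k) mpoly" assume p: "p \<in> carrier (mpoly_ring V)"
    show "\<exists>q\<in>carrier (mpoly_ring V). q \<oplus>\<^bsub>mpoly_ring V\<^esub> p = \<zero>\<^bsub>mpoly_ring V\<^esub>"
    proof (rule bexI)
      show "- p \<oplus>\<^bsub>mpoly_ring V\<^esub> p = \<zero>\<^bsub>mpoly_ring V\<^esub>"
        by (simp add: mpoly_ring_def)
      show "- p \<in> carrier (mpoly_ring V)"
        using p by (simp add: mpoly_ring_def mvars_uminus)
    qed
  next
    fix p q :: "('v, 'k) mpoly"
    assume "p \<in> carrier (mpoly_ring V)" "q \<in> carrier (mpoly_ring V)"
    then show "p \<oplus>\<^bsub>mpoly_ring V\<^esub> q \<in> carrier (mpoly_ring V)"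
      using mvars_add[of p q] by (simp add: mpoly_ring_def) blast
  qed (simp_all add: mpoly_ring_def mvars_def add.assoc add.commute)
  show "Group.comm_monoid (mpoly_ring V :: ('v, 'k) mpoly ring)"
  proof (rule comm_monoidI)
    fix p q :: "('v, 'k) mpoly"
    assume "p \<in> carrier (mpoly_ring V)" "q \<in> carrier (mpoly_ring V)"
    then show "p \<otimes>\<^bsub>mpoly_ring V\<^esub> q \<in> carrier (mpoly_ring V)"
      using mvars_mult[of p q] by (simp add: mpoly_ring_def) blast
  next
    show "\<one>\<^bsub>mpoly_ring V\<^esub> \<in> carrier (mpoly_ring V :: ('v, 'k) mpoly ring)"
      by (simp add: mpoly_ring_def mvars_def flip: single_one)
  qed (simp_all add: mpoly_ring_def mult.assoc mult.commute)
qed (simp add: mpoly_ring_def distrib_right)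

text \<open>Points of the affine space with coordinates indexed by \<^term>\<open>V\<close> are functions vanishing outside
  \<^term>\<open>V\<close>. A subset of the projective space on \<^term>\<open>V\<close> is represented by the homogeneous coordinate
  vectors of its points.\<close>

definition affine_space :: "'v set \<Rightarrow> ('v \<Rightarrow> 'k::zero) set" where
  "affine_space V = {x. \<forall>v. v \<notin> V \<longrightarrow> x v = 0}"

definition zero_locus :: "'v set \<Rightarrow> ('v, 'k::comm_ring_1) mpoly set \<Rightarrow> ('v \<Rightarrow> 'k) set" where
  "zero_locus V F = {x \<in> affine_space V. \<forall>p\<in>F. meval id x p = 0}"

definition vanishing_ideal :: "'v set \<Rightarrow> ('v \<Rightarrow> 'k::comm_ring_1) set \<Rightarrow> ('v, 'k) mpoly set" where
  "vanishing_ideal V X = {p \<in> carrier (mpoly_ring V). \<forall>x\<in>X. meval id x p = 0}"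

definition zariski_closure :: "'v set \<Rightarrow> ('v \<Rightarrow> 'k::comm_ring_1) set \<Rightarrow> ('v \<Rightarrow> 'k) set" where
  "zariski_closure V X = zero_locus V (vanishing_ideal V X)"

text \<open>The affine cone over the embedded tangent space at the point \<^term>\<open>x\<close> of \<^term>\<open>X\<close>.\<close>

definition tangent_space ::
    "'v set \<Rightarrow> ('v \<Rightarrow> 'k::comm_ring_1) set \<Rightarrow> ('v \<Rightarrow> 'k) \<Rightarrow> ('v \<Rightarrow> 'k) set" where
  "tangent_space V X x = {t \<in> affine_space V.
     \<forall>p\<in>vanishing_ideal V X. (\<Sum>v\<in>V. meval id x (mderiv v p) * t v) = 0}"

text \<open>The affine cone over the projective dual variety of a smooth projective variety \<^term>\<open>X\<close> (with
  \<^term>\<open>V\<close> finite): the closure of the set of hyperplanes tangent to \<^term>\<open>X\<close> somewhere. As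
  \<^term>\<open>X\<close> is smooth, no points have to be excluded. The hyperplane with equation
  \<open>(\<Sum>v\<in>V. h v * t v) = 0\<close> is given by its coefficient vector \<^term>\<open>h\<close>; \<^term>\<open>h = (\<lambda>_. 0)\<close>
  is the vertex of the cone.\<close>

definition dual_variety :: "'v set \<Rightarrow> ('v \<Rightarrow> 'k::comm_ring_1) set \<Rightarrow> ('v \<Rightarrow> 'k) set" where
  "dual_variety V X = zariski_closure V
     {h \<in> affine_space V. \<exists>x\<in>X. \<forall>t\<in>tangent_space V X x. (\<Sum>v\<in>V. h v * t v) = 0}"

text \<open>Multi-indices and all other indices start from 0. A tensor of format
  \<open>d\<^sub>1 \<times> \<dots> \<times> d\<^sub>r\<close> is a point of \<open>affine_space (multi_indices [d\<^sub>1, \<dots>, d\<^sub>r])\<close>; in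
  particular the coordinate \<open>x\<^sub>i\<^sub>,\<^sub>J\<close> of an \<open>a \<times> b\<close> tensor is the one with index \<^term>\<open>i # J\<close> in
  \<^term>\<open>multi_indices (a # bs)\<close>.\<close>

definition multi_indices :: "nat list \<Rightarrow> nat list set" where
  "multi_indices ds = {J. length J = length ds \<and> (\<forall>l<length ds. J ! l < ds ! l)}"

text \<open>Homogeneous coordinates of the points of the product of the projective spaces of dimensions
  \<open>d\<^sub>l - 1\<close>.\<close>

definition multi_proj :: "nat list \<Rightarrow> (nat \<Rightarrow> 'k::zero) list set" where
  "multi_proj ds = {ys. length ys = length ds \<and>
     (\<forall>l<length ds. ys ! l \<in> affine_space {..<ds ! l} - {\<lambda>_. 0})}"

definition coord_monomial :: "(nat \<Rightarrow> 'k::comm_ring_1) list \<Rightarrow> nat list \<Rightarrow> 'k" where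
  "coord_monomial ys J = (\<Prod>l<length J. (ys ! l) (J ! l))"

definition segre :: "nat list \<Rightarrow> (nat list \<Rightarrow> 'k::comm_ring_1) set" where
  "segre ds =
     (\<lambda>ys J. if J \<in> multi_indices ds then coord_monomial ys J else 0) ` multi_proj ds"

text \<open>The hyperdeterminant is determined only up to sign, hence a predicate. Irreducibility is meant
  over the integers, so that primitivity is only needed to exclude constants. The dual variety lives
  in the dual tensor space, which is identified with the tensor space by the standard pairing of
  coordinates.\<close>

definition is_hyperdeterminant :: "nat list \<Rightarrow> (nat list, int) mpoly \<Rightarrow> bool" where
  "is_hyperdeterminant ds D \<longleftrightarrow>
     D \<in> carrier (mpoly_ring (multi_indices ds)) \<and>
     ring_irreducible\<^bsub>mpoly_ring (multi_indices ds)\<^esub> D \<and>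
     (\<forall>p::int. Factorial_Ring.prime p \<longrightarrow> \<not> (mconst p) divides\<^bsub>mpoly_ring (multi_indices ds)\<^esub> D) \<and>
     {x \<in> affine_space (multi_indices ds). meval of_int x D = (0::complex)} =
       dual_variety (multi_indices ds) (segre ds)"

definition tensor_form ::
    "nat list \<Rightarrow> (nat list \<Rightarrow> 'k::comm_ring_1) \<Rightarrow> nat \<Rightarrow> (nat \<Rightarrow> 'k) list \<Rightarrow> 'k" where
  "tensor_form bs A i ys = (\<Sum>J\<in>multi_indices bs. A (i # J) * coord_monomial ys J)"

text \<open>The points over \<^typ>\<open>'k\<close> of the incidence variety; a point of the product of projective spaces is
  given by all its homogeneous coordinates. For algebraically closed \<^typ>\<open>'k\<close>, the projection
  \<open>Y_locus\<close> is the set of \<^typ>\<open>'k\<close>-valued points of the image variety.\<close>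

definition Z_locus ::
    "nat \<Rightarrow> nat list \<Rightarrow> ((nat list \<Rightarrow> 'k::comm_ring_1) \<times> (nat \<Rightarrow> 'k) list) set" where
  "Z_locus a bs = {(A, ys) \<in> affine_space (multi_indices (a # bs)) \<times> multi_proj bs.
     \<forall>i<a. tensor_form bs A i ys = 0}"

definition Y_locus :: "nat \<Rightarrow> nat list \<Rightarrow> (nat list \<Rightarrow> 'k::comm_ring_1) set" where
  "Y_locus a bs = fst ` Z_locus a bs"

text \<open>For a matrix \<^term>\<open>C\<close> with \<^term>\<open>a\<close> columns, the entry of the tensor at \<^term>\<open>k # J\<close>, which is a
  polynomial in the entries of the universal tensor.\<close>

fun subtensor :: "nat \<Rightarrow> 'k::comm_ring_1 mat \<Rightarrow> nat list \<Rightarrow> (nat list, 'k) mpoly" where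
  "subtensor a C (k # J) = (\<Sum>i<a. mconst (C $$ (k, i)) * mvar (i # J))"
| "subtensor a C [] = 0"

definition subtensors :: "nat \<Rightarrow> nat \<Rightarrow> (nat list \<Rightarrow> (nat list, 'k::field) mpoly) set" where
  "subtensors a a' = {subtensor a C | C. C \<in> carrier_mat a' a \<and> vec_space.rank a' C = a'}"

definition hyperdet_ideal ::
    "nat \<Rightarrow> nat \<Rightarrow> nat list \<Rightarrow> (nat list, int) mpoly \<Rightarrow> (nat list, 'k::field) mpoly set" where
  "hyperdet_ideal a a' bs D = Idl\<^bsub>mpoly_ring (multi_indices (a # bs))\<^esub>
     {meval of_int \<phi> D | \<phi>. \<phi> \<in> subtensors a a'}"

end

theory Submission
  imports Defs "HOL-Library.List_Lexorder" "HOL-Library.Countable"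
begin

text \<open>
  The locus \<open>Y\<close> is parametrized, over every field, by the generic tensor
  \<open>\<eta>\<^sub>i\<^sub>J = \<Sum>\<^sub>J\<^sub>' (z\<^sub>i\<^sub>J\<^sub>J\<^sub>' - z\<^sub>i\<^sub>J\<^sub>'\<^sub>J) y\<^sub>J\<^sub>'\<close>, which has integer coefficients. By the extension theorem for
  places, a tensor over an algebraically closed field is in \<open>Y\<close> as soon as it is a zero of
  all integer polynomials vanishing at \<open>\<eta>\<close>.

  In the boundary format a tensor \<open>h\<close> with common zero \<open>y\<close> of its rows is tangent to the Segre variety
  at some \<open>(u, y)\<close>: the conditions on \<open>u\<close> are \<open>a' - 1\<close> homogeneous linear equations in \<open>a'\<close>
  unknowns. So the complex zeros of the hyperdeterminant \<open>D\<close> are the points of \<open>Y\<close>. As integer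
  polynomials factor uniquely, \<open>D\<close> divides all integer polynomials vanishing at \<open>\<eta>\<close>, and
  hence \<open>D\<close> defines \<open>Y\<close> over every algebraically closed field.

  If there are fewer than \<open>a'\<close> rows, then \<open>Y\<close> is the whole space: otherwise, fixing the other rows,
  \<open>D\<close> would be a polynomial without zeros in each entry of a row, hence constant. If there are more,
  a general linear projection preserves the absence of common zeros.
\<close>

text \<open>The obstacle is the characteristic: \<open>D\<close> is known only through its complex
  zeros, while the field of the theorem is arbitrary. The link is the prime ideal of all integer
  polynomials that vanish at the generic tensor. It is determined by the complex points of Y, hence
  generated by \<open>D\<close>, and divisibility over the integers survives reduction modulo every
  prime. The generic tensor comes from linear algebra. For fixed y, each row solves a single linear
  equation with coefficient vector (y_J). Over a field, where some y_J is invertible, the solutions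
  are the Koszul syzygies, i.e. alternating matrices applied to (y_J). No dimension theory enters.
  Closedness of Y rests on valuation rings: homogeneous coordinates can be divided by one that
  divides all the others, so one coordinate becomes 1 and the specialized vector cannot be zero.
  General projections exist by a count of monomials, and their center is found by a Kronecker
  substitution with powers of a single field element.\<close>

hide_const (open) up_ring.coeff up_ring.monom module.smult Divisibility.irreducible Divisibility.prime

section \<open>Evaluation of polynomials\<close>

lemma poly_mapping_sum_single:
  "p = (\<Sum>m\<in>Poly_Mapping.keys p. Poly_Mapping.single m (Poly_Mapping.lookup p m))"
  by (rule poly_mapping_eqI)
     (auto simp: lookup_sum lookup_single when_def sum.delta in_keys_iff
        intro!: sum.neutral[symmetric])

lemma monomial_as_prod:
  "Poly_Mapping.single m (1::'c::comm_ring_1) =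
     (\<Prod>v\<in>Poly_Mapping.keys m. mvar v ^ Poly_Mapping.lookup m v)"
proof -
  have pow: "mvar v ^ n = Poly_Mapping.single (Poly_Mapping.single v n) (1::'c)" for v :: 'a and n
    by (induction n) (auto simp: mvar_def mult_single simp flip: single_add)
  have "(\<Prod>v\<in>A. Poly_Mapping.single (Poly_Mapping.single v (Poly_Mapping.lookup m v)) (1::'c)) =
      Poly_Mapping.single (\<Sum>v\<in>A. Poly_Mapping.single v (Poly_Mapping.lookup m v)) 1" if "finite A" for A
    using that by (induction A rule: finite_induct) (auto simp: mult_single)
  from this[of "Poly_Mapping.keys m"] show ?thesis
    unfolding pow poly_mapping_sum_single[of m, symmetric] by simp
qed

lemma mvars_finite [simp]: "finite (mvars p)"
  by (simp add: mvars_def)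

lemma mvars_0 [simp]: "mvars 0 = {}"
  by (simp add: mvars_def)

lemma mvars_mconst [simp]: "mvars (mconst c) = {}"
  by (auto simp: mvars_def mconst_def split: if_splits)

lemma mvars_mvar: "mvars (mvar v) \<subseteq> {v}"
  by (auto simp: mvars_def mvar_def split: if_splits)

lemma mconst_0 [simp]: "mconst 0 = 0"
  by (simp add: mconst_def)

lemma mconst_1 [simp]: "mconst 1 = 1"
  by (simp add: mconst_def)

lemma mconst_add: "mconst (a + b) = mconst a + mconst b"
  by (simp add: mconst_def single_add)

lemma mconst_mult: "mconst (a * b) = mconst a * mconst b"
  by (simp add: mconst_def mult_single)

lemma mvars_1 [simp]: "mvars 1 = {}"
  by (auto simp: mvars_def)

lemma comm_ring_hom_mconst: "comm_ring_hom mconst"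
  by unfold_locales (auto simp: mconst_add mconst_mult)

lemma mvar_neq_0 [simp]: "mvar v \<noteq> (0 :: ('v, 'c::comm_ring_1) mpoly)"
  unfolding mvar_def by (metis lookup_single_eq lookup_zero zero_neq_one)

lemma mvars_subset_add: "mvars p \<subseteq> V \<Longrightarrow> mvars q \<subseteq> V \<Longrightarrow> mvars (p + q) \<subseteq> V"
  using mvars_add[of p q] by blast

lemma mvars_subset_mult:
  "mvars p \<subseteq> V \<Longrightarrow> mvars q \<subseteq> V \<Longrightarrow> mvars (p * q :: ('v, 'k::comm_ring_1) mpoly) \<subseteq> V"
  using mvars_mult[of p q] by blast

lemma mvars_subset_diff:
  "mvars p \<subseteq> V \<Longrightarrow> mvars q \<subseteq> V \<Longrightarrow> mvars (p - q :: ('v, 'k::comm_ring_1) mpoly) \<subseteq> V"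
  using mvars_subset_add[of p V "-q"] by (simp add: mvars_uminus)

lemma mvars_subset_power:
  "mvars p \<subseteq> V \<Longrightarrow> mvars (p ^ n :: ('v, 'k::comm_ring_1) mpoly) \<subseteq> V"
  by (induction n) (simp_all add: mvars_subset_mult)

lemma mvars_subset_sum:
  "(\<And>i. i \<in> I \<Longrightarrow> mvars (f i) \<subseteq> V) \<Longrightarrow> mvars (\<Sum>i\<in>I. f i :: ('v, 'k::comm_ring_1) mpoly) \<subseteq> V"
  by (induction I rule: infinite_finite_induct) (simp_all add: mvars_subset_add)

lemma mvars_subset_prod:
  "(\<And>i. i \<in> I \<Longrightarrow> mvars (f i) \<subseteq> V) \<Longrightarrow> mvars (\<Prod>i\<in>I. f i :: ('v, 'k::comm_ring_1) mpoly) \<subseteq> V"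
  by (induction I rule: infinite_finite_induct) (simp_all add: mvars_subset_mult)

lemma mvars_empty_conv:
  assumes "mvars p = {}"
  shows "p = mconst (Poly_Mapping.lookup p 0)"
proof (rule poly_mapping_eqI)
  fix m
  have "m = 0" if "Poly_Mapping.lookup p m \<noteq> 0"
  proof -
    have "m \<in> Poly_Mapping.keys p" using that by (simp add: in_keys_iff)
    then have "Poly_Mapping.keys m = {}" using assms by (auto simp: mvars_def)
    then show ?thesis by simp
  qed
  then show "Poly_Mapping.lookup p m = Poly_Mapping.lookup (mconst (Poly_Mapping.lookup p 0)) m"
    by (cases "m = 0") (auto simp: mconst_def lookup_single when_def)
qed

context comm_ring_hom
begin

definition mon_val :: "('v \<Rightarrow> 'b) \<Rightarrow> ('v \<Rightarrow>\<^sub>0 nat) \<Rightarrow> 'b" where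
  "mon_val x m = (\<Prod>v\<in>Poly_Mapping.keys m. x v ^ Poly_Mapping.lookup m v)"

lemma mon_val_superset:
  "finite W \<Longrightarrow> Poly_Mapping.keys m \<subseteq> W \<Longrightarrow> mon_val x m = (\<Prod>v\<in>W. x v ^ Poly_Mapping.lookup m v)"
  unfolding mon_val_def by (rule prod.mono_neutral_left) (auto simp: in_keys_iff)

lemma mon_val_add: "mon_val x (m + n) = mon_val x m * mon_val x n"
proof -
  let ?W = "Poly_Mapping.keys m \<union> Poly_Mapping.keys n"
  have "Poly_Mapping.keys (m + n) \<subseteq> ?W" by (rule Poly_Mapping.keys_add)
  then show ?thesis
    by (simp add: mon_val_superset[of ?W] lookup_add power_add prod.distrib)
qed

lemma meval_superset:
  assumes "finite M" "Poly_Mapping.keys p \<subseteq> M"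
  shows "meval hom x p = (\<Sum>m\<in>M. hom (Poly_Mapping.lookup p m) * mon_val x m)"
  unfolding meval_def mon_val_def[symmetric]
  by (rule sum.mono_neutral_left[OF assms]) (simp add: in_keys_iff)

lemma meval_add: "meval hom x (p + q) = meval hom x p + meval hom x q"
proof -
  let ?W = "Poly_Mapping.keys p \<union> Poly_Mapping.keys q"
  have "Poly_Mapping.keys (p + q) \<subseteq> ?W" by (rule Poly_Mapping.keys_add)
  then show ?thesis
    by (simp add: meval_superset[of ?W] lookup_add hom_add distrib_right sum.distrib)
qed

lemma meval_0: "meval hom x 0 = 0"
  by (simp add: meval_def)

lemma meval_sum: "meval hom x (\<Sum>i\<in>I. f i) = (\<Sum>i\<in>I. meval hom x (f i))"
  by (induction I rule: infinite_finite_induct) (auto simp: meval_0 meval_add)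

lemma meval_single: "meval hom x (Poly_Mapping.single m c) = hom c * mon_val x m"
  by (cases "c = 0") (auto simp: meval_def mon_val_def)

lemma meval_mult: "meval hom x (p * q) = meval hom x p * meval hom x q"
proof -
  have "p * q = (\<Sum>m\<in>Poly_Mapping.keys p. \<Sum>n\<in>Poly_Mapping.keys q.
      Poly_Mapping.single (m + n) (Poly_Mapping.lookup p m * Poly_Mapping.lookup q n))"
    unfolding mult_single[symmetric] sum_product[symmetric]
    by (rule arg_cong2[of _ _ _ _ "(*)"] poly_mapping_sum_single)+
  also have "meval hom x \<dots> = (\<Sum>m\<in>Poly_Mapping.keys p. \<Sum>n\<in>Poly_Mapping.keys q.
      (hom (Poly_Mapping.lookup p m) * mon_val x m) * (hom (Poly_Mapping.lookup q n) * mon_val x n))"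
    by (simp add: meval_sum meval_single mon_val_add hom_mult mult_ac)
  also have "\<dots> = meval hom x p * meval hom x q"
    unfolding sum_product[symmetric] by (simp add: meval_def mon_val_def)
  finally show ?thesis .
qed

lemma meval_mconst: "meval hom x (mconst c) = hom c"
  by (simp add: mconst_def meval_single mon_val_def)

lemma meval_mvar: "meval hom x (mvar v) = x v"
  by (simp add: mvar_def meval_single mon_val_def)

lemma meval_1: "meval hom x 1 = 1"
  using meval_mconst[of x 1] by simp

lemma comm_ring_hom_meval: "comm_ring_hom (meval hom x)"
  by unfold_locales (auto simp: meval_add meval_mult meval_0 meval_1)

text \<open>An induction over sums and products. With \<open>P\<close> a bound on the variables, it
  controls which variables survive a substitution.\<close>

lemma meval_mvars_subset:
  assumes "\<And>v. v \<in> mvars p \<Longrightarrow> P (x v)" "\<And>c. P (hom c)"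
    "\<And>a b. P a \<Longrightarrow> P b \<Longrightarrow> P (a + b)" "\<And>a b. P a \<Longrightarrow> P b \<Longrightarrow> P (a * b)"
  shows "P (meval hom x p)"
proof -
  have one: "P 1" using assms(2)[of 1] by simp
  have zero: "P 0" using assms(2)[of 0] by simp
  have pow: "P (a ^ n)" if "P a" for a n
    by (induction n) (auto simp: one intro: assms(4) that)
  have prod: "P (\<Prod>i\<in>I. f i)" if "\<And>i. i \<in> I \<Longrightarrow> P (f i)" for I and f :: "'v \<Rightarrow> 'b"
    using that by (induction I rule: infinite_finite_induct) (auto simp: one intro: assms(4))
  have sum: "P (\<Sum>i\<in>I. f i)" if "\<And>i. i \<in> I \<Longrightarrow> P (f i)" for I and f :: "('v \<Rightarrow>\<^sub>0 nat) \<Rightarrow> 'b"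
    using that by (induction I rule: infinite_finite_induct) (auto simp: zero intro: assms(3))
  show ?thesis
    unfolding meval_def by (intro sum assms(4) prod pow assms(1,2)) (auto simp: mvars_def)
qed

end

lemma meval_cong:
  "(\<And>v. v \<in> mvars p \<Longrightarrow> x v = y v) \<Longrightarrow> meval h x p = meval h y p"
  unfolding meval_def
  by (intro sum.cong arg_cong2[of _ _ _ _ "(*)"] prod.cong refl arg_cong2[of _ _ _ _ "(^)"])
     (auto simp: mvars_def)

lemma (in comm_ring_hom) hom_meval:
  "hom (meval h x p) = meval (\<lambda>c. hom (h c)) (\<lambda>v. hom (x v)) p"
  by (simp add: meval_def hom_distribs)

lemma meval_mconst_mvar [simp]: "meval mconst mvar p = p"
proof -
  have "meval mconst mvar p = (\<Sum>m\<in>Poly_Mapping.keys p. mconst (Poly_Mapping.lookup p m) * Poly_Mapping.single m 1)"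
    by (simp add: meval_def monomial_as_prod)
  also have "\<dots> = (\<Sum>m\<in>Poly_Mapping.keys p. Poly_Mapping.single m (Poly_Mapping.lookup p m))"
    by (simp add: mconst_def mult_single)
  also have "\<dots> = p"
    by (rule poly_mapping_sum_single[symmetric])
  finally show ?thesis .
qed

lemma comm_ring_hom_id: "comm_ring_hom id"
  by unfold_locales auto

lemma comm_ring_hom_of_int: "comm_ring_hom of_int"
  by unfold_locales auto

lemma comm_ring_hom_const_poly: "comm_ring_hom (\<lambda>c. [:c:])"
  by unfold_locales (auto simp: one_pCons)

lemma comm_ring_hom_poly: "comm_ring_hom (\<lambda>p. poly p a)"
  by unfold_locales auto

lemma comm_ring_hom_comp: "comm_ring_hom f \<Longrightarrow> comm_ring_hom g \<Longrightarrow> comm_ring_hom (\<lambda>x. f (g x))"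
proof -
  assume "comm_ring_hom f" "comm_ring_hom g"
  then interpret f: comm_ring_hom f + g: comm_ring_hom g by simp_all
  show ?thesis by unfold_locales (auto simp: f.hom_add g.hom_add f.hom_mult g.hom_mult)
qed

lemma comm_ring_hom_const_poly_mconst: "comm_ring_hom (\<lambda>c. [:mconst c:])"
  by (rule comm_ring_hom_comp[OF comm_ring_hom_const_poly comm_ring_hom_mconst])

section \<open>Polynomials in a main variable\<close>

text \<open>The coefficients stay in the type of all polynomials; that they avoid \<open>v\<close>
  is recorded by \<open>mvars_coeff_upoly\<close>.\<close>

definition upoly :: "'v \<Rightarrow> ('v, 'c::comm_ring_1) mpoly \<Rightarrow> ('v, 'c) mpoly poly" where
  "upoly v = meval (\<lambda>c. [:mconst c:]) (\<lambda>w. if w = v then [:0, 1:] else [:mvar w:])"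

definition vdeg :: "'v \<Rightarrow> ('v, 'c::comm_ring_1) mpoly \<Rightarrow> nat" where
  "vdeg v p = degree (upoly v p)"

definition vlc :: "'v \<Rightarrow> ('v, 'c::comm_ring_1) mpoly \<Rightarrow> ('v, 'c) mpoly" where
  "vlc v p = lead_coeff (upoly v p)"

interpretation upoly: comm_ring_hom "upoly v"
  unfolding upoly_def by (rule comm_ring_hom.comm_ring_hom_meval[OF comm_ring_hom_const_poly_mconst])

lemma poly_upoly: "poly (upoly v p) (mvar v) = p"
proof -
  interpret comm_ring_hom "\<lambda>q. poly q (mvar v)" by (rule comm_ring_hom_poly)
  have "poly (upoly v p) (mvar v) = meval mconst mvar p"
    unfolding upoly_def hom_meval
    by (intro arg_cong2[of _ _ _ _ "\<lambda>h x. meval h x p"]) auto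
  then show ?thesis by simp
qed

lemma upoly_eq_0_iff [simp]: "upoly v p = 0 \<longleftrightarrow> p = 0"
  by (metis poly_upoly upoly.hom_zero poly_0)

lemma upoly_const:
  assumes "v \<notin> mvars p"
  shows "upoly v p = [:p:]"
proof -
  have "upoly v p = meval (\<lambda>c. [:mconst c:]) (\<lambda>w. [:mvar w:]) p"
    unfolding upoly_def by (rule meval_cong) (use assms in auto)
  also have "\<dots> = [:meval mconst mvar p:]"
    by (rule comm_ring_hom.hom_meval[OF comm_ring_hom_const_poly, symmetric])
  finally show ?thesis by simp
qed

lemma upoly_mvar: "upoly v (mvar v) = [:0, 1:]"
  unfolding upoly_def by (simp add: comm_ring_hom.meval_mvar[OF comm_ring_hom_const_poly_mconst])

lemma mvars_coeff_upoly: "mvars (coeff (upoly v p) i) \<subseteq> mvars p - {v}"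
proof -
  interpret comm_ring_hom "\<lambda>c. [:mconst c:]" by (rule comm_ring_hom_const_poly_mconst)
  have "\<forall>i. mvars (coeff (upoly v p) i) \<subseteq> mvars p - {v}"
    unfolding upoly_def
  proof (rule meval_mvars_subset[where P = "\<lambda>q. \<forall>i. mvars (coeff q i) \<subseteq> mvars p - {v}"], goal_cases)
    case (1 w)
    then show ?case
      using mvars_mvar[of w] by (auto simp: coeff_pCons split: nat.splits)
  next
    case (2 c)
    then show ?case by (auto simp: coeff_pCons split: nat.splits)
  next
    case (3 a b)
    then show ?case by (simp add: mvars_subset_add)
  next
    case (4 a b)
    then show ?case unfolding coeff_mult by (intro allI mvars_subset_sum mvars_subset_mult) auto
  qed
  then show ?thesis by blast
qed

lemma mvars_vlc: "mvars (vlc v p) \<subseteq> mvars p - {v}"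
  unfolding vlc_def by (rule mvars_coeff_upoly)

lemma vlc_eq_0_iff [simp]: "vlc v p = 0 \<longleftrightarrow> p = 0"
  by (simp add: vlc_def)

lemma vdeg_eq_0_iff: "vdeg v p = 0 \<longleftrightarrow> v \<notin> mvars p"
proof
  assume "vdeg v p = 0"
  then obtain c where c: "upoly v p = [:c:]"
    unfolding vdeg_def by (meson degree_eq_zeroE)
  then have "p = c" using poly_upoly[of v p] by simp
  moreover have "mvars c \<subseteq> mvars p - {v}"
    using mvars_coeff_upoly[of v p 0] c by simp
  ultimately show "v \<notin> mvars p" by blast
qed (simp add: vdeg_def upoly_const)

lemma vlc_const: "v \<notin> mvars p \<Longrightarrow> vlc v p = p"
  by (simp add: vlc_def upoly_const)

lemma upoly_expansion: "p = (\<Sum>i\<le>vdeg v p. coeff (upoly v p) i * mvar v ^ i)"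
  using poly_upoly[of v p] by (simp add: poly_altdef vdeg_def)

text \<open>The coefficients with respect to \<open>v\<close> do not see the change of
  \<open>x\<close> at \<open>v\<close>, so a single coordinate can be moved to a root of the
  univariate polynomial \<open>P\<close>.\<close>

lemma (in comm_ring_hom) meval_upd:
  fixes p :: "('v, 'a) mpoly" and x :: "'v \<Rightarrow> 'b"
  shows "\<exists>P. (\<forall>i. coeff P i = meval hom x (coeff (upoly v p) i)) \<and>
       (\<forall>s. meval hom (x(v := s)) p = poly P s)"
proof (intro exI conjI allI)
  let ?P = "\<Sum>i\<le>vdeg v p. monom (meval hom x (coeff (upoly v p) i)) i"
  show "coeff ?P i = meval hom x (coeff (upoly v p) i)" for i
    by (auto simp: coeff_sum vdeg_def meval_0 not_le coeff_eq_0)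
  fix s
  interpret m: comm_ring_hom "meval hom (x(v := s))" by (rule comm_ring_hom_meval)
  have "meval hom (x(v := s)) p =
      (\<Sum>i\<le>vdeg v p. meval hom (x(v := s)) (coeff (upoly v p) i) * s ^ i)"
    by (subst upoly_expansion[of p v]) (simp add: m.hom_sum m.hom_mult m.hom_power meval_mvar)
  also have "\<dots> = (\<Sum>i\<le>vdeg v p. meval hom x (coeff (upoly v p) i) * s ^ i)"
    using mvars_coeff_upoly[of v p] by (intro sum.cong refl arg_cong2[of _ _ _ _ "(*)"] meval_cong) auto
  also have "\<dots> = poly ?P s"
    by (simp add: poly_sum poly_monom)
  finally show "meval hom (x(v := s)) p = poly ?P s" .
qed

text \<open>Induction on the variables: at a point where the leading coefficient in \<open>v\<close>
  survives, a nonzero univariate polynomial in \<open>v\<close> remains, and its finitely many roots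
  do not exhaust an infinite domain.\<close>

lemma nonvanishing_point:
  fixes h :: "'c::idom \<Rightarrow> 'k::idom" and p :: "('v, 'c) mpoly"
  assumes h: "comm_ring_hom h" "\<And>c. h c = 0 \<Longrightarrow> c = 0" and inf: "infinite (UNIV :: 'k set)"
    and p: "p \<noteq> 0"
  shows "\<exists>x. meval h x p \<noteq> 0"
proof -
  interpret comm_ring_hom h by fact
  have "\<exists>x. meval h x p \<noteq> 0" if "finite W" "mvars p \<subseteq> W" "p \<noteq> 0" for W and p :: "('v, 'c) mpoly"
    using that
  proof (induction W arbitrary: p rule: finite_induct)
    case empty
    then have *: "p = mconst (Poly_Mapping.lookup p 0)" using mvars_empty_conv[of p] by simp
    with empty have "Poly_Mapping.lookup p 0 \<noteq> 0" by force
    with h(2) have "meval h x p \<noteq> 0" for x by (subst *) (auto simp: meval_mconst)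
    then show ?case by blast
  next
    case (insert v W)
    have "mvars (vlc v p) \<subseteq> W" using insert.prems mvars_vlc[of v p] by blast
    then obtain x where x: "meval h x (vlc v p) \<noteq> 0"
      using insert.IH[of "vlc v p"] insert.prems by auto
    obtain P where P: "\<And>i. coeff P i = meval h x (coeff (upoly v p) i)"
      "\<And>s. meval h (x(v := s)) p = poly P s" using meval_upd[of x v p] by blast
    from x P(1)[of "degree (upoly v p)"] have "P \<noteq> 0" by (auto simp: vlc_def)
    then have "finite {s. poly P s = 0}" by (rule poly_roots_finite)
    with inf obtain s where "poly P s \<noteq> 0" by (metis (full_types) UNIV_eq_I mem_Collect_eq)
    with P(2) show ?case by metis
  qed
  from this[OF mvars_finite order.refl p] show ?thesis .
qed

text \<open>One step of pseudo-division: the leading terms cancel without fractions, because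
  \<open>u\<close> is first multiplied by the leading coefficient of \<open>w\<close>. The case
  \<open>u' = 0\<close> is separate since the zero polynomial has degree 0.\<close>

lemma vdeg_pseudo_reduction:
  fixes u w :: "('v, 'c::comm_ring_1) mpoly"
  assumes "vdeg v w \<le> vdeg v u"
  defines "u' \<equiv> vlc v w * u - vlc v u * mvar v ^ (vdeg v u - vdeg v w) * w"
  shows "u' = 0 \<or> vdeg v u' < vdeg v u"
proof -
  let ?k = "vdeg v u - vdeg v w"
  have c: "upoly v (vlc v q) = [:vlc v q:]" for q :: "('v, 'c) mpoly"
    using mvars_vlc[of v q] by (intro upoly_const) auto
  have "upoly v u' = smult (vlc v w) (upoly v u) - smult (vlc v u) (monom 1 ?k * upoly v w)"
    unfolding u'_def by (simp add: upoly.hom_minus upoly.hom_mult upoly.hom_power c upoly_mvar monom_altdef)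
  then have coeff: "coeff (upoly v u') i =
      vlc v w * coeff (upoly v u) i - vlc v u * (if i < ?k then 0 else coeff (upoly v w) (i - ?k))" for i
    by (simp add: coeff_monom_mult)
  have z: "coeff (upoly v u') i = 0" if "i \<ge> vdeg v u" for i
  proof (cases "i = vdeg v u")
    case True
    with assms(1) show ?thesis unfolding coeff by (auto simp: vlc_def vdeg_def mult.commute)
  next
    case False
    with that assms(1) have "i > degree (upoly v u)" "i - ?k > degree (upoly v w)"
      by (auto simp: vdeg_def)
    then show ?thesis unfolding coeff by (simp add: coeff_eq_0)
  qed
  show ?thesis
  proof (cases "u' = 0")
    case False
    then have "coeff (upoly v u') (vdeg v u') \<noteq> 0" by (simp add: vdeg_def)
    with z have "vdeg v u' < vdeg v u" by (meson not_le)
    then show ?thesis ..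
  qed simp
qed

text \<open>The order on the variables orders the monomials, which is what excludes zero divisors;
  hence leading coefficients multiply to something nonzero.\<close>

lemma vdeg_mult:
  "p \<noteq> 0 \<Longrightarrow> q \<noteq> 0 \<Longrightarrow> vdeg v (p * q :: ('v::linorder, 'c::idom) mpoly) = vdeg v p + vdeg v q"
  by (simp add: vdeg_def upoly.hom_mult degree_mult_eq)

lemma vlc_mult: "vlc v (p * q :: ('v::linorder, 'c::idom) mpoly) = vlc v p * vlc v q"
  by (simp add: vlc_def upoly.hom_mult lead_coeff_mult)

lemma mvars_factor:
  assumes "p * q \<noteq> (0 :: ('v::linorder, 'c::idom) mpoly)"
  shows "mvars p \<subseteq> mvars (p * q)" "mvars q \<subseteq> mvars (p * q)"
  using assms vdeg_eq_0_iff vdeg_mult by (metis add_is_0 mult_eq_0_iff subsetI)+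

section \<open>Unique factorization\<close>

text \<open>The total degree, read off after all variables are scaled by one new indeterminate. The
  value 1 of that indeterminate gives back the polynomial, the value 0 its constant term.\<close>

definition tdeg :: "('v, 'c::comm_ring_1) mpoly \<Rightarrow> nat" where
  "tdeg p = degree (meval (\<lambda>c. [:mconst c:]) (\<lambda>v. [:0, mvar v:]) p)"

definition coeff_norm :: "('v, int) mpoly \<Rightarrow> nat" where
  "coeff_norm p = (\<Sum>m\<in>Poly_Mapping.keys p. nat \<bar>Poly_Mapping.lookup p m\<bar>)"

lemma homogenize_at_1:
  "poly (meval (\<lambda>c. [:mconst c:]) (\<lambda>v. [:0, mvar v:]) p) 1 = p"
proof -
  interpret comm_ring_hom "\<lambda>q. poly q 1" by (rule comm_ring_hom_poly)
  show ?thesis unfolding hom_meval by simp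
qed

lemma tdeg_mult:
  fixes p q :: "('v::linorder, 'c::idom) mpoly"
  assumes "p \<noteq> 0" "q \<noteq> 0"
  shows "tdeg (p * q) = tdeg p + tdeg q"
proof -
  interpret comm_ring_hom "\<lambda>c. [:mconst c:]" by (rule comm_ring_hom_const_poly_mconst)
  show ?thesis
    unfolding tdeg_def meval_mult
  proof (rule degree_mult_eq)
    show "meval (\<lambda>c. [:mconst c:]) (\<lambda>v. [:0, mvar v:]) p \<noteq> 0"
      "meval (\<lambda>c. [:mconst c:]) (\<lambda>v. [:0, mvar v:]) q \<noteq> 0"
      using assms homogenize_at_1[of p] homogenize_at_1[of q] by auto
  qed
qed

lemma tdeg_0_const:
  assumes "tdeg p = 0"
  shows "\<exists>k. p = mconst k"
proof -
  obtain c where c: "meval (\<lambda>c. [:mconst c:]) (\<lambda>v. [:0, mvar v:]) p = [:c:]"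
    using assms unfolding tdeg_def by (meson degree_eq_zeroE)
  interpret comm_ring_hom "\<lambda>q. poly q 0" by (rule comm_ring_hom_poly)
  have "poly [:c:] 0 = meval mconst (\<lambda>_. 0) p"
    unfolding c[symmetric] hom_meval by simp
  also have "\<dots> = mconst (meval id (\<lambda>_. 0) p)"
    by (simp add: comm_ring_hom.hom_meval[OF comm_ring_hom_mconst])
  finally show ?thesis
    using homogenize_at_1[of p] c by (auto intro!: exI[of _ "meval id (\<lambda>_. 0) p"])
qed

lemma lookup_mult_mconst:
  "Poly_Mapping.lookup (p * mconst k) m = Poly_Mapping.lookup p m * (k::'c::comm_ring_1)"
proof -
  have "p * mconst k = (\<Sum>m\<in>Poly_Mapping.keys p. Poly_Mapping.single m (Poly_Mapping.lookup p m)) * mconst k"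
    by (rule arg_cong2[OF poly_mapping_sum_single refl])
  also have "\<dots> = (\<Sum>m\<in>Poly_Mapping.keys p. Poly_Mapping.single m (Poly_Mapping.lookup p m * k))"
    by (simp add: sum_distrib_right mconst_def mult_single)
  finally show ?thesis
    by (auto simp: lookup_sum lookup_single when_def in_keys_iff sum.delta)
qed

lemma coeff_norm_pos: "p \<noteq> 0 \<Longrightarrow> coeff_norm p > 0"
  unfolding coeff_norm_def by (rule sum_pos) (auto simp: in_keys_iff)

lemma coeff_norm_mult_mconst:
  assumes "k \<noteq> 0"
  shows "coeff_norm (p * mconst k) = coeff_norm p * nat \<bar>k\<bar>"
proof -
  have "Poly_Mapping.keys (p * mconst k) = Poly_Mapping.keys p"
    using assms by (auto simp: in_keys_iff lookup_mult_mconst)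
  then show ?thesis
    by (simp add: coeff_norm_def lookup_mult_mconst abs_mult nat_mult_distrib sum_distrib_right)
qed

lemma mconst_unit: "k dvd 1 \<Longrightarrow> mconst k dvd 1"
  by (metis dvdE dvdI mconst_1 mconst_mult)

text \<open>A nonconstant cofactor contributes to the total degree. A constant cofactor that is no
  unit has absolute value at least 2 and enlarges the sum of the absolute values of the
  coefficients.\<close>

lemma factor_measure:
  fixes a b :: "('v::linorder, int) mpoly"
  assumes "a * b \<noteq> 0" "\<not> b dvd 1"
  shows "(a, a * b) \<in> measures [tdeg, coeff_norm]"
proof (cases "tdeg b = 0")
  case True
  then obtain k where k: "b = mconst k" using tdeg_0_const by blast
  with assms have "k \<noteq> 0" by auto
  moreover have "\<bar>k\<bar> \<noteq> 1" using assms k mconst_unit[of k] by auto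
  ultimately have "\<bar>k\<bar> \<ge> 2" by linarith
  then have "coeff_norm (a * b) > coeff_norm a"
    using coeff_norm_pos[of a] assms(1) \<open>k \<noteq> 0\<close> by (auto simp: k coeff_norm_mult_mconst)
  moreover have "tdeg (a * b) = tdeg a" using True assms(1) by (simp add: tdeg_mult)
  ultimately show ?thesis by simp
next
  case False
  then show ?thesis using assms(1) by (simp add: tdeg_mult)
qed

text \<open>Existence of factorizations into irreducibles, cast as an induction rule: it is
  well-founded induction along \<open>factor_measure\<close>.\<close>

lemma mpoly_factor_induct [consumes 1, case_names unit irreducible mult]:
  fixes c :: "('v::linorder, int) mpoly"
  assumes "c \<noteq> 0"
    and "\<And>u. u dvd 1 \<Longrightarrow> P u"
    and "\<And>p. irreducible p \<Longrightarrow> P p"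
    and "\<And>a b. a * b \<noteq> 0 \<Longrightarrow> P a \<Longrightarrow> P b \<Longrightarrow> P (a * b)"
  shows "P c"
proof -
  have "wf (measures [tdeg, coeff_norm :: ('v, int) mpoly \<Rightarrow> nat])" by simp
  then show ?thesis using assms(1)
  proof (induction c rule: wf_induct_rule)
  case (less c)
  show ?case
  proof (cases "c dvd 1 \<or> irreducible c")
    case True
    then show ?thesis using assms(2,3) by blast
  next
    case False
    then obtain a b where ab: "c = a * b" "\<not> a dvd 1" "\<not> b dvd 1"
      using less(2) by (auto simp: Factorial_Ring.irreducible_def)
    have "P a" "P b"
      using less ab factor_measure[of a b] factor_measure[of b a] by (auto simp: mult.commute simp del: in_measures)
    then show ?thesis using assms(4) less(2) ab(1) by blast
  qed
  qed
qed

section \<open>Primality of irreducible polynomials\<close>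

definition prime_on :: "'v set \<Rightarrow> ('v, 'c::comm_ring_1) mpoly \<Rightarrow> bool" where
  "prime_on W p \<longleftrightarrow>
     (\<forall>g h. mvars g \<subseteq> W \<longrightarrow> mvars h \<subseteq> W \<longrightarrow> p dvd g * h \<longrightarrow> p dvd g \<or> p dvd h)"

lemma dvd_vlc:
  fixes p u :: "('v::linorder, 'c::idom) mpoly"
  shows "v \<notin> mvars p \<Longrightarrow> p dvd u \<Longrightarrow> p dvd vlc v u"
  by (auto simp: vlc_mult vlc_const)

lemma prime_on_insert:
  fixes p :: "('v::linorder, 'c::idom) mpoly"
  assumes v: "v \<notin> mvars p" and p: "prime_on W p"
  shows "prime_on (insert v W) p"
  unfolding prime_on_def
proof (intro allI impI)
  fix g h :: "('v, 'c) mpoly"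
  assume "mvars g \<subseteq> insert v W" "mvars h \<subseteq> insert v W" "p dvd g * h"
  then show "p dvd g \<or> p dvd h"
  proof (induction "vdeg v g + vdeg v h" arbitrary: g h rule: less_induct)
    case less
    have red: "p dvd g \<or> p dvd h"
      if g: "p dvd vlc v g" and *: "p dvd g * h" "mvars g \<subseteq> insert v W" "mvars h \<subseteq> insert v W"
        and IH: "\<And>g'. vdeg v g' < vdeg v g \<Longrightarrow> mvars g' \<subseteq> insert v W \<Longrightarrow> p dvd g' * h \<Longrightarrow> p dvd g' \<or> p dvd h"
      for g h
    proof -
      define g' where "g' = g - vlc v g * mvar v ^ vdeg v g"
      \<comment> \<open>Pseudo-reduction by the constant 1 removes just the leading term.\<close>
      have g': "g' = 0 \<or> vdeg v g' < vdeg v g"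
        using vdeg_pseudo_reduction[of v 1 g] by (simp add: g'_def vlc_const vdeg_def)
      have dvd: "p dvd vlc v g * mvar v ^ vdeg v g" using g by simp
      have "p dvd g' * h" unfolding g'_def left_diff_distrib using * g by (simp add: mult.assoc)
      moreover have "mvars g' \<subseteq> insert v W"
        unfolding g'_def using *(2) mvars_vlc[of v g] mvars_mvar[of v]
        by (intro mvars_subset_diff mvars_subset_mult mvars_subset_power) auto
      ultimately have "p dvd g' \<or> p dvd h" using g' IH by auto
      moreover have "g = g' + vlc v g * mvar v ^ vdeg v g" by (simp add: g'_def)
      ultimately show ?thesis using dvd by (metis dvd_add)
    qed
    have "p dvd vlc v (g * h)" using less.prems v by (intro dvd_vlc)
    moreover have "mvars (vlc v g) \<subseteq> W" "mvars (vlc v h) \<subseteq> W"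
      using less.prems mvars_vlc[of v g] mvars_vlc[of v h] by blast+
    ultimately consider "p dvd vlc v g" | "p dvd vlc v h"
      using p unfolding prime_on_def vlc_mult by blast
    then show ?case
    proof cases
      case 1
      show ?thesis by (rule red[OF 1]) (use less in auto)
    next
      case 2
      have "p dvd h \<or> p dvd g" by (rule red[OF 2]) (use less in \<open>auto simp: mult.commute\<close>)
      then show ?thesis by blast
    qed
  qed
qed

lemma prime_on_prime_elem:
  fixes p :: "('v::linorder, 'c::idom) mpoly"
  assumes "irreducible p" "mvars p \<subseteq> W" "prime_on W p"
  shows "prime_elem p"
proof -
  have "prime_on (W \<union> F) p" if "finite F" for F
    using that
  proof (induction F rule: finite_induct)
    case (insert v F)
    show ?case
    proof (cases "v \<in> mvars p")
      case True
      with assms(2) insert show ?thesis by (simp add: insert_absorb subset_iff)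
    next
      case False
      with prime_on_insert[OF False insert.IH] show ?thesis by simp
    qed
  qed (use assms in simp)
  then have "prime_on (W \<union> (mvars g \<union> mvars h)) p" for g h :: "('v, 'c) mpoly"
    by simp
  then have "p dvd g \<or> p dvd h" if "p dvd g * h" for g h
    using that unfolding prime_on_def by blast
  with assms(1) show ?thesis by (auto simp: prime_elem_def Factorial_Ring.irreducible_def)
qed

lemma irreducible_const_prime_on:
  fixes p :: "('v::linorder, int) mpoly"
  assumes "irreducible p" "mvars p = {}"
  shows "prime_on {} p"
proof -
  define k where "k = Poly_Mapping.lookup p 0"
  have k: "p = mconst k" unfolding k_def using assms(2) by (rule mvars_empty_conv)
  have c: "k dvd a" if dvd: "mconst k dvd (mconst a :: ('v, int) mpoly)" for a
  proof -
    obtain w where "(mconst a :: ('v, int) mpoly) = mconst k * w" using dvd by (elim dvdE)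
    then have w: "(mconst a :: ('v, int) mpoly) = w * mconst k" by (simp only: mult.commute)
    have "Poly_Mapping.lookup (mconst a :: ('v, int) mpoly) 0 = a" by (simp add: mconst_def)
    then show ?thesis unfolding w lookup_mult_mconst by (metis dvd_triv_right)
  qed
  have u: "a dvd 1" if dvd: "(mconst a :: ('v, int) mpoly) dvd 1" for a
  proof -
    obtain w where "(1 :: ('v, int) mpoly) = mconst a * w" using dvd by (elim dvdE)
    then have w: "(1 :: ('v, int) mpoly) = w * mconst a" by (simp only: mult.commute)
    have "Poly_Mapping.lookup (1 :: ('v, int) mpoly) 0 = 1" by simp
    then show ?thesis unfolding w lookup_mult_mconst by (metis dvd_triv_right)
  qed
  have "irreducible k"
  proof (rule Factorial_Ring.irreducibleI)
    show "k \<noteq> 0" using assms(1) k by auto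
    show "\<not> k dvd 1" using assms(1) k mconst_unit[of k] by (auto simp only: Factorial_Ring.irreducible_def)
    fix a b :: int assume "k = a * b"
    then have "p = mconst a * mconst b" by (simp add: k mconst_mult)
    with assms(1) show "a dvd 1 \<or> b dvd 1" unfolding Factorial_Ring.irreducible_def using u by blast
  qed
  then have "prime_elem k" by (rule irreducible_imp_prime_elem)
  show ?thesis
    unfolding prime_on_def
  proof (intro allI impI)
    fix g h :: "('v, int) mpoly"
    assume "mvars g \<subseteq> {}" "mvars h \<subseteq> {}" "p dvd g * h"
    then obtain a b where ab: "g = mconst a" "h = mconst b"
      using mvars_empty_conv[of g] mvars_empty_conv[of h] by auto
    with \<open>p dvd g * h\<close> have "k dvd a * b" using c by (simp add: k flip: mconst_mult)
    with \<open>prime_elem k\<close> have "k dvd a \<or> k dvd b" by (simp add: prime_elem_dvd_mult_iff)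
    then show "p dvd g \<or> p dvd h"
      unfolding ab k by (metis dvdE dvdI mconst_mult)
  qed
qed

text \<open>Primality of the irreducible factors lets \<open>c\<close> be distributed over
  \<open>q\<close> and \<open>r\<close> one factor at a time. This replaces greatest common divisors
  in the versions of Gauss's lemma below.\<close>

lemma primal:
  fixes c :: "('v::linorder, int) mpoly"
  assumes pr: "\<And>p :: ('v, int) mpoly. irreducible p \<Longrightarrow> mvars p \<subseteq> V \<Longrightarrow> prime_elem p"
    and c: "c \<noteq> 0" "mvars c \<subseteq> V" "c dvd q * r"
  shows "\<exists>c1 c2. c = c1 * c2 \<and> c1 dvd q \<and> c2 dvd r"
proof -
  have "mvars c \<subseteq> V \<longrightarrow> (\<forall>q r. c dvd q * r \<longrightarrow> (\<exists>c1 c2. c = c1 * c2 \<and> c1 dvd q \<and> c2 dvd r))"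
    using c(1)
  proof (induction c rule: mpoly_factor_induct)
    case (unit u)
    then show ?case by (metis dvd_trans mult.right_neutral one_dvd)
  next
    case (irreducible p)
    show ?case
    proof (intro impI allI)
      fix q r assume "mvars p \<subseteq> V" "p dvd q * r"
      with pr[OF irreducible] have "p dvd q \<or> p dvd r" by (simp add: prime_elem_dvd_mult_iff)
      then show "\<exists>c1 c2. p = c1 * c2 \<and> c1 dvd q \<and> c2 dvd r"
        by (metis mult.left_neutral mult.right_neutral one_dvd)
    qed
  next
    case (mult a b)
    show ?case
    proof (intro impI allI)
      fix q r assume *: "mvars (a * b) \<subseteq> V" "a * b dvd q * r"
      have sub: "mvars a \<subseteq> V" "mvars b \<subseteq> V" using mvars_factor[OF mult(1)] *(1) by auto
      have "a dvd q * r" using *(2) by (rule dvd_mult_left)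
      with mult(2) sub obtain a1 a2 where a: "a = a1 * a2" "a1 dvd q" "a2 dvd r" by blast
      then obtain q' r' where q': "q = a1 * q'" "r = a2 * r'" by (auto elim!: dvdE)
      have "a * b dvd a * (q' * r')" using *(2) by (simp add: q' a(1) mult_ac)
      then have "b dvd q' * r'" using mult(1) by simp
      with mult(3) sub obtain b1 b2 where b: "b = b1 * b2" "b1 dvd q'" "b2 dvd r'" by blast
      have "a * b = (a1 * b1) * (a2 * b2) \<and> a1 * b1 dvd q \<and> a2 * b2 dvd r"
        using a b q' by (auto simp: mult_ac mult_dvd_mono)
      then show "\<exists>c1 c2. a * b = c1 * c2 \<and> c1 dvd q \<and> c2 dvd r" by blast
    qed
  qed
  with c show ?thesis by blast
qed

text \<open>The inductive step from the variables \<open>V\<close> to one more variable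
  \<open>v\<close>. Irreducible polynomials that do not involve \<open>v\<close> are covered by the
  induction hypothesis \<open>pr\<close>, so \<open>f\<close> is assumed to involve it.\<close>

locale ufd_step =
  fixes V :: "'v::linorder set" and v :: 'v and f :: "('v, int) mpoly"
  assumes pr: "\<And>p :: ('v, int) mpoly. irreducible p \<Longrightarrow> mvars p \<subseteq> V \<Longrightarrow> prime_elem p"
    and v: "v \<notin> V"
    and f: "irreducible f" "mvars f \<subseteq> insert v V" "v \<in> mvars f"
begin

lemma f_nonzero: "f \<noteq> 0"
  using f(1) by auto

lemma unit_vars: "u dvd 1 \<Longrightarrow> mvars u = {}" for u :: "('v, int) mpoly"
  using mvars_factor(1)[of u] by (elim dvdE) (metis mvars_1 one_neq_zero subset_empty)

text \<open>Gauss's lemma: the part of \<open>c\<close> that divides \<open>f\<close> does not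
  involve \<open>v\<close>, so it is a unit by irreducibility, and \<open>c\<close> divides the
  cofactor up to this unit.\<close>

lemma dvd_cancel_const:
  assumes "c \<noteq> 0" "mvars c \<subseteq> V" "f dvd c * g"
  shows "f dvd g"
proof -
  obtain w where w: "c * g = f * w" using assms(3) by (elim dvdE)
  then have "c dvd f * w" by (metis dvd_triv_left)
  then obtain c1 c2 where c: "c = c1 * c2" "c1 dvd f" "c2 dvd w"
    using primal[OF pr assms(1,2)] by blast
  obtain s where s: "f = c1 * s" using c(2) by (elim dvdE)
  have "\<not> s dvd 1"
  proof
    assume "s dvd 1"
    then have "mvars s = {}" by (rule unit_vars)
    moreover have "mvars c1 \<subseteq> V" using mvars_factor(1)[of c1 c2] assms(1,2) c(1) by blast
    moreover have "mvars f \<subseteq> mvars c1 \<union> mvars s" unfolding s by (rule mvars_mult)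
    ultimately show False using f(3) v by blast
  qed
  then have "c1 dvd 1" using f(1) s unfolding Factorial_Ring.irreducible_def by blast
  then obtain t where t: "1 = c1 * t" by (elim dvdE)
  obtain w' where w': "w = c2 * w'" using c(3) by (elim dvdE)
  have "c * (f * w' * t) = (c1 * t) * (f * w)" by (simp add: c(1) w' mult_ac)
  also have "\<dots> = c * g" by (simp add: w flip: t)
  finally have "g = f * w' * t" using assms(1) by simp
  then show ?thesis by simp
qed

text \<open>Euclidean division, with the leading coefficients inverted, produces a common divisor of
  \<^term>\<open>f\<close> and \<^term>\<open>g\<close> up to factors not involving \<^term>\<open>v\<close>.\<close>

lemma bezout:
  assumes g: "mvars g \<subseteq> insert v V" "\<not> f dvd g"
  shows "\<exists>r \<alpha> \<beta>. r \<noteq> 0 \<and> mvars r \<subseteq> V \<and> r = \<alpha> * f + \<beta> * g"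
proof -
  \<comment> \<open>The ideal of \<open>f\<close> and \<open>g\<close> within the polynomials in
    \<open>insert v V\<close>. The bound on the variables keeps the leading coefficients in
    \<open>V\<close>, where \<open>primal\<close> applies.\<close>
  define S where "S = {u. \<exists>\<alpha> \<beta>. u = \<alpha> * f + \<beta> * g \<and> mvars \<alpha> \<subseteq> insert v V \<and> mvars \<beta> \<subseteq> insert v V}"
  have S_lin: "a * u - b * w \<in> S"
    if S: "u \<in> S" "w \<in> S" and ab: "mvars a \<subseteq> insert v V" "mvars b \<subseteq> insert v V" for a b u w
  proof -
    obtain \<alpha> \<beta> \<alpha>' \<beta>' where *: "u = \<alpha> * f + \<beta> * g" "w = \<alpha>' * f + \<beta>' * g"
      "mvars \<alpha> \<subseteq> insert v V" "mvars \<beta> \<subseteq> insert v V" "mvars \<alpha>' \<subseteq> insert v V" "mvars \<beta>' \<subseteq> insert v V"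
      using S unfolding S_def by blast
    have "a * u - b * w = (a * \<alpha> - b * \<alpha>') * f + (a * \<beta> - b * \<beta>') * g"
      by (simp add: * algebra_simps)
    moreover have "mvars (a * \<alpha> - b * \<alpha>') \<subseteq> insert v V" "mvars (a * \<beta> - b * \<beta>') \<subseteq> insert v V"
      using * ab by (simp_all add: mvars_subset_diff mvars_subset_mult)
    ultimately show ?thesis unfolding S_def by blast
  qed
  have fS: "f \<in> S" unfolding S_def by (rule CollectI, rule exI[of _ 1], rule exI[of _ 0]) simp
  have gS: "g \<in> S" unfolding S_def by (rule CollectI, rule exI[of _ 0], rule exI[of _ 1]) simp
  have S_vars: "mvars u \<subseteq> insert v V" if u: "u \<in> S" for u
  proof -
    obtain \<alpha> \<beta> where "u = \<alpha> * f + \<beta> * g" "mvars \<alpha> \<subseteq> insert v V" "mvars \<beta> \<subseteq> insert v V"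
      using u unfolding S_def by blast
    then show ?thesis
      using f(2) g(1) by (simp add: mvars_subset_add mvars_subset_mult)
  qed
  obtain r where r: "r \<in> S" "r \<noteq> 0" "\<And>u. u \<in> S \<Longrightarrow> u \<noteq> 0 \<Longrightarrow> vdeg v r \<le> vdeg v u"
    using ex_has_least_nat[of "\<lambda>u. u \<in> S \<and> u \<noteq> 0" f "vdeg v"] fS f_nonzero by blast
  have lc: "mvars (vlc v u) \<subseteq> V" if "u \<in> S" for u
    using S_vars[OF that] mvars_vlc[of v u] by blast
  \<comment> \<open>Pseudo-division by an element \<open>r\<close> of least degree ends with
    remainder 0; the factor \<open>c\<close> collects the powers of its leading coefficient.\<close>
  have div: "\<exists>c. c \<noteq> 0 \<and> mvars c \<subseteq> V \<and> r dvd c * u" if "u \<in> S" for u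
    using that
  proof (induction "vdeg v u" arbitrary: u rule: less_induct)
    case less
    show ?case
    proof (cases "u = 0")
      case True
      then show ?thesis by (intro exI[of _ 1]) simp
    next
      case False
      with less.prems r(3) have deg: "vdeg v r \<le> vdeg v u" by blast
      define b where "b = vlc v u * mvar v ^ (vdeg v u - vdeg v r)"
      define u' where "u' = vlc v r * u - b * r"
      have "mvars b \<subseteq> insert v V"
        unfolding b_def using lc[OF less.prems] mvars_mvar[of v]
        by (intro mvars_subset_mult mvars_subset_power) auto
      then have "u' \<in> S"
        unfolding u'_def using less.prems r(1) lc[OF r(1)] by (intro S_lin) auto
      moreover have "u' = 0 \<or> vdeg v u' < vdeg v u"
        using vdeg_pseudo_reduction[OF deg] by (simp add: u'_def b_def)
      ultimately have "\<exists>c. c \<noteq> 0 \<and> mvars c \<subseteq> V \<and> r dvd c * u'"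
        using less.hyps[of u'] by (cases "u' = 0") (auto intro!: exI[of _ 1])
      then obtain c where c: "c \<noteq> 0" "mvars c \<subseteq> V" "r dvd c * u'" by blast
      have "(c * vlc v r) * u = c * u' + r * (c * b)" by (simp add: u'_def algebra_simps)
      then have "r dvd (c * vlc v r) * u" using c(3) by simp
      moreover have "c * vlc v r \<noteq> 0" using c(1) r(2) by simp
      moreover have "mvars (c * vlc v r) \<subseteq> V" using c(2) lc[OF r(1)] by (rule mvars_subset_mult)
      ultimately show ?thesis by blast
    qed
  qed
  obtain c where c: "c \<noteq> 0" "mvars c \<subseteq> V" "r dvd c * f" using div[OF fS] by blast
  obtain c' where c': "c' \<noteq> 0" "mvars c' \<subseteq> V" "r dvd c' * g" using div[OF gS] by blast
  obtain q where q: "c * f = r * q" using c(3) by (elim dvdE)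
  then have "c dvd r * q" by (metis dvd_triv_left)
  then obtain c1 c2 where c12: "c = c1 * c2" "c1 dvd r" "c2 dvd q"
    using primal[OF pr c(1,2)] by blast
  obtain r' q' where r': "r = c1 * r'" "q = c2 * q'" using c12(2,3) by (elim dvdE)
  have "c * f = (c1 * r') * (c2 * q')" using q r' by simp
  also have "\<dots> = c * (r' * q')" by (simp add: c12(1) mult_ac)
  finally have "c * f = c * (r' * q')" .
  then have frq: "f = r' * q'" using c(1) by simp
  have c1V: "mvars c1 \<subseteq> V" "c1 \<noteq> 0"
    using mvars_factor(1)[of c1 c2] c(1,2) c12(1) by auto
  \<comment> \<open>If \<open>r'\<close> is a unit, \<open>r\<close> is associated to
    \<open>c1\<close>, which is free of \<open>v\<close>. If \<open>q'\<close> is a unit,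
    \<open>f\<close> divides \<open>r\<close> and hence \<open>c' * g\<close>, which contradicts
    \<open>g(2)\<close> after cancellation of \<open>c'\<close>.\<close>
  from f(1) frq consider "r' dvd 1" | "q' dvd 1"
    unfolding Factorial_Ring.irreducible_def by blast
  then show ?thesis
  proof cases
    case 1
    then obtain t where t: "1 = r' * t" by (elim dvdE)
    obtain \<alpha> \<beta> where "r = \<alpha> * f + \<beta> * g" using r(1) by (auto simp: S_def)
    then have "(t * \<alpha>) * f + (t * \<beta>) * g = t * r" by (simp only: distrib_left mult.assoc)
    also have "\<dots> = c1 * (r' * t)" by (simp only: r'(1) mult_ac)
    also have "\<dots> = c1" by (simp flip: t)
    finally have "c1 = (t * \<alpha>) * f + (t * \<beta>) * g" ..
    with c1V show ?thesis by blast
  next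
    case 2
    then obtain t where t: "1 = q' * t" by (elim dvdE)
    have "r' = r' * (q' * t)" using t by simp
    then have "r' = f * t" by (simp add: frq mult.assoc)
    then have "f dvd r" unfolding r'(1) by simp
    then have "f dvd c' * g" using c'(3) by (rule dvd_trans)
    then have "f dvd g" by (rule dvd_cancel_const[OF c'(1,2)])
    with g(2) show ?thesis by blast
  qed
qed

text \<open>As in Euclid's lemma, the Bezout relation for \<open>f\<close> and \<open>g\<close> is
  multiplied by \<open>h\<close>, and then \<open>r\<close>, being free of \<open>v\<close>, is
  cancelled.\<close>

lemma f_prime: "prime_elem f"
proof (rule prime_on_prime_elem[OF f(1,2)], unfold prime_on_def, intro allI impI)
  fix g h :: "('v, int) mpoly"
  assume *: "mvars g \<subseteq> insert v V" "f dvd g * h"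
  show "f dvd g \<or> f dvd h"
  proof (cases "f dvd g")
    case False
    then obtain r \<alpha> \<beta> where r: "r \<noteq> 0" "mvars r \<subseteq> V" "r = \<alpha> * f + \<beta> * g"
      using bezout[OF *(1) False] by (elim exE conjE)
    have "r * h = f * (\<alpha> * h) + \<beta> * (g * h)" by (simp add: r(3) algebra_simps)
    then have "f dvd r * h" using *(2) by simp
    then have "f dvd h" by (rule dvd_cancel_const[OF r(1,2)])
    then show ?thesis ..
  qed simp
qed

end

lemma irreducible_prime_elem:
  fixes f :: "('v::linorder, int) mpoly"
  assumes "irreducible f"
  shows "prime_elem f"
proof -
  have "prime_elem f" if "finite V" "irreducible f" "mvars f \<subseteq> V" for V and f :: "('v, int) mpoly"
    using that
  proof (induction V arbitrary: f rule: finite_induct)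
    case empty
    then show ?case using prime_on_prime_elem[OF empty(1)] irreducible_const_prime_on by blast
  next
    case (insert v V)
    show ?case
    proof (cases "v \<in> mvars f")
      case True
      have "ufd_step V v f"
      proof (rule ufd_step.intro)
        fix p :: "('v, int) mpoly"
        assume "irreducible p" "mvars p \<subseteq> V"
        then show "prime_elem p" by (rule insert.IH)
      qed (fact insert.hyps insert.prems True)+
      then show ?thesis by (rule ufd_step.f_prime)
    next
      case False
      with insert show ?thesis by (simp add: subset_insert)
    qed
  qed
  from this[OF mvars_finite assms order.refl] show ?thesis .
qed

text \<open>The polynomial \<open>r\<close> plays the role of the resultant of \<open>f\<close> and
  \<open>g\<close> with respect to \<open>v\<close>: all other variables are counted among the
  coefficients.\<close>

lemma irreducible_bezout:
  fixes f g :: "('v::linorder, int) mpoly"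
  assumes "irreducible f" "v \<in> mvars f" "\<not> f dvd g"
  shows "\<exists>r \<alpha> \<beta>. r \<noteq> 0 \<and> v \<notin> mvars r \<and> r = \<alpha> * f + \<beta> * g"
proof -
  have step: "ufd_step (mvars f \<union> mvars g - {v}) v f"
  proof (rule ufd_step.intro)
    fix p :: "('v, int) mpoly"
    assume "irreducible p"
    then show "prime_elem p" by (rule irreducible_prime_elem)
  qed (use assms(1,2) in blast)+
  have "mvars g \<subseteq> insert v (mvars f \<union> mvars g - {v})" by blast
  from ufd_step.bezout[OF step this assms(3)] obtain r \<alpha> \<beta>
    where r: "r \<noteq> 0" "mvars r \<subseteq> mvars f \<union> mvars g - {v}" "r = \<alpha> * f + \<beta> * g"
    by (elim exE conjE)
  then have "v \<notin> mvars r" by blast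
  with r(1,3) show ?thesis by (intro exI conjI)
qed

text \<open>The Nullstellensatz for an irreducible hypersurface, by elimination. Otherwise some
  nonzero \<open>r\<close> free of \<open>v\<close> lies in the ideal of \<open>D\<close> and
  \<open>F\<close>; over a point with \<open>r\<close> nonzero, \<open>D\<close> still has a root in
  the coordinate \<open>v\<close>, where \<open>r\<close> would have to vanish.\<close>

lemma irreducible_dvd_if_vanishing:
  fixes D F :: "('v::linorder, int) mpoly"
  assumes D: "irreducible D" "v \<in> mvars D"
    and van: "\<And>x :: 'v \<Rightarrow> 'k::{alg_closed_field, field_char_0}. meval of_int x D = 0 \<Longrightarrow> meval of_int x F = 0"
  shows "D dvd F"
proof (rule ccontr)
  assume "\<not> D dvd F"
  then obtain r \<alpha> \<beta> where r: "r \<noteq> 0" "v \<notin> mvars r" "r = \<alpha> * D + \<beta> * F"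
    using irreducible_bezout[OF D \<open>\<not> D dvd F\<close>] by (elim exE conjE)
  have "D \<noteq> 0" using D(1) by auto
  \<comment> \<open>The factor \<open>vlc v D\<close> keeps the degree of \<open>D\<close> in
    \<open>v\<close> positive at the chosen point, so that a root exists.\<close>
  with r have "r * vlc v D \<noteq> 0" by simp
  have "\<exists>x :: 'v \<Rightarrow> 'k. meval of_int x (r * vlc v D) \<noteq> 0"
    by (rule nonvanishing_point[OF comm_ring_hom_of_int _ infinite_UNIV_char_0])
       (use \<open>r * vlc v D \<noteq> 0\<close> in simp_all)
  then obtain x :: "'v \<Rightarrow> 'k" where x: "meval of_int x (r * vlc v D) \<noteq> 0" by blast
  obtain P where P: "\<And>i. coeff P i = meval of_int x (coeff (upoly v D) i)"
    "\<And>s. meval of_int (x(v := s)) D = poly P s" using comm_ring_hom.meval_upd[OF comm_ring_hom_of_int, of x v D] by blast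
  have "coeff P (vdeg v D) \<noteq> 0" using x by (simp add: P comm_ring_hom.meval_mult[OF comm_ring_hom_of_int] vdeg_def flip: vlc_def)
  moreover have "vdeg v D > 0" using D(2) vdeg_eq_0_iff[of v D] by auto
  ultimately have "degree P > 0" using le_degree[of P "vdeg v D"] by linarith
  then obtain s where "poly P s = 0" using alg_closed_imp_poly_has_root by blast
  then have D0: "meval of_int (x(v := s)) D = 0" using P(2) by simp
  have "meval of_int x r = meval of_int (x(v := s)) r" using r(2) by (intro meval_cong) auto
  also have "\<dots> = 0" unfolding r(3) using D0 van[OF D0] by (simp add: comm_ring_hom.meval_add[OF comm_ring_hom_of_int] comm_ring_hom.meval_mult[OF comm_ring_hom_of_int])
  finally show False using x by (simp add: comm_ring_hom.meval_mult[OF comm_ring_hom_of_int])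
qed

section \<open>Extension of ring homomorphisms\<close>

text \<open>Graphs of ring homomorphisms from subrings of \<open>'a\<close> to \<open>'b\<close>. As
  the graph is closed under subtraction, the last clause says that it is single-valued. Extension of
  homomorphisms becomes inclusion, which suits Zorn's lemma.\<close>

definition partial_hom :: "('a::field \<times> 'b::field) set \<Rightarrow> bool" where
  "partial_hom G \<longleftrightarrow> (1, 1) \<in> G \<and>
     (\<forall>a b c d. (a, b) \<in> G \<longrightarrow> (c, d) \<in> G \<longrightarrow> (a + c, b + d) \<in> G \<and> (a * c, b * d) \<in> G) \<and>
     (\<forall>a b. (a, b) \<in> G \<longrightarrow> (- a, - b) \<in> G) \<and> (\<forall>c. (0, c) \<in> G \<longrightarrow> c = 0)"

lemma partial_homI:
  assumes "(1, 1) \<in> G" "\<And>a b c d. (a, b) \<in> G \<Longrightarrow> (c, d) \<in> G \<Longrightarrow> (a + c, b + d) \<in> G"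
    "\<And>a b c d. (a, b) \<in> G \<Longrightarrow> (c, d) \<in> G \<Longrightarrow> (a * c, b * d) \<in> G"
    "\<And>a b. (a, b) \<in> G \<Longrightarrow> (- a, - b) \<in> G" "\<And>c. (0, c) \<in> G \<Longrightarrow> c = 0"
  shows "partial_hom G"
  unfolding partial_hom_def using assms by blast

lemma partial_homD:
  assumes "partial_hom G"
  shows "(1, 1) \<in> G" "(a, b) \<in> G \<Longrightarrow> (c, d) \<in> G \<Longrightarrow> (a + c, b + d) \<in> G"
    "(a, b) \<in> G \<Longrightarrow> (c, d) \<in> G \<Longrightarrow> (a * c, b * d) \<in> G"
    "(a, b) \<in> G \<Longrightarrow> (- a, - b) \<in> G" "(0, b) \<in> G \<Longrightarrow> b = 0"
  using assms unfolding partial_hom_def by blast+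

text \<open>Places in the sense of Chevalley: the aim is \<open>valuation_ring\<close>, that the
  domain of a maximal homomorphism is a valuation ring.\<close>

locale maximal_partial_hom =
  fixes G :: "('a::field \<times> 'b::alg_closed_field) set"
  assumes ph: "partial_hom G"
    and maximal: "\<And>G'. partial_hom G' \<Longrightarrow> G \<subseteq> G' \<Longrightarrow> G' = G"
begin

lemma one: "(1, 1) \<in> G"
  and add: "(a, b) \<in> G \<Longrightarrow> (c, d) \<in> G \<Longrightarrow> (a + c, b + d) \<in> G"
  and mult: "(a, b) \<in> G \<Longrightarrow> (c, d) \<in> G \<Longrightarrow> (a * c, b * d) \<in> G"
  and minus: "(a, b) \<in> G \<Longrightarrow> (- a, - b) \<in> G"
  and zeroD: "(0, b) \<in> G \<Longrightarrow> b = 0"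
  by (fact partial_homD[OF ph])+

lemma zero: "(0, 0) \<in> G"
  using add[OF one minus[OF one]] by simp

lemma diff: "(a, b) \<in> G \<Longrightarrow> (c, d) \<in> G \<Longrightarrow> (a - c, b - d) \<in> G"
  using add[of a b "- c" "- d"] minus by simp

lemma functional: "(a, b) \<in> G \<Longrightarrow> (a, c) \<in> G \<Longrightarrow> b = c"
  using diff[of a b a c] zeroD by force

lemma power: "(a, b) \<in> G \<Longrightarrow> (a ^ n, b ^ n) \<in> G"
  by (induction n) (auto intro: one mult)

lemma sum: "(\<And>i. i \<in> I \<Longrightarrow> (f i, g i) \<in> G) \<Longrightarrow> (\<Sum>i\<in>I. f i, \<Sum>i\<in>I. g i) \<in> G"
  by (induction I rule: infinite_finite_induct) (auto intro: zero add)

lemma prod: "(\<And>i. i \<in> I \<Longrightarrow> (f i, g i) \<in> G) \<Longrightarrow> (\<Prod>i\<in>I. f i, \<Prod>i\<in>I. g i) \<in> G"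
  by (induction I rule: infinite_finite_induct) (auto intro: one mult)

text \<open>The homomorphism extends to the fractions with powers of \<open>t\<close> as
  denominators, so by maximality these are already in its domain. Hence all elements outside the
  kernel are units.\<close>

lemma inverse:
  assumes t: "(t, c) \<in> G" "c \<noteq> 0"
  shows "(inverse t, inverse c) \<in> G"
proof -
  have t0: "t \<noteq> 0" using t zeroD by blast
  define G' where "G' = {(u / t ^ n, d / c ^ n) | u d n. (u, d) \<in> G}"
  have G'I: "(x, y) \<in> G'" if "(u, d) \<in> G" "x = u / t ^ n" "y = d / c ^ n" for u d n x y
    using that unfolding G'_def by blast
  have "partial_hom G'"
  proof (rule partial_homI)
    show "(1, 1) \<in> G'" by (rule G'I[OF one, of _ 0]) auto
    show "b = 0" if "(0, b) \<in> G'" for b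
      using that t0 zeroD by (auto simp: G'_def)
    show "(- a, - b) \<in> G'" if "(a, b) \<in> G'" for a b
    proof -
      from that obtain u d n where "(u, d) \<in> G" "a = u / t ^ n" "b = d / c ^ n"
        unfolding G'_def by blast
      then show ?thesis by (intro G'I[OF minus[of u d], of _ n]) auto
    qed
    fix a b a' b' assume "(a, b) \<in> G'" "(a', b') \<in> G'"
    then obtain u d n u' d' n' where *: "(u, d) \<in> G" "a = u / t ^ n" "b = d / c ^ n"
      "(u', d') \<in> G" "a' = u' / t ^ n'" "b' = d' / c ^ n'"
      unfolding G'_def by blast
    show "(a * a', b * b') \<in> G'"
      by (rule G'I[OF mult[OF *(1,4)], of _ "n + n'"]) (auto simp: * power_add)
    show "(a + a', b + b') \<in> G'"
      by (rule G'I[OF add[OF mult[OF *(1) power[OF t(1), of n']] mult[OF *(4) power[OF t(1), of n]]], of _ "n + n'"])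
         (use t0 t(2) in \<open>auto simp: * power_add field_simps\<close>)
  qed
  moreover have "G \<subseteq> G'" using G'I[of _ _ _ 0] by auto
  ultimately have "G' = G" by (rule maximal)
  moreover have "(inverse t, inverse c) \<in> G'"
    by (rule G'I[OF one, of _ 1]) (auto simp: inverse_eq_divide)
  ultimately show ?thesis by simp
qed

section \<open>Adjoining an element and the valuation ring property\<close>

definition GX :: "('a poly \<times> 'b poly) set" where
  "GX = {(p, q). \<forall>i. (coeff p i, coeff q i) \<in> G}"

lemma GX_add: "(p, q) \<in> GX \<Longrightarrow> (p', q') \<in> GX \<Longrightarrow> (p + p', q + q') \<in> GX"
  by (auto simp: GX_def intro: add)

lemma GX_diff: "(p, q) \<in> GX \<Longrightarrow> (p', q') \<in> GX \<Longrightarrow> (p - p', q - q') \<in> GX"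
  by (auto simp: GX_def intro: diff)

lemma GX_minus: "(p, q) \<in> GX \<Longrightarrow> (- p, - q) \<in> GX"
  by (auto simp: GX_def intro: minus)

lemma GX_mult: "(p, q) \<in> GX \<Longrightarrow> (p', q') \<in> GX \<Longrightarrow> (p * p', q * q') \<in> GX"
  by (auto simp: GX_def coeff_mult intro!: sum mult)

lemma GX_const: "(a, b) \<in> G \<Longrightarrow> ([:a:], [:b:]) \<in> GX"
  by (auto simp: GX_def coeff_pCons zero split: nat.splits)

lemma GX_smult: "(a, b) \<in> G \<Longrightarrow> (p, q) \<in> GX \<Longrightarrow> (smult a p, smult b q) \<in> GX"
  by (auto simp: GX_def intro: mult)

lemma GX_monom: "(monom 1 n, monom 1 n) \<in> GX"
  by (auto simp: GX_def zero one)

text \<open>The ring hom extends to \<^term>\<open>t\<close> unless the ideal generated by its kernel in the ring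
  obtained by adjoining \<^term>\<open>t\<close> is the unit ideal.\<close>

lemma adjoin:
  assumes unit: "\<And>p. (p, 1) \<in> GX \<Longrightarrow> poly p t \<noteq> 0"
  shows "t \<in> Domain G"
proof -
  \<comment> \<open>The images of the polynomial relations of \<open>t\<close>. A common root
    \<open>c\<close> of them is a consistent value for \<open>t\<close>.\<close>
  define J where "J = {q. \<exists>p. (p, q) \<in> GX \<and> poly p t = 0}"
  have "\<exists>c. \<forall>q\<in>J. poly q c = 0"
  proof (cases "J \<subseteq> {0}")
    case False
    then obtain q0 where q0: "q0 \<in> J" "q0 \<noteq> 0" "\<And>q. q \<in> J \<Longrightarrow> q \<noteq> 0 \<Longrightarrow> degree q0 \<le> degree q"
      using ex_has_least_nat[of "\<lambda>q. q \<in> J \<and> q \<noteq> 0" _ degree] by blast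
    obtain p0 where p0: "(p0, q0) \<in> GX" "poly p0 t = 0" using q0(1) by (auto simp: J_def)
    have lc: "(coeff p0 (degree q0), lead_coeff q0) \<in> G" using p0(1) by (auto simp: GX_def)
    have lc_inv: "(inverse (coeff p0 (degree q0)), inverse (lead_coeff q0)) \<in> G"
      using inverse[OF lc] q0(2) by simp
    \<comment> \<open>A nonzero constant in \<open>J\<close> could be scaled to 1 by
      \<open>lc_inv\<close> and would give a relation excluded by \<open>unit\<close>.\<close>
    have "degree q0 > 0"
    proof (rule ccontr)
      assume "\<not> degree q0 > 0"
      then have "q0 = [:lead_coeff q0:]" by (metis degree_eq_zeroE gr0I lead_coeff_pCons(2) pCons_0_0 lead_coeff_pCons(1))
      then have "smult (inverse (lead_coeff q0)) q0 = 1"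
        using q0(2) by (metis left_inverse leading_coeff_0_iff one_pCons smult_pCons smult_0_right)
      with GX_smult[OF lc_inv p0(1)] unit p0(2) show False by force
    qed
    then obtain c where c: "poly q0 c = 0" using alg_closed_imp_poly_has_root by blast
    have "poly q c = 0" if "q \<in> J" for q
      using that
    proof (induction "degree q" arbitrary: q rule: less_induct)
      case less
      show ?case
      proof (cases "q = 0")
        case False
        obtain p where p: "(p, q) \<in> GX" "poly p t = 0" using less.prems by (auto simp: J_def)
        define k where "k = degree q - degree q0"
        have deg: "degree q = k + degree q0" using q0(3)[OF less.prems False] by (simp add: k_def)
        define s where "s = lead_coeff q * inverse (lead_coeff q0)"
        define q' where "q' = q - smult s (monom 1 k * q0)"
        have "(coeff p (degree q) * inverse (coeff p0 (degree q0)), s) \<in> G"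
          unfolding s_def using p(1) by (intro mult lc_inv) (auto simp: GX_def)
        from GX_diff[OF p(1) GX_smult[OF this GX_mult[OF GX_monom p0(1), of k]]]
        have q'J: "q' \<in> J" unfolding J_def q'_def using p(2) p0(2) by force
        have z: "coeff q' i = 0" if "i \<ge> degree q" for i
          using that q0(2) deg
          by (cases "i = degree q") (auto simp: q'_def s_def coeff_monom_mult coeff_eq_0)
        have "poly q' c = 0"
        proof (cases "q' = 0")
          case False
          then have "degree q' < degree q" using z[of "degree q'"] by (metis leading_coeff_0_iff not_le)
          then show ?thesis using less.hyps q'J by blast
        qed simp
        then show ?thesis using c by (simp add: q'_def)
      qed simp
    qed
    then show ?thesis by blast
  next
    case True
    \<comment> \<open>All relations have image zero, so every value is admissible; 0 is
      taken.\<close>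
    then have "\<forall>q\<in>J. poly q 0 = 0" by auto
    then show ?thesis ..
  qed
  then obtain c where c: "\<And>p q. (p, q) \<in> GX \<Longrightarrow> poly p t = 0 \<Longrightarrow> poly q c = 0"
    unfolding J_def by blast
  define G' where "G' = {(poly p t, poly q c) | p q. (p, q) \<in> GX}"
  have G'I: "(poly p t, poly q c) \<in> G'" if "(p, q) \<in> GX" for p q
    using that unfolding G'_def by blast
  have "partial_hom G'"
  proof (rule partial_homI)
    show "(1, 1) \<in> G'" using G'I[OF GX_const[OF one]] by simp
    show "b = 0" if "(0, b) \<in> G'" for b
      using that c by (auto simp: G'_def)
    show "(- a, - b) \<in> G'" if "(a, b) \<in> G'" for a b
      using that G'I[OF GX_minus] by (fastforce simp: G'_def)
    fix a b a' b' assume "(a, b) \<in> G'" "(a', b') \<in> G'"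
    then obtain p q p' q' where *: "(p, q) \<in> GX" "a = poly p t" "b = poly q c"
      "(p', q') \<in> GX" "a' = poly p' t" "b' = poly q' c"
      unfolding G'_def by blast
    show "(a * a', b * b') \<in> G'" using G'I[OF GX_mult[OF *(1,4)]] * by simp
    show "(a + a', b + b') \<in> G'" using G'I[OF GX_add[OF *(1,4)]] * by simp
  qed
  moreover have "G \<subseteq> G'" using G'I[OF GX_const] by fastforce
  ultimately have "G' = G" by (rule maximal)
  moreover have "(t, c) \<in> G'" using G'I[OF GX_monom[of 1]] by (simp add: poly_monom)
  ultimately show ?thesis by blast
qed

text \<open>A pair (p, 1) in \<open>GX\<close> with p(t) = 0 is a relation with constant term
  congruent to 1 and all other coefficients in the kernel. The reversed relation for
  \<open>inverse t\<close> has a unit as its leading coefficient and can therefore be used to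
  shorten the relation for \<open>t\<close>.\<close>

lemma relation_reduce:
  assumes t: "t \<noteq> 0" and p: "(p, 1) \<in> GX" "poly p t = 0"
    and r: "(r, 1) \<in> GX" "poly r (inverse t) = 0" and deg: "degree r \<le> degree p"
  shows "\<exists>p'. (p', 1) \<in> GX \<and> poly p' t = 0 \<and> degree p' < degree p"
proof -
  let ?n = "degree p" and ?m = "degree r"
  have rG: "(coeff r i, of_bool (i = 0)) \<in> G" and pG: "(coeff p i, of_bool (i = 0)) \<in> G" for i
    using r(1) p(1) by (simp_all add: GX_def)
  have rc: "(coeff r 0, 1) \<in> G" using rG[of 0] by simp
  have rc': "(coeff r i, 0) \<in> G" if "i > 0" for i using rG[of i] that by simp
  have pc: "(coeff p 0, 1) \<in> G" using pG[of 0] by simp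
  have pc': "(coeff p i, 0) \<in> G" if "i > 0" for i using pG[of i] that by simp
  have r0: "coeff r 0 \<noteq> 0" using rc zeroD by force
  have p0: "coeff p 0 \<noteq> 0" using pc zeroD by force
  have "?n > 0"
  proof (rule ccontr)
    assume "\<not> ?n > 0"
    then have "p = [:coeff p 0:]" by (metis degree_0_id gr0I)
    then have "poly p t = coeff p 0" by (metis poly_pCons poly_0 mult_zero_right add.right_neutral)
    with p(2) p0 show False by simp
  qed
  \<comment> \<open>The relation for \<open>inverse t\<close> read as one for \<open>t\<close>, with
    \<open>coeff r 0\<close> as leading coefficient.\<close>
  define R where "R = reflect_poly r"
  have R: "degree R = ?m" "lead_coeff R = coeff r 0" "poly R t = 0"
    using r0 r(2) t by (simp_all add: R_def degree_reflect_poly_eq poly_reflect_poly_nz coeff_reflect_poly)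
  have RG: "\<exists>b. (coeff R i, b) \<in> G" for i
    using rc rc'[of "?m - i"] zero
    by (cases i ?m rule: linorder_cases) (auto simp: R_def coeff_reflect_poly)
  define s where "s = lead_coeff p * inverse (coeff r 0)"
  \<comment> \<open>The leading coefficient of \<open>p\<close> is in the kernel because
    \<open>p\<close> is not constant; so a multiple by \<open>s\<close> can be subtracted without
    changing the image 1 of \<open>p\<close>.\<close>
  have s: "(s, 0) \<in> G"
    using mult[OF pc'[OF \<open>?n > 0\<close>] inverse[OF rc]] by (simp add: s_def)
  define p' where "p' = p - smult s (monom 1 (?n - ?m) * R)"
  have "(coeff p' i, coeff 1 i) \<in> G" for i
  proof -
    have "\<exists>b. (coeff (monom 1 (?n - ?m) * R) i, b) \<in> G"
      using RG zero by (auto simp: coeff_monom_mult)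
    then obtain b where "(coeff (monom 1 (?n - ?m) * R) i, b) \<in> G" ..
    from diff[OF _ mult[OF s this], of "coeff p i" "coeff 1 i"] p(1) show ?thesis
      by (simp add: p'_def GX_def)
  qed
  then have "(p', 1) \<in> GX" by (simp add: GX_def)
  moreover have "poly p' t = 0" using p(2) R(3) by (simp add: p'_def)
  moreover have "degree p' < ?n"
  proof -
    have z: "coeff p' i = 0" if "i \<ge> ?n" for i
      using that R deg r0
      by (cases "i = ?n") (auto simp: p'_def s_def coeff_monom_mult coeff_eq_0)
    show ?thesis
    proof (cases "p' = 0")
      case False
      then show ?thesis using z[of "degree p'"] by (metis leading_coeff_0_iff not_le)
    qed (use \<open>?n > 0\<close> in simp)
  qed
  ultimately show ?thesis by blast
qed

text \<open>If both extensions failed, \<open>t\<close> and \<open>inverse t\<close> would have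
  relations of least degree, and the longer one could be shortened by the other.\<close>

lemma valuation_ring:
  assumes "t \<noteq> 0"
  shows "t \<in> Domain G \<or> inverse t \<in> Domain G"
proof (rule ccontr)
  assume "\<not> ?thesis"
  then obtain p0 r0 where p0: "(p0, 1) \<in> GX \<and> poly p0 t = 0"
    and r0: "(r0, 1) \<in> GX \<and> poly r0 (inverse t) = 0"
    using adjoin by blast
  obtain p where "(p, 1) \<in> GX \<and> poly p t = 0"
      and p_min: "\<And>p'. (p', 1) \<in> GX \<and> poly p' t = 0 \<Longrightarrow> degree p \<le> degree p'"
    using ex_has_least_nat[of "\<lambda>p. (p, 1) \<in> GX \<and> poly p t = 0", OF p0, of degree] by (elim exE conjE) blast
  then have p: "(p, 1) \<in> GX" "poly p t = 0" by blast+
  obtain r where "(r, 1) \<in> GX \<and> poly r (inverse t) = 0"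
      and r_min: "\<And>p'. (p', 1) \<in> GX \<and> poly p' (inverse t) = 0 \<Longrightarrow> degree r \<le> degree p'"
    using ex_has_least_nat[of "\<lambda>p. (p, 1) \<in> GX \<and> poly p (inverse t) = 0", OF r0, of degree] by (elim exE conjE) blast
  then have r: "(r, 1) \<in> GX" "poly r (inverse t) = 0" by blast+
  show False
  proof (cases "degree r \<le> degree p")
    case True
    from relation_reduce[OF assms p r True] p_min show False by (meson not_le)
  next
    case False
    have "\<exists>p'. (p', 1) \<in> GX \<and> poly p' (inverse t) = 0 \<and> degree p' < degree r"
      by (rule relation_reduce[of "inverse t" r p]) (use assms p r False in auto)
    with r_min show False by (meson not_le)
  qed
qed

text \<open>Divisibility in a valuation ring is total, so one of finitely many elements divides all
  the others. Homogeneous coordinates divided by it lie in the domain, and one of them is 1.\<close>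

lemma max_ratio:
  assumes "finite I" "i0 \<in> I" "y i0 \<noteq> 0"
  shows "\<exists>j\<in>I. y j \<noteq> 0 \<and> (\<forall>i\<in>I. y i / y j \<in> Domain G)"
proof -
  have "I = {} \<or> (\<forall>i\<in>I. y i = 0) \<or> (\<exists>j\<in>I. y j \<noteq> 0 \<and> (\<forall>i\<in>I. y i / y j \<in> Domain G))"
    using assms(1)
  proof (induction I rule: finite_induct)
    case (insert a I)
    have dom: "0 \<in> Domain G" "1 \<in> Domain G" using zero one by auto
    show ?case
    proof (cases "\<exists>j\<in>I. y j \<noteq> 0 \<and> (\<forall>i\<in>I. y i / y j \<in> Domain G)")
      case False
      with insert.IH have z: "\<forall>i\<in>I. y i = 0" by blast
      show ?thesis
      proof (cases "y a = 0")
        case False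
        then have "\<forall>i\<in>insert a I. y i / y a \<in> Domain G" using z dom by auto
        with False show ?thesis by blast
      qed (use z in auto)
    next
      case True
      then obtain j where j: "j \<in> I" "y j \<noteq> 0" "\<forall>i\<in>I. y i / y j \<in> Domain G" by blast
      show ?thesis
      proof (cases "y a / y j \<in> Domain G")
        case True
        with j show ?thesis by blast
      next
        case False
        then have a: "y a \<noteq> 0" using dom by auto
        then have "y j / y a \<in> Domain G"
          using valuation_ring[of "y a / y j"] False j(2) by auto
        then have "y i / y j * (y j / y a) \<in> Domain G" if "i \<in> I" for i
          using j(3) that mult by blast
        then have "\<forall>i\<in>insert a I. y i / y a \<in> Domain G" using j(2) a dom by auto
        with a show ?thesis by blast
      qed
    qed
  qed simp
  with assms show ?thesis by blast
qed

end

lemma maximal_partial_hom_exists: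
  assumes "partial_hom (G0 :: ('a::field \<times> 'b::alg_closed_field) set)"
  shows "\<exists>G. G0 \<subseteq> G \<and> maximal_partial_hom G"
proof -
  let ?A = "{G. partial_hom G \<and> G0 \<subseteq> G}"
  have "\<exists>M\<in>?A. \<forall>X\<in>?A. M \<subseteq> X \<longrightarrow> X = M"
  proof (rule subset_Zorn_nonempty)
    have "G0 \<in> ?A" using assms by simp
    then show "?A \<noteq> {}" by (metis emptyE)
    fix C assume C: "C \<noteq> {}" "subset.chain ?A C"
    then have sub: "\<And>G. G \<in> C \<Longrightarrow> partial_hom G \<and> G0 \<subseteq> G" by (auto simp: subset.chain_def)
    have both: "\<exists>G\<in>C. x \<in> G \<and> y \<in> G" if xy: "x \<in> \<Union>C" "y \<in> \<Union>C" for x y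
    proof -
      obtain X Y where XY: "X \<in> C" "Y \<in> C" "x \<in> X" "y \<in> Y" using xy by blast
      with C(2) have "X \<subseteq> Y \<or> Y \<subseteq> X" unfolding subset.chain_def by blast
      with XY show ?thesis by blast
    qed
    have "partial_hom (\<Union>C)"
    proof (rule partial_homI)
      obtain G where "G \<in> C" using C(1) by blast
      with partial_homD(1)[of G] sub show "(1, 1) \<in> \<Union>C" by blast
      show "b = 0" if "(0, b) \<in> \<Union>C" for b using that sub partial_homD(5) by blast
      show "(- a, - b) \<in> \<Union>C" if "(a, b) \<in> \<Union>C" for a b
        using that sub partial_homD(4) by blast
      fix a b c d assume "(a, b) \<in> \<Union>C" "(c, d) \<in> \<Union>C"
      then obtain G where G: "G \<in> C" "(a, b) \<in> G" "(c, d) \<in> G" using both by blast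
      with partial_homD(2,3)[of G a b c d] sub show "(a + c, b + d) \<in> \<Union>C" "(a * c, b * d) \<in> \<Union>C"
        by blast+
    qed
    moreover have "G0 \<subseteq> \<Union>C" using C(1) sub by blast
    ultimately show "\<Union>C \<in> ?A" by simp
  qed
  then obtain M where M: "M \<in> ?A" "\<forall>X\<in>?A. M \<subseteq> X \<longrightarrow> X = M" by (elim bexE)
  have "maximal_partial_hom M"
  proof (rule maximal_partial_hom.intro)
    show "partial_hom M" using M(1) by simp
    fix G' assume "partial_hom G'" "M \<subseteq> G'"
    with M show "G' = M" by (metis (no_types, lifting) mem_Collect_eq order_trans)
  qed
  with M(1) show ?thesis by blast
qed

section \<open>The generic tensor with a common zero of its rows\<close>

lemma Cons_in_multi_indices [simp]:
  "k # J \<in> multi_indices (d # ds) \<longleftrightarrow> k < d \<and> J \<in> multi_indices ds"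
  by (auto simp: multi_indices_def less_Suc_eq_0_disj all_conj_distrib nth_Cons split: nat.splits)

lemma Nil_notin_multi_indices [simp]: "[] \<notin> multi_indices (d # ds)"
  by (simp add: multi_indices_def)

lemma multi_indices_ConsE:
  assumes "K \<in> multi_indices (d # ds)"
  obtains k J where "K = k # J" "k < d" "J \<in> multi_indices ds"
  using assms by (cases K) auto

lemma multi_indices_Nil [simp]: "multi_indices [] = {[]}"
  by (auto simp: multi_indices_def)

lemma multi_indices_Cons: "multi_indices (d # ds) = (\<lambda>(k, J). k # J) ` ({..<d} \<times> multi_indices ds)"
  by (auto elim!: multi_indices_ConsE)

lemma finite_multi_indices [simp]: "finite (multi_indices ds)"
  by (induction ds) (simp_all add: multi_indices_Cons)

lemma multi_indicesD:
  assumes "J \<in> multi_indices ds"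
  shows "length J = length ds" "l < length ds \<Longrightarrow> J ! l < ds ! l"
  using assms by (auto simp: multi_indices_def)

lemma coord_monomial_map:
  assumes "comm_ring_hom h" "length J \<le> length ys"
  shows "coord_monomial (map (\<lambda>y j. h (y j)) ys) J = h (coord_monomial ys J)"
proof -
  interpret comm_ring_hom h by fact
  show ?thesis using assms(2) by (simp add: coord_monomial_def hom_prod)
qed

text \<open>Each row is an alternating matrix applied to the vector of the coordinate monomials and
  hence orthogonal to that vector.\<close>

definition gen_tensor :: "nat \<Rightarrow> nat list \<Rightarrow> (nat \<Rightarrow> nat list \<Rightarrow> nat list \<Rightarrow> 'r::comm_ring_1) \<Rightarrow>
    (nat \<Rightarrow> 'r) list \<Rightarrow> nat list \<Rightarrow> 'r" where
  "gen_tensor a bs z ys K = (if K \<in> multi_indices (a # bs) then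
     \<Sum>J'\<in>multi_indices bs. (z (hd K) (tl K) J' - z (hd K) J' (tl K)) * coord_monomial ys J' else 0)"

lemma gen_tensor_affine: "gen_tensor a bs z ys \<in> affine_space (multi_indices (a # bs))"
  by (simp add: affine_space_def gen_tensor_def)

lemma tensor_form_gen_tensor:
  assumes "i < a"
  shows "tensor_form bs (gen_tensor a bs z ys) i ys = 0"
proof -
  let ?M = "multi_indices bs" and ?c = "coord_monomial ys"
  have "tensor_form bs (gen_tensor a bs z ys) i ys =
      (\<Sum>J\<in>?M. \<Sum>J'\<in>?M. z i J J' * ?c J' * ?c J - z i J' J * ?c J' * ?c J)"
    using assms by (simp add: tensor_form_def gen_tensor_def sum_distrib_right left_diff_distrib)
  also have "\<dots> = (\<Sum>J\<in>?M. \<Sum>J'\<in>?M. z i J J' * ?c J' * ?c J) - (\<Sum>J\<in>?M. \<Sum>J'\<in>?M. z i J' J * ?c J' * ?c J)"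
    by (simp add: sum_subtractf)
  also have "(\<Sum>J\<in>?M. \<Sum>J'\<in>?M. z i J' J * ?c J' * ?c J) = (\<Sum>J\<in>?M. \<Sum>J'\<in>?M. z i J J' * ?c J' * ?c J)"
    by (subst sum.swap) (simp add: mult_ac)
  finally show ?thesis by simp
qed

lemma coord_monomial_nonzero_exists:
  fixes ys :: "(nat \<Rightarrow> 'k::idom) list"
  assumes "ys \<in> multi_proj bs"
  shows "\<exists>J\<in>multi_indices bs. coord_monomial ys J \<noteq> 0"
proof -
  have "\<exists>j. j < bs ! l \<and> (ys ! l) j \<noteq> 0" if "l < length bs" for l
  proof -
    have *: "ys ! l \<in> affine_space {..<bs ! l}" "ys ! l \<noteq> (\<lambda>_. 0)"
      using assms that by (auto simp: multi_proj_def)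
    then obtain j where "(ys ! l) j \<noteq> 0" by blast
    with *(1) show ?thesis by (auto simp: affine_space_def)
  qed
  then obtain f where f: "\<And>l. l < length bs \<Longrightarrow> f l < bs ! l \<and> (ys ! l) (f l) \<noteq> 0" by metis
  let ?J = "map f [0..<length bs]"
  have "?J \<in> multi_indices bs" using f by (simp add: multi_indices_def)
  moreover have "coord_monomial ys ?J \<noteq> 0" using f by (simp add: coord_monomial_def)
  ultimately show ?thesis by blast
qed

text \<open>A nonzero coordinate monomial makes the Koszul syzygies generate all solutions of the
  equation of a row.\<close>

lemma gen_tensor_surj:
  fixes A :: "nat list \<Rightarrow> 'k::field"
  assumes A: "A \<in> affine_space (multi_indices (a # bs))" and ys: "ys \<in> multi_proj bs"
    and form: "\<And>i. i < a \<Longrightarrow> tensor_form bs A i ys = 0"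
  shows "\<exists>z. A = gen_tensor a bs z ys"
proof -
  obtain J0 where J0: "J0 \<in> multi_indices bs" "coord_monomial ys J0 \<noteq> 0"
    using coord_monomial_nonzero_exists[OF ys] by blast
  let ?M = "multi_indices bs" and ?c = "coord_monomial ys"
  \<comment> \<open>Only the column \<open>J0\<close> is used: it produces the entries at all other
    indices directly.\<close>
  define z where "z = (\<lambda>i J J'. if J' = J0 then A (i # J) / ?c J0 else 0)"
  have "A K = gen_tensor a bs z ys K" for K
  proof (cases "K \<in> multi_indices (a # bs)")
    case False
    with A show ?thesis by (simp add: gen_tensor_def affine_space_def)
  next
    case True
    then obtain i J where K: "K = i # J" "i < a" "J \<in> ?M" by (rule multi_indices_ConsE)
    have "gen_tensor a bs z ys K = (\<Sum>J'\<in>?M. (z i J J' - z i J' J) * ?c J')"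
      using K by (simp add: gen_tensor_def)
    also have "\<dots> = A K"
    proof (cases "J = J0")
      case False
      then have "(\<Sum>J'\<in>?M. (z i J J' - z i J' J) * ?c J') = (\<Sum>J'\<in>?M. if J' = J0 then A K else 0)"
        using J0(2) K(1) by (intro sum.cong) (auto simp: z_def)
      then show ?thesis using J0(1) by simp
    next
      case True
      have "(\<Sum>J'\<in>?M. (z i J J' - z i J' J) * ?c J') = (\<Sum>J'\<in>?M - {J0}. (z i J0 J' - z i J' J0) * ?c J')"
        using J0(1) True by (subst sum.remove[of _ J0]) auto
      also have "\<dots> = (\<Sum>J'\<in>?M - {J0}. - (A (i # J') * ?c J') / ?c J0)"
        by (intro sum.cong) (auto simp: z_def)
      also have "\<dots> = - (\<Sum>J'\<in>?M - {J0}. A (i # J') * ?c J') / ?c J0"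
        by (simp add: sum_negf sum_divide_distrib)
      \<comment> \<open>The diagonal contributes nothing to the entry at \<open>J0\<close>; the
        equation of the row recovers this entry from the others.\<close>
      also have "(\<Sum>J'\<in>?M - {J0}. A (i # J') * ?c J') = - (A (i # J0) * ?c J0)"
        using form[OF K(2)] J0(1) unfolding tensor_form_def
        by (subst (asm) sum.remove[of _ J0]) (auto simp: eq_neg_iff_add_eq_0 add.commute)
      finally show ?thesis using J0(2) True K(1) by simp
    qed
    finally show ?thesis ..
  qed
  then show ?thesis by blast
qed

section \<open>The generic tensor and its specializations\<close>

definition zcode :: "nat \<Rightarrow> nat list \<Rightarrow> nat list \<Rightarrow> nat" where
  "zcode i J J' = to_nat (Inl (i, J, J') :: (nat \<times> nat list \<times> nat list) + (nat \<times> nat))"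

definition ycode :: "nat \<Rightarrow> nat \<Rightarrow> nat" where
  "ycode l j = to_nat (Inr (l, j) :: (nat \<times> nat list \<times> nat list) + (nat \<times> nat))"

definition generic_point :: "nat list \<Rightarrow> (nat \<Rightarrow> (nat, int) mpoly) list" where
  "generic_point bs = map (\<lambda>l j. mvar (ycode l j)) [0..<length bs]"

definition generic_tensor :: "nat \<Rightarrow> nat list \<Rightarrow> nat list \<Rightarrow> (nat, int) mpoly" where
  "generic_tensor a bs = gen_tensor a bs (\<lambda>i J J'. mvar (zcode i J J')) (generic_point bs)"

lemma hom_gen_tensor:
  assumes "comm_ring_hom h" "length ys = length bs"
  shows "h (gen_tensor a bs z ys K) =
    gen_tensor a bs (\<lambda>i J J'. h (z i J J')) (map (\<lambda>y j. h (y j)) ys) K"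
proof -
  interpret comm_ring_hom h by fact
  show ?thesis
    by (auto simp: gen_tensor_def hom_sum hom_mult hom_minus
        coord_monomial_map[OF assms(1)] assms(2) multi_indicesD(1) intro!: sum.cong)
qed

lemma meval_generic_tensor:
  fixes \<sigma> :: "nat \<Rightarrow> 'r::comm_ring_1"
  shows "meval of_int \<sigma> (generic_tensor a bs K) =
    gen_tensor a bs (\<lambda>i J J'. \<sigma> (zcode i J J')) (map (\<lambda>l j. \<sigma> (ycode l j)) [0..<length bs]) K"
proof -
  interpret h: comm_ring_hom "meval of_int \<sigma>"
    by (rule comm_ring_hom.comm_ring_hom_meval[OF comm_ring_hom_of_int])
  show ?thesis
    unfolding generic_tensor_def generic_point_def
    by (subst hom_gen_tensor[OF h.comm_ring_hom_axioms])
       (simp_all add: comm_ring_hom.meval_mvar[OF comm_ring_hom_of_int] o_def)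
qed

lemma meval_at_generic_tensor:
  fixes \<sigma> :: "nat \<Rightarrow> 'r::comm_ring_1"
  shows "meval of_int \<sigma> (meval mconst (generic_tensor a bs) F) =
     meval of_int (gen_tensor a bs (\<lambda>i J J'. \<sigma> (zcode i J J')) (map (\<lambda>l j. \<sigma> (ycode l j)) [0..<length bs])) F"
  unfolding comm_ring_hom.hom_meval[OF comm_ring_hom.comm_ring_hom_meval[OF comm_ring_hom_of_int]]
  by (simp add: meval_generic_tensor comm_ring_hom.meval_mconst[OF comm_ring_hom_of_int])

text \<open>In every characteristic, a point of Y is a specialization of the generic tensor; the
  substitution \<sigma> is found by decoding the variables.\<close>

lemma generic_vanishing_imp:
  fixes A :: "nat list \<Rightarrow> 'k::field"
  assumes "meval mconst (generic_tensor a bs) F = 0" "A \<in> Y_locus a bs"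
  shows "meval of_int A F = 0"
proof -
  obtain ys where ys: "(A, ys) \<in> Z_locus a bs" using assms(2) by (auto simp: Y_locus_def)
  then obtain z where z: "A = gen_tensor a bs z ys"
    using gen_tensor_surj[of A a bs ys] by (auto simp: Z_locus_def)
  have len: "length ys = length bs" using ys by (auto simp: Z_locus_def multi_proj_def)
  define \<sigma> where "\<sigma> n = (case (from_nat n :: (nat \<times> nat list \<times> nat list) + (nat \<times> nat)) of
     Inl (i, J, J') \<Rightarrow> z i J J' | Inr (l, j) \<Rightarrow> (ys ! l) j)" for n
  have "map (\<lambda>l j. \<sigma> (ycode l j)) [0..<length bs] = ys"
    by (rule nth_equalityI) (auto simp: len \<sigma>_def ycode_def)
  then have "meval of_int A F = meval of_int \<sigma> (meval mconst (generic_tensor a bs) F)"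
    unfolding meval_at_generic_tensor z by (simp add: \<sigma>_def zcode_def)
  then show ?thesis
    by (simp add: assms(1) comm_ring_hom.meval_0[OF comm_ring_hom_of_int])
qed

text \<open>A polynomial that is nonzero at the generic tensor stays nonzero under some
  specialization, which can be kept a genuine point of Y.\<close>

lemma generic_vanishing_if:
  assumes b: "\<forall>b\<in>set bs. b \<ge> 1"
    and van: "\<And>A :: nat list \<Rightarrow> 'k::field_char_0. A \<in> Y_locus a bs \<Longrightarrow> meval of_int A F = 0"
  shows "meval mconst (generic_tensor a bs) F = 0"
proof (rule ccontr)
  \<comment> \<open>The factor \<open>?y\<close> keeps the first coordinate in every projective
    factor different from zero.\<close>
  let ?G = "meval mconst (generic_tensor a bs) F" and ?y = "\<Prod>l<length bs. mvar (ycode l 0)"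
  assume "?G \<noteq> 0"
  then have nz: "?G * ?y \<noteq> 0" by simp
  have "\<exists>\<sigma> :: nat \<Rightarrow> 'k. meval of_int \<sigma> (?G * ?y) \<noteq> 0"
    by (rule nonvanishing_point[OF comm_ring_hom_of_int _ infinite_UNIV_char_0 nz]) simp
  then obtain \<sigma> :: "nat \<Rightarrow> 'k" where \<sigma>: "meval of_int \<sigma> (?G * ?y) \<noteq> 0" by blast
  interpret h: comm_ring_hom "meval of_int \<sigma>"
    by (rule comm_ring_hom.comm_ring_hom_meval[OF comm_ring_hom_of_int])
  have G: "meval of_int \<sigma> ?G \<noteq> 0" and y: "\<And>l. l < length bs \<Longrightarrow> \<sigma> (ycode l 0) \<noteq> 0"
    using \<sigma> by (auto simp: h.hom_mult h.hom_prod comm_ring_hom.meval_mvar[OF comm_ring_hom_of_int])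
  \<comment> \<open>Coordinates beyond the bound are cut off to obtain points of
    \<open>affine_space\<close>; the monomials with indices in \<open>multi_indices bs\<close> do
    not involve them.\<close>
  define ys where "ys = map (\<lambda>l j. if j < bs ! l then \<sigma> (ycode l j) else 0) [0..<length bs]"
  let ?z = "\<lambda>i J J'. \<sigma> (zcode i J J')"
  have "coord_monomial ys J = coord_monomial (map (\<lambda>l j. \<sigma> (ycode l j)) [0..<length bs]) J"
    if "J \<in> multi_indices bs" for J
    unfolding coord_monomial_def
    by (rule prod.cong) (use multi_indicesD[OF that] in \<open>auto simp: ys_def\<close>)
  then have eq: "gen_tensor a bs ?z (map (\<lambda>l j. \<sigma> (ycode l j)) [0..<length bs]) = gen_tensor a bs ?z ys"
    by (intro ext) (auto simp: gen_tensor_def intro!: sum.cong)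
  have "ys \<in> multi_proj bs"
    unfolding multi_proj_def
  proof (intro CollectI conjI allI impI)
    fix l assume l: "l < length bs"
    then have "bs ! l \<ge> 1" using b by simp
    then have "(ys ! l) 0 \<noteq> 0" using y[OF l] l by (simp add: ys_def)
    then have "ys ! l \<noteq> (\<lambda>_. 0)" by metis
    moreover have "ys ! l \<in> affine_space {..<bs ! l}"
      using l by (simp add: ys_def affine_space_def)
    ultimately show "ys ! l \<in> affine_space {..<bs ! l} - {\<lambda>_. 0}" by blast
  qed (simp add: ys_def)
  then have "gen_tensor a bs ?z ys \<in> Y_locus a bs"
    unfolding Y_locus_def Z_locus_def
    by (intro image_eqI[of _ _ "(gen_tensor a bs ?z ys, ys)"])
       (auto simp: gen_tensor_affine tensor_form_gen_tensor)
  from van[OF this] G show False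
    unfolding meval_at_generic_tensor eq by simp
qed

text \<open>Properness of the projection: a specialization of the generic tensor extends to a place of
  the function field, which takes the generic point, suitably scaled, to a point over the
  specialized tensor.\<close>

lemma Y_locus_if_generic_vanishing:
  fixes A :: "nat list \<Rightarrow> 'k::alg_closed_field"
  assumes b: "\<forall>b\<in>set bs. b \<ge> 1" and A: "A \<in> affine_space (multi_indices (a # bs))"
    and van: "\<And>F. mvars F \<subseteq> multi_indices (a # bs) \<Longrightarrow>
      meval mconst (generic_tensor a bs) F = 0 \<Longrightarrow> meval of_int A F = 0"
  shows "A \<in> Y_locus a bs"
proof -
  let ?n = "length bs" and ?V = "multi_indices (a # bs)" and ?M = "multi_indices bs"
  define \<eta> where "\<eta> F = to_fract (meval mconst (generic_tensor a bs) F)" for F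
  interpret e: comm_ring_hom "meval mconst (generic_tensor a bs)"
    by (rule comm_ring_hom.comm_ring_hom_meval[OF comm_ring_hom_mconst])
  interpret v: comm_ring_hom "meval of_int A"
    by (rule comm_ring_hom.comm_ring_hom_meval[OF comm_ring_hom_of_int])
  interpret f: comm_ring_hom "to_fract :: (nat, int) mpoly \<Rightarrow> _" by unfold_locales simp_all
  \<comment> \<open>The homomorphism from the subring generated by the generic tensor, inside the
    function field, that specializes it to \<open>A\<close>. It is single-valued by
    \<open>van\<close>.\<close>
  define G0 where "G0 = {(\<eta> F, meval of_int A F) | F. mvars F \<subseteq> ?V}"
  have G0I: "(\<eta> F, meval of_int A F) \<in> G0" if "mvars F \<subseteq> ?V" for F
    using that unfolding G0_def by blast
  have "partial_hom G0"
  proof (rule partial_homI)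
    show "(1, 1) \<in> G0" using G0I[of 1] by (simp add: \<eta>_def)
    show "c = 0" if "(0, c) \<in> G0" for c
      using that van by (auto simp: G0_def \<eta>_def)
    show "(- x, - y) \<in> G0" if xy: "(x, y) \<in> G0" for x y
    proof -
      obtain F where F: "mvars F \<subseteq> ?V" "x = \<eta> F" "y = meval of_int A F"
        using xy unfolding G0_def by blast
      show ?thesis using G0I[of "- F"] F by (simp add: mvars_uminus \<eta>_def e.hom_uminus v.hom_uminus)
    qed
    fix x y x' y' assume xy: "(x, y) \<in> G0" "(x', y') \<in> G0"
    obtain F F' where F: "mvars F \<subseteq> ?V" "x = \<eta> F" "y = meval of_int A F"
      "mvars F' \<subseteq> ?V" "x' = \<eta> F'" "y' = meval of_int A F'"
      using xy unfolding G0_def by blast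
    show "(x + x', y + y') \<in> G0"
      using G0I[of "F + F'"] F by (simp add: mvars_subset_add \<eta>_def e.hom_add v.hom_add)
    show "(x * x', y * y') \<in> G0"
      using G0I[of "F * F'"] F by (simp add: mvars_subset_mult \<eta>_def e.hom_mult v.hom_mult)
  qed
  then obtain G where G: "G0 \<subseteq> G" "maximal_partial_hom G"
    using maximal_partial_hom_exists by blast
  interpret maximal_partial_hom G by (rule G(2))
  define y where "y l j = to_fract (mvar (ycode l j) :: (nat, int) mpoly)" for l j
  \<comment> \<open>In every projective factor, the generic coordinates are scaled separately by one
    that divides the others.\<close>
  have "\<exists>j\<in>{..<bs ! l}. y l j \<noteq> 0 \<and> (\<forall>i\<in>{..<bs ! l}. y l i / y l j \<in> Domain G)" if "l < ?n" for l
    by (rule max_ratio[of _ 0]) (use b that nth_mem[OF that] in \<open>auto simp: y_def Suc_le_eq\<close>)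
  then obtain j where j: "\<And>l. l < ?n \<Longrightarrow> j l < bs ! l"
      "\<And>l i. l < ?n \<Longrightarrow> i < bs ! l \<Longrightarrow> y l i / y l (j l) \<in> Domain G"
    by (metis lessThan_iff)
  have y0: "y l i \<noteq> 0" for l i by (simp add: y_def)
  define c where "c l i = (SOME d. (y l i / y l (j l), d) \<in> G)" for l i
  have c: "(y l i / y l (j l), c l i) \<in> G" if "l < ?n" "i < bs ! l" for l i
    unfolding c_def by (rule someI_ex) (use j(2)[OF that] in blast)
  define ys where "ys = map (\<lambda>l i. if i < bs ! l then c l i else 0) [0..<?n]"
  have c1: "c l (j l) = 1" if "l < ?n" for l
    using c[OF that j(1)[OF that]] y0 functional[OF _ one] by simp
  have "ys \<in> multi_proj bs"
    unfolding multi_proj_def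
  proof (intro CollectI conjI allI impI)
    fix l assume l: "l < ?n"
    then have "(ys ! l) (j l) \<noteq> 0" using j(1) c1 by (simp add: ys_def)
    then have "ys ! l \<noteq> (\<lambda>_. 0)" by metis
    moreover have "ys ! l \<in> affine_space {..<bs ! l}"
      using l by (simp add: ys_def affine_space_def)
    ultimately show "ys ! l \<in> affine_space {..<bs ! l} - {\<lambda>_. 0}" by blast
  qed (simp add: ys_def)
  moreover have "tensor_form bs A i ys = 0" if i: "i < a" for i
  proof -
    let ?x = "\<lambda>J. to_fract (generic_tensor a bs (i # J))"
    have "(?x J, A (i # J)) \<in> G" if "J \<in> ?M" for J
    proof -
      have "mvars (mvar (i # J) :: (nat list, int) mpoly) \<subseteq> ?V"
        using mvars_mvar[of "i # J"] i that by auto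
      from G0I[OF this] G(1) show ?thesis
        by (auto simp: \<eta>_def comm_ring_hom.meval_mvar[OF comm_ring_hom_of_int]
            comm_ring_hom.meval_mvar[OF comm_ring_hom_mconst])
    qed
    moreover have "(\<Prod>l<?n. y l (J ! l) / y l (j l), coord_monomial ys J) \<in> G" if "J \<in> ?M" for J
    proof -
      have "coord_monomial ys J = (\<Prod>l<?n. c l (J ! l))"
        unfolding coord_monomial_def
        by (rule prod.cong) (use multi_indicesD[OF that] in \<open>auto simp: ys_def\<close>)
      then show ?thesis using c multi_indicesD[OF that] by (auto intro!: prod)
    qed
    \<comment> \<open>The place maps the scaled generic form to the form of \<open>A\<close> at
      \<open>ys\<close>. The generic form is zero, since the scaling only divides it by a common
      factor.\<close>
    ultimately have "(\<Sum>J\<in>?M. ?x J * (\<Prod>l<?n. y l (J ! l) / y l (j l)), tensor_form bs A i ys) \<in> G"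
      unfolding tensor_form_def by (intro sum mult)
    also have "(\<Sum>J\<in>?M. ?x J * (\<Prod>l<?n. y l (J ! l) / y l (j l))) =
        (\<Sum>J\<in>?M. to_fract (generic_tensor a bs (i # J) * coord_monomial (generic_point bs) J)) /
        (\<Prod>l<?n. y l (j l))"
      unfolding sum_divide_distrib
      by (rule sum.cong[OF refl])
         (auto simp: prod_dividef coord_monomial_def generic_point_def y_def f.hom_prod
           multi_indicesD(1) f.hom_mult)
    also have "\<dots> = 0"
      using tensor_form_gen_tensor[OF i, of bs "\<lambda>i J J'. mvar (zcode i J J')" "generic_point bs"]
      unfolding f.hom_sum[symmetric] tensor_form_def generic_tensor_def by simp
    finally show ?thesis by (rule zeroD)
  qed
  ultimately have "(A, ys) \<in> Z_locus a bs" using A by (auto simp: Z_locus_def)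
  then show ?thesis unfolding Y_locus_def by force
qed

section \<open>Tangent hyperplanes of the Segre variety\<close>

text \<open>Gaussian elimination: the equation \<open>m\<close> is solved for a pivot unknown
  \<open>u0\<close>, which is substituted into the remaining equations.\<close>

lemma homogeneous_system_nontrivial_solution:
  fixes c :: "'u \<Rightarrow> 'm \<Rightarrow> 'k::field"
  assumes "finite M" "finite U" "card M < card U"
  shows "\<exists>x. (\<exists>u\<in>U. x u \<noteq> 0) \<and> (\<forall>m\<in>M. (\<Sum>u\<in>U. x u * c u m) = 0)"
  using assms
proof (induction M arbitrary: U c rule: finite_induct)
  case empty
  then obtain u where "u \<in> U" by fastforce
  then show ?case by (intro exI[of _ "\<lambda>_. 1"]) auto
next
  case (insert m M)
  show ?case
  proof (cases "\<forall>u\<in>U. c u m = 0")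
    case True
    have "card M < card U" using insert by simp
    from insert.IH[OF insert.prems(1) this, of c] True show ?thesis by force
  next
    case False
    then obtain u0 where u0: "u0 \<in> U" "c u0 m \<noteq> 0" by blast
    let ?U = "U - {u0}"
    define c' where "c' u m' = c u m' - c u m / c u0 m * c u0 m'" for u m'
    have "card M < card ?U" using insert u0(1) by simp
    then obtain x where x: "\<exists>u\<in>?U. x u \<noteq> 0" "\<And>m'. m' \<in> M \<Longrightarrow> (\<Sum>u\<in>?U. x u * c' u m') = 0"
      using insert.IH[of ?U c'] insert.prems(1) by auto
    define s where "s = - (\<Sum>u\<in>?U. x u * c u m / c u0 m)"
    define x' where "x' = x(u0 := s)"
    have split: "(\<Sum>u\<in>U. x' u * c u m') = s * c u0 m' + (\<Sum>u\<in>?U. x u * c u m')" for m'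
      using insert.prems(1) u0(1) by (subst sum.remove[of _ u0]) (auto simp: x'_def intro!: sum.cong)
    have "(\<Sum>u\<in>U. x' u * c u m') = 0" if "m' \<in> insert m M" for m'
    proof (cases "m' = m")
      case True
      have "s * c u0 m = - (\<Sum>u\<in>?U. x u * c u m)"
        using u0(2) by (simp add: s_def sum_distrib_right)
      with True split[of m] show ?thesis by simp
    next
      case False
      with that have "(\<Sum>u\<in>?U. x u * c' u m') = 0" using x(2) by blast
      moreover have "(\<Sum>u\<in>?U. x u * c' u m') = (\<Sum>u\<in>?U. x u * c u m') + s * c u0 m'"
        by (simp add: c'_def s_def algebra_simps sum_subtractf sum_distrib_right sum_distrib_left)
      ultimately show ?thesis using split by (simp add: add.commute)
    qed
    moreover have "\<exists>u\<in>U. x' u \<noteq> 0" using x(1) by (auto simp: x'_def)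
    ultimately show ?thesis by blast
  qed
qed

section \<open>Formal derivatives as first-order coefficients\<close>

lemma coeff_1_mult: "coeff (p * q) 1 = coeff p 1 * coeff q 0 + coeff p 0 * coeff q 1"
  for p q :: "'r::comm_ring_1 poly"
  by (simp add: coeff_mult add.commute)

lemma coeff_0_prod: "coeff (\<Prod>i\<in>I. f i) 0 = (\<Prod>i\<in>I. coeff (f i) 0)"
  for f :: "'i \<Rightarrow> 'r::comm_ring_1 poly"
  by (induction I rule: infinite_finite_induct) (auto simp: coeff_mult)

lemma coeff_1_prod:
  fixes f :: "'i \<Rightarrow> 'r::comm_ring_1 poly"
  assumes "finite I"
  shows "coeff (\<Prod>i\<in>I. f i) 1 = (\<Sum>i\<in>I. coeff (f i) 1 * (\<Prod>j\<in>I - {i}. coeff (f j) 0))"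
  using assms
proof (induction I rule: finite_induct)
  case (insert a I)
  have "(\<Prod>j\<in>insert a I - {i}. coeff (f j) 0) = coeff (f a) 0 * (\<Prod>j\<in>I - {i}. coeff (f j) 0)"
    if "i \<in> I" for i
    using insert.hyps that by (subst insert_Diff_if) auto
  moreover have "insert a I - {a} = I" using insert.hyps by auto
  ultimately show ?case
    using insert.hyps
    by (simp add: coeff_1_mult coeff_0_prod insert.IH sum_distrib_left mult_ac del: One_nat_def)
qed simp

lemma coeff_0_power_linear: "coeff ([:a, b:] ^ n) 0 = (a::'r::comm_ring_1) ^ n"
  by (simp add: coeff_0_power)

lemma coeff_1_power_linear: "coeff ([:a, b:] ^ n) 1 = of_nat n * (a::'r::comm_ring_1) ^ (n - 1) * b"
  using coeff_1_prod[of "{..<n}" "\<lambda>_. [:a, b:]"] by (simp add: mult_ac)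

text \<open>The differential is the linear coefficient of p(x + s t) in s. In this form it is
  compatible with products, and polynomials along a line can be compared with it.\<close>

lemma coeff_1_meval_linear:
  fixes x t :: "'v \<Rightarrow> 'k::comm_ring_1"
  assumes V: "finite V" "mvars p \<subseteq> V"
  shows "coeff (meval (\<lambda>c. [:c:]) (\<lambda>v. [:x v, t v:]) p) 1 = (\<Sum>v\<in>V. meval id x (mderiv v p) * t v)"
proof -
  interpret c: comm_ring_hom "\<lambda>c::'k. [:c:]" by (rule comm_ring_hom_const_poly)
  interpret i: comm_ring_hom "id :: 'k \<Rightarrow> 'k" by (rule comm_ring_hom_id)
  let ?e = "\<lambda>v. Poly_Mapping.single v (1::nat)"
  have sub: "Poly_Mapping.keys m \<subseteq> V" if "m \<in> Poly_Mapping.keys p" for m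
    using V(2) that by (auto simp: mvars_def)
  \<comment> \<open>If \<open>v\<close> does not occur in \<open>m\<close>, truncated subtraction
    leaves the exponents unchanged, and the factor \<open>of_nat\<close> 0 removes the term.\<close>
  have mon: "coeff (c.mon_val (\<lambda>v. [:x v, t v:]) m) 1 =
      (\<Sum>v\<in>V. of_nat (Poly_Mapping.lookup m v) * i.mon_val x (m - ?e v) * t v)"
    if m: "m \<in> Poly_Mapping.keys p" for m
  proof -
    have "coeff (c.mon_val (\<lambda>v. [:x v, t v:]) m) 1 =
        (\<Sum>v\<in>V. of_nat (Poly_Mapping.lookup m v) * x v ^ (Poly_Mapping.lookup m v - 1) * t v *
          (\<Prod>w\<in>V - {v}. x w ^ Poly_Mapping.lookup m w))"
      unfolding c.mon_val_superset[OF V(1) sub[OF m]] coeff_1_prod[OF V(1)]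
        coeff_1_power_linear coeff_0_power_linear ..
    also have "\<dots> = (\<Sum>v\<in>V. of_nat (Poly_Mapping.lookup m v) * i.mon_val x (m - ?e v) * t v)"
    proof (rule sum.cong[OF refl])
      fix v assume v: "v \<in> V"
      have "Poly_Mapping.keys (m - ?e v) \<subseteq> Poly_Mapping.keys m"
        by (auto simp: in_keys_iff lookup_minus)
      then have "i.mon_val x (m - ?e v) = (\<Prod>w\<in>V. x w ^ Poly_Mapping.lookup (m - ?e v) w)"
        by (intro i.mon_val_superset V(1)) (use sub[OF m] in blast)
      also have "\<dots> = x v ^ (Poly_Mapping.lookup m v - 1) * (\<Prod>w\<in>V - {v}. x w ^ Poly_Mapping.lookup m w)"
      proof -
        have "(\<Prod>w\<in>V - {v}. x w ^ Poly_Mapping.lookup (m - ?e v) w) =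
            (\<Prod>w\<in>V - {v}. x w ^ Poly_Mapping.lookup m w)"
          by (rule prod.cong) (auto simp: lookup_minus lookup_single)
        then show ?thesis
          using V(1) v by (subst prod.remove[of _ v]) (simp_all add: lookup_minus)
      qed
      finally show "of_nat (Poly_Mapping.lookup m v) * x v ^ (Poly_Mapping.lookup m v - 1) * t v *
          (\<Prod>w\<in>V - {v}. x w ^ Poly_Mapping.lookup m w) =
          of_nat (Poly_Mapping.lookup m v) * i.mon_val x (m - ?e v) * t v" by (simp add: mult_ac)
    qed
    finally show ?thesis .
  qed
  have "coeff (meval (\<lambda>c. [:c:]) (\<lambda>v. [:x v, t v:]) p) 1 =
      (\<Sum>m\<in>Poly_Mapping.keys p. Poly_Mapping.lookup p m *
        (\<Sum>v\<in>V. of_nat (Poly_Mapping.lookup m v) * i.mon_val x (m - ?e v) * t v))"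
    unfolding meval_def c.mon_val_def[symmetric] coeff_sum
    by (rule sum.cong) (auto simp: mon[unfolded One_nat_def])
  also have "\<dots> = (\<Sum>v\<in>V. (\<Sum>m\<in>Poly_Mapping.keys p.
      of_nat (Poly_Mapping.lookup m v) * Poly_Mapping.lookup p m * i.mon_val x (m - ?e v)) * t v)"
    unfolding sum_distrib_left sum_distrib_right
    by (subst sum.swap) (simp add: mult_ac)
  also have "\<dots> = (\<Sum>v\<in>V. meval id x (mderiv v p) * t v)"
    by (simp add: mderiv_def i.meval_sum i.meval_single)
  finally show ?thesis .
qed

text \<open>An equation of \<open>X\<close> restricted to the line has infinitely many zeros, so it
  vanishes identically, and so does its linear coefficient. Infinitely many parameters are asked
  for, not all, so that degenerate ones may be left out.\<close>

lemma tangent_spaceI: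
  fixes x t :: "'v \<Rightarrow> 'k::field"
  assumes V: "finite V" and t: "t \<in> affine_space V"
    and inf: "infinite {s. (\<lambda>v. x v + s * t v) \<in> X}"
  shows "t \<in> tangent_space V X x"
  unfolding tangent_space_def
proof (intro CollectI conjI ballI t)
  fix p assume p: "p \<in> vanishing_ideal V X"
  let ?P = "meval (\<lambda>c. [:c:]) (\<lambda>v. [:x v, t v:]) p"
  have "poly ?P s = meval id (\<lambda>v. x v + s * t v) p" for s
    unfolding comm_ring_hom.hom_meval[OF comm_ring_hom_poly] by (simp add: id_def)
  with p have "{s. (\<lambda>v. x v + s * t v) \<in> X} \<subseteq> {s. poly ?P s = 0}"
    by (auto simp: vanishing_ideal_def)
  with inf have "infinite {s. poly ?P s = 0}" using finite_subset by blast
  then have "?P = 0" using poly_roots_finite by blast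
  then show "(\<Sum>v\<in>V. meval id x (mderiv v p) * t v) = 0"
    using coeff_1_meval_linear[OF V, of p x t] p by (simp add: vanishing_ideal_def mpoly_ring_def)
qed

section \<open>The Segre variety and its tangent hyperplanes\<close>

definition segre_point :: "nat list \<Rightarrow> (nat \<Rightarrow> 'k::comm_ring_1) list \<Rightarrow> nat list \<Rightarrow> 'k" where
  "segre_point ds ys J = (if J \<in> multi_indices ds then coord_monomial ys J else 0)"

lemma segre_alt: "segre ds = segre_point ds ` multi_proj ds"
  by (simp add: segre_def segre_point_def[abs_def])

lemma coord_monomial_Cons [simp]: "coord_monomial (y # ys) (j # J) = y j * coord_monomial ys J"
  by (simp add: coord_monomial_def prod.lessThan_Suc_shift del: prod.lessThan_Suc)

lemma Cons_in_multi_proj: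
  "u # ys \<in> multi_proj (d # ds) \<longleftrightarrow> u \<in> affine_space {..<d} \<and> u \<noteq> (\<lambda>_. 0) \<and> ys \<in> multi_proj ds"
  by (auto simp: multi_proj_def nth_Cons less_Suc_eq_0_disj split: nat.splits)

lemma sum_multi_indices_Cons:
  "(\<Sum>K\<in>multi_indices (d # ds). f K) = (\<Sum>i<d. \<Sum>J\<in>multi_indices ds. f (i # J))"
proof -
  have "inj_on (\<lambda>(k, J). k # J) ({..<d} \<times> multi_indices ds)" by (auto simp: inj_on_def)
  then have "(\<Sum>K\<in>multi_indices (d # ds). f K) = (\<Sum>(i, J)\<in>{..<d} \<times> multi_indices ds. f (i # J))"
    unfolding multi_indices_Cons by (subst sum.reindex) (auto simp: o_def case_prod_unfold)
  then show ?thesis by (simp add: sum.cartesian_product)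
qed

text \<open>Moving the first factor in the direction of the i-th unit vector stays in the Segre
  variety. The pairing of \<open>h\<close> with this tangent vector is the form of row i at the
  remaining factors.\<close>

lemma tangent_hyperplane_in_Y_locus:
  fixes h :: "nat list \<Rightarrow> 'k::field"
  assumes inf: "infinite (UNIV :: 'k set)" and h: "h \<in> affine_space (multi_indices (a # bs))"
    and x: "x \<in> segre (a # bs)"
    and tan: "\<And>t. t \<in> tangent_space (multi_indices (a # bs)) (segre (a # bs)) x \<Longrightarrow>
      (\<Sum>K\<in>multi_indices (a # bs). h K * t K) = 0"
  shows "h \<in> Y_locus a bs"
proof -
  obtain zs where zs: "zs \<in> multi_proj (a # bs)" "x = segre_point (a # bs) zs"
    using x unfolding segre_alt by blast
  then obtain u ys where "zs = u # ys" by (cases zs) (auto simp: multi_proj_def)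
  with zs have u: "u \<in> affine_space {..<a}" "u \<noteq> (\<lambda>_. 0)" and ys: "ys \<in> multi_proj bs"
    and x_def: "x = segre_point (a # bs) (u # ys)"
    by (auto simp: Cons_in_multi_proj)
  have "tensor_form bs h i ys = 0" if i: "i < a" for i
  proof -
    let ?e = "\<lambda>k. if k = i then 1 else 0 :: 'k"
    let ?t = "segre_point (a # bs) (?e # ys)"
    have "?t \<in> tangent_space (multi_indices (a # bs)) (segre (a # bs)) x"
    proof (rule tangent_spaceI)
      show "?t \<in> affine_space (multi_indices (a # bs))"
        by (simp add: segre_point_def affine_space_def)
      \<comment> \<open>The excluded parameter is the only one at which the moved vector could
        become zero.\<close>
      have "(\<lambda>v. x v + s * ?t v) \<in> segre (a # bs)" if s: "s \<noteq> - u i" for s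
      proof -
        let ?u = "\<lambda>k. u k + s * ?e k"
        have "?u i \<noteq> 0" using s by (simp add: add_eq_0_iff)
        have "?u \<noteq> (\<lambda>_. 0)"
        proof
          assume "?u = (\<lambda>_. 0)"
          then have "?u i = 0" by (rule fun_cong)
          with \<open>?u i \<noteq> 0\<close> show False by blast
        qed
        moreover have "?u \<in> affine_space {..<a}" using u(1) i by (auto simp: affine_space_def)
        ultimately have "?u # ys \<in> multi_proj (a # bs)" using ys by (simp add: Cons_in_multi_proj)
        moreover have "(\<lambda>v. x v + s * ?t v) = segre_point (a # bs) (?u # ys)"
        proof
          fix K show "x K + s * ?t K = segre_point (a # bs) (?u # ys) K"
            by (cases K) (simp_all add: x_def segre_point_def algebra_simps)
        qed
        ultimately show ?thesis unfolding segre_alt by blast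
      qed
      then have "UNIV - {- u i} \<subseteq> {s. (\<lambda>v. x v + s * ?t v) \<in> segre (a # bs)}" by blast
      moreover have "infinite (UNIV - {- u i})" using inf by simp
      ultimately show "infinite {s. (\<lambda>v. x v + s * ?t v) \<in> segre (a # bs)}"
        using infinite_super by blast
    qed simp
    from tan[OF this] have "0 = (\<Sum>k<a. \<Sum>J\<in>multi_indices bs. h (k # J) * ?t (k # J))"
      by (simp only: sum_multi_indices_Cons)
    also have "\<dots> = (\<Sum>k<a. if k = i then tensor_form bs h i ys else 0)"
      by (rule sum.cong) (auto simp: segre_point_def tensor_form_def)
    also have "\<dots> = tensor_form bs h i ys" using i by simp
    finally show ?thesis ..
  qed
  then have "(h, ys) \<in> Z_locus a bs" using h ys by (simp add: Z_locus_def)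
  then show ?thesis unfolding Y_locus_def by force
qed

lemma coord_monomial_update:
  assumes "l < length ys" "length J = length ys"
  shows "coord_monomial (ys[l := w]) J = w (J ! l) * (\<Prod>m\<in>{..<length ys} - {l}. (ys ! m) (J ! m))"
proof -
  have "coord_monomial (ys[l := w]) J = (\<Prod>m<length ys. (ys[l := w] ! m) (J ! m))"
    using assms(2) by (simp add: coord_monomial_def)
  also have "\<dots> = w (J ! l) * (\<Prod>m\<in>{..<length ys} - {l}. (ys[l := w] ! m) (J ! m))"
    using assms(1) by (subst prod.remove[of _ l]) auto
  also have "(\<Prod>m\<in>{..<length ys} - {l}. (ys[l := w] ! m) (J ! m)) =
      (\<Prod>m\<in>{..<length ys} - {l}. (ys ! m) (J ! m))"
    by (rule prod.cong) auto
  finally show ?thesis .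
qed

lemma coord_monomial_update_index:
  assumes "l < length ys" "length J = length ys"
  shows "coord_monomial ys (J[l := k]) = (ys ! l) k * (\<Prod>m\<in>{..<length ys} - {l}. (ys ! m) (J ! m))"
proof -
  have "coord_monomial ys (J[l := k]) = (\<Prod>m<length ys. (ys ! m) (J[l := k] ! m))"
    using assms(2) by (simp add: coord_monomial_def)
  also have "\<dots> = (ys ! l) k * (\<Prod>m\<in>{..<length ys} - {l}. (ys ! m) (J[l := k] ! m))"
    using assms by (subst prod.remove[of _ l]) auto
  also have "(\<Prod>m\<in>{..<length ys} - {l}. (ys ! m) (J[l := k] ! m)) =
      (\<Prod>m\<in>{..<length ys} - {l}. (ys ! m) (J ! m))"
    by (rule prod.cong) auto
  finally show ?thesis .
qed

text \<open>Each \<open>q m\<close> is missing only from the factor with l = m. This accounts for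
  the exponent r - 1 in the equations of the Segre variety below.\<close>

lemma prod_prod_others:
  fixes q :: "nat \<Rightarrow> 'k::comm_ring_1"
  shows "(\<Prod>l<r. \<Prod>m\<in>{..<r} - {l}. q m) = (\<Prod>m<r. q m) ^ (r - 1)"
proof -
  have "(\<Prod>l<r. \<Prod>m\<in>{..<r} - {l}. q m) = (\<Prod>l<r. \<Prod>m\<in>{m \<in> {..<r}. m \<noteq> l}. q m)"
    by (intro prod.cong) auto
  also have "\<dots> = (\<Prod>m<r. \<Prod>l\<in>{l \<in> {..<r}. m \<noteq> l}. q m)"
    by (rule prod.swap_restrict) auto
  also have "\<dots> = (\<Prod>m<r. q m ^ (r - 1))"
  proof (rule prod.cong[OF refl])
    fix m assume "m \<in> {..<r}"
    then have "card {l \<in> {..<r}. m \<noteq> l} = card ({..<r} - {m})" by (intro arg_cong[of _ _ card]) auto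
    also have "\<dots> = r - 1" using \<open>m \<in> {..<r}\<close> by simp
    finally show "(\<Prod>l\<in>{l \<in> {..<r}. m \<noteq> l}. q m) = q m ^ (r - 1)" by simp
  qed
  finally show ?thesis by (simp add: prod_power_distrib)
qed

text \<open>The equations \<open>x\<^sub>K x\<^sub>K\<^sub>0\<^sup>r\<^sup>-\<^sup>1 = \<Prod>\<^sub>l x\<^sub>K\<^sub>0\<^sub>[\<^sub>l\<^sub>:\<^sub>=\<^sub>K\<^sub>l\<^sub>]\<close> cut out the Segre variety where
  \<open>x\<^sub>K\<^sub>0 \<noteq> 0\<close>; their differentials suffice to determine the tangent space.\<close>

lemma pairing_with_tangent_space:
  fixes h :: "nat list \<Rightarrow> 'k::field"
  assumes zs: "zs \<in> multi_proj ds"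
    and h: "\<And>l w. l < length ds \<Longrightarrow> (\<Sum>K\<in>multi_indices ds. h K * coord_monomial (zs[l := w]) K) = 0"
    and t: "t \<in> tangent_space (multi_indices ds) (segre ds) (segre_point ds zs)"
    and ne: "ds \<noteq> []"
  shows "(\<Sum>K\<in>multi_indices ds. h K * t K) = 0"
proof -
  let ?r = "length ds" and ?V = "multi_indices ds" and ?x = "segre_point ds zs"
  have len: "length zs = ?r" using zs by (simp add: multi_proj_def)
  obtain K0 where K0: "K0 \<in> ?V" "coord_monomial zs K0 \<noteq> 0"
    using coord_monomial_nonzero_exists[OF zs] by blast
  have K0len: "length K0 = ?r" using K0(1) by (rule multi_indicesD)
  let ?c = "?x K0"
  have c0: "?c \<noteq> 0" using K0 by (simp add: segre_point_def)
  define q where "q l = (\<Prod>m\<in>{..<?r} - {l}. (zs ! m) (K0 ! m))" for l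
  have upd: "K0[l := K ! l] \<in> ?V" if "K \<in> ?V" "l < ?r" for K l
    using that K0(1) by (auto simp: multi_indices_def nth_list_update)
  have xupd: "?x (K0[l := K ! l]) = (zs ! l) (K ! l) * q l" if "K \<in> ?V" "l < ?r" for K l
    using upd[OF that] that len K0len by (simp add: segre_point_def coord_monomial_update_index q_def)
  \<comment> \<open>Up to a nonzero factor, \<open>t\<close> is a combination of vectors with one
    factor of \<open>zs\<close> replaced and of the point itself; \<open>h\<close> annihilates all
    of these.\<close>
  have key: "t K * ?c ^ (?r - 1) =
      (\<Sum>l<?r. (\<Prod>m\<in>{..<?r} - {l}. q m) * coord_monomial (zs[l := (\<lambda>k. t (K0[l := k]))]) K)
      - of_nat (?r - 1) * ?c ^ (?r - 1 - 1) * t K0 * coord_monomial zs K" if K: "K \<in> ?V" for K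
  proof -
    define p :: "(nat list, 'k) mpoly" where
      "p = mvar K * mvar K0 ^ (?r - 1) - (\<Prod>l<?r. mvar (K0[l := K ! l]))"
    have Klen: "length K = ?r" using K by (rule multi_indicesD)
    have sub: "mvars (mvar J :: (nat list, 'k) mpoly) \<subseteq> ?V" if "J \<in> ?V" for J
      using mvars_mvar[of J] that by auto
    have pV: "mvars p \<subseteq> ?V"
      unfolding p_def using K K0(1) upd
      by (intro mvars_subset_diff mvars_subset_mult mvars_subset_power mvars_subset_prod sub) auto
    interpret i: comm_ring_hom "id :: 'k \<Rightarrow> 'k" by (rule comm_ring_hom_id)
    interpret ci: comm_ring_hom "\<lambda>c::'k. [:c:]" by (rule comm_ring_hom_const_poly)
    have "meval id x p = 0" if x: "x \<in> segre ds" for x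
    proof -
      interpret m: comm_ring_hom "meval id x" by (rule i.comm_ring_hom_meval)
      obtain ws where ws: "ws \<in> multi_proj ds" "x = segre_point ds ws"
        using x unfolding segre_alt by blast
      have wlen: "length ws = ?r" using ws(1) by (simp add: multi_proj_def)
      have "(\<Prod>l<?r. x (K0[l := K ! l])) =
          (\<Prod>l<?r. (ws ! l) (K ! l) * (\<Prod>m\<in>{..<?r} - {l}. (ws ! m) (K0 ! m)))"
        by (rule prod.cong) (use K upd wlen K0len in \<open>auto simp: ws(2) segre_point_def coord_monomial_update_index\<close>)
      also have "\<dots> = coord_monomial ws K * coord_monomial ws K0 ^ (?r - 1)"
        by (simp add: prod.distrib prod_prod_others coord_monomial_def Klen K0len)
      finally have "(\<Prod>l<?r. x (K0[l := K ! l])) = x K * x K0 ^ (?r - 1)"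
        using K K0(1) by (simp add: ws(2) segre_point_def)
      then show ?thesis
        by (simp add: p_def m.hom_minus m.hom_mult m.hom_power m.hom_prod i.meval_mvar)
    qed
    then have pI: "p \<in> vanishing_ideal ?V (segre ds)"
      using pV by (simp add: vanishing_ideal_def mpoly_ring_def)
    interpret M: comm_ring_hom "meval (\<lambda>c. [:c:]) (\<lambda>v. [:?x v, t v:])" by (rule ci.comm_ring_hom_meval)
    have sum_eq: "(\<Sum>l<?r. t (K0[l := K ! l]) * (\<Prod>m\<in>{..<?r} - {l}. ?x (K0[m := K ! m]))) =
        (\<Sum>l<?r. (\<Prod>m\<in>{..<?r} - {l}. q m) * coord_monomial (zs[l := (\<lambda>k. t (K0[l := k]))]) K)"
    proof (rule sum.cong[OF refl])
      fix l assume l: "l \<in> {..<?r}"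
      have "(\<Prod>m\<in>{..<?r} - {l}. ?x (K0[m := K ! m])) =
          (\<Prod>m\<in>{..<?r} - {l}. (zs ! m) (K ! m)) * (\<Prod>m\<in>{..<?r} - {l}. q m)"
        unfolding prod.distrib[symmetric] by (rule prod.cong) (auto simp: xupd[OF K])
      then show "t (K0[l := K ! l]) * (\<Prod>m\<in>{..<?r} - {l}. ?x (K0[m := K ! m])) =
          (\<Prod>m\<in>{..<?r} - {l}. q m) * coord_monomial (zs[l := (\<lambda>k. t (K0[l := k]))]) K"
        using l len Klen by (simp add: coord_monomial_update)
    qed
    have "coeff (meval (\<lambda>c. [:c:]) (\<lambda>v. [:?x v, t v:]) p) 1 = 0"
      using t pI coeff_1_meval_linear[OF finite_multi_indices pV, of ?x t]
      by (simp add: tangent_space_def del: One_nat_def)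
    moreover have "meval (\<lambda>c. [:c:]) (\<lambda>v. [:?x v, t v:]) p =
        [:?x K, t K:] * [:?c, t K0:] ^ (?r - 1) - (\<Prod>l<?r. [:?x (K0[l := K ! l]), t (K0[l := K ! l]):])"
      by (simp add: p_def M.hom_minus M.hom_mult M.hom_power M.hom_prod ci.meval_mvar)
    ultimately have "coeff ([:?x K, t K:] * [:?c, t K0:] ^ (?r - 1) -
        (\<Prod>l<?r. [:?x (K0[l := K ! l]), t (K0[l := K ! l]):])) 1 = 0" by (simp only:)
    then have "t K * ?c ^ (?r - 1) + ?x K * (of_nat (?r - 1) * ?c ^ (?r - 1 - 1) * t K0) =
        (\<Sum>l<?r. t (K0[l := K ! l]) * (\<Prod>m\<in>{..<?r} - {l}. ?x (K0[m := K ! m])))"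
      unfolding coeff_diff coeff_1_mult coeff_1_power_linear coeff_0_power_linear coeff_1_prod[OF finite_lessThan]
      by simp
    then show ?thesis unfolding sum_eq using K by (simp add: segre_point_def algebra_simps)
  qed
  have h0: "(\<Sum>K\<in>?V. h K * coord_monomial zs K) = 0"
    using h[of 0 "zs ! 0"] ne by simp
  have "(\<Sum>K\<in>?V. h K * t K) * ?c ^ (?r - 1) = (\<Sum>K\<in>?V. h K * (t K * ?c ^ (?r - 1)))"
    by (simp add: sum_distrib_right mult_ac)
  also have "\<dots> = (\<Sum>K\<in>?V. h K * (\<Sum>l<?r. (\<Prod>m\<in>{..<?r} - {l}. q m) * coord_monomial (zs[l := (\<lambda>k. t (K0[l := k]))]) K))
      - (\<Sum>K\<in>?V. h K * (of_nat (?r - 1) * ?c ^ (?r - 1 - 1) * t K0 * coord_monomial zs K))"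
    unfolding sum_subtractf[symmetric]
    by (rule sum.cong[OF refl]) (simp only: key right_diff_distrib)
  also have "(\<Sum>K\<in>?V. h K * (\<Sum>l<?r. (\<Prod>m\<in>{..<?r} - {l}. q m) * coord_monomial (zs[l := (\<lambda>k. t (K0[l := k]))]) K))
      = (\<Sum>l<?r. (\<Prod>m\<in>{..<?r} - {l}. q m) * (\<Sum>K\<in>?V. h K * coord_monomial (zs[l := (\<lambda>k. t (K0[l := k]))]) K))"
    unfolding sum_distrib_left by (subst sum.swap) (simp only: mult.left_commute)
  also have "\<dots> = 0" using h by simp
  also have "(\<Sum>K\<in>?V. h K * (of_nat (?r - 1) * ?c ^ (?r - 1 - 1) * t K0 * coord_monomial zs K)) =
      of_nat (?r - 1) * ?c ^ (?r - 1 - 1) * t K0 * (\<Sum>K\<in>?V. h K * coord_monomial zs K)"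
    unfolding sum_distrib_left by (simp only: mult.left_commute)
  finally show ?thesis using c0 h0 by simp
qed

lemma coord_monomial_update_expand:
  fixes w :: "nat \<Rightarrow> 'k::comm_ring_1"
  assumes "l < length ds" "length ys = length ds" "J \<in> multi_indices ds"
  shows "coord_monomial (ys[l := w]) J =
    (\<Sum>j<ds ! l. w j * coord_monomial (ys[l := (\<lambda>i. if i = j then 1 else 0)]) J)"
proof -
  have J: "length J = length ys" "J ! l < ds ! l"
    using assms multi_indicesD[OF assms(3)] by auto
  let ?q = "\<Prod>m\<in>{..<length ys} - {l}. (ys ! m) (J ! m)"
  have "(\<Sum>j<ds ! l. w j * coord_monomial (ys[l := (\<lambda>i. if i = j then 1 else 0)]) J) =
      (\<Sum>j<ds ! l. if J ! l = j then w (J ! l) * ?q else 0)"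
    using assms J by (intro sum.cong) (auto simp: coord_monomial_update)
  then show ?thesis using assms J by (simp add: coord_monomial_update)
qed

lemma Y_locus_tangent:
  fixes h :: "nat list \<Rightarrow> 'k::field"
  assumes a: "a = 1 + (\<Sum>b\<leftarrow>bs. b - 1)" and h: "h \<in> Y_locus a bs"
  shows "\<exists>x\<in>segre (a # bs). \<forall>t\<in>tangent_space (multi_indices (a # bs)) (segre (a # bs)) x.
    (\<Sum>K\<in>multi_indices (a # bs). h K * t K) = 0"
proof -
  let ?n = "length bs" and ?M = "multi_indices bs"
  obtain ys where "(h, ys) \<in> Z_locus a bs" using h by (auto simp: Y_locus_def)
  then have ys: "ys \<in> multi_proj bs" and form: "\<And>i. i < a \<Longrightarrow> tensor_form bs h i ys = 0"
    by (auto simp: Z_locus_def)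
  have len: "length ys = ?n" using ys by (simp add: multi_proj_def)
  obtain J0 where J0: "J0 \<in> ?M" "coord_monomial ys J0 \<noteq> 0"
    using coord_monomial_nonzero_exists[OF ys] by blast
  have y0: "(ys ! l) (J0 ! l) \<noteq> 0" if "l < ?n" for l
    using J0 that multi_indicesD(1)[OF J0(1)] by (auto simp: coord_monomial_def)
  let ?e = "\<lambda>j i. if i = j then 1 else 0 :: 'k"
  \<comment> \<open>\<open>E i l j\<close> is the partial derivative at \<open>ys\<close> of the
    form of row \<open>i\<close> with respect to the j-th coordinate of factor l.\<close>
  define E where "E i l j = (\<Sum>J\<in>?M. h (i # J) * coord_monomial (ys[l := ?e j]) J)" for i l j
  have E: "(\<Sum>J\<in>?M. h (i # J) * coord_monomial (ys[l := w]) J) = (\<Sum>j<bs ! l. w j * E i l j)"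
    if "l < ?n" for i l w
  proof -
    have "(\<Sum>J\<in>?M. h (i # J) * coord_monomial (ys[l := w]) J) =
        (\<Sum>J\<in>?M. \<Sum>j<bs ! l. w j * (h (i # J) * coord_monomial (ys[l := ?e j]) J))"
      by (rule sum.cong)
         (simp_all add: coord_monomial_update_expand[OF that len, of _ w] sum_distrib_left mult_ac)
    also have "\<dots> = (\<Sum>j<bs ! l. w j * E i l j)"
      unfolding E_def sum_distrib_left by (rule sum.swap)
    finally show ?thesis .
  qed
  \<comment> \<open>One coordinate with a nonzero value is left out in every factor. This leaves
    exactly a - 1 equations for the a unknowns \<open>u\<close>.\<close>
  let ?I = "SIGMA l:{..<?n}. {..<bs ! l} - {J0 ! l}"
  have "card ?I = (\<Sum>l<?n. bs ! l - 1)"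
    using multi_indicesD(2)[OF J0(1)] by (simp add: card_SigmaI)
  also have "\<dots> = (\<Sum>b\<leftarrow>bs. b - 1)"
    by (simp add: sum_list_sum_nth atLeast0LessThan)
  finally have "card ?I < card {..<a}" using a by simp
  then obtain u where u: "\<exists>i\<in>{..<a}. u i \<noteq> 0"
    "\<And>m. m \<in> ?I \<Longrightarrow> (\<Sum>i<a. u i * (case m of (l, j) \<Rightarrow> E i l j)) = 0"
    using homogeneous_system_nontrivial_solution[of ?I "{..<a}" "\<lambda>i (l, j). E i l j"] by auto
  have uE: "(\<Sum>i<a. u i * E i l j) = 0" if l: "l < ?n" and j: "j < bs ! l" for l j
  proof (cases "j = J0 ! l")
    case False
    with u(2)[of "(l, j)"] l j show ?thesis by simp
  next
    case True
    \<comment> \<open>Euler's relation in factor l yields the equation for the coordinate left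
      out.\<close>
    have "0 = (\<Sum>i<a. u i * tensor_form bs h i ys)" using form by simp
    also have "\<dots> = (\<Sum>i<a. u i * (\<Sum>j<bs ! l. (ys ! l) j * E i l j))"
      using E[OF l, of _ "ys ! l"] by (simp add: tensor_form_def)
    also have "\<dots> = (\<Sum>j<bs ! l. (ys ! l) j * (\<Sum>i<a. u i * E i l j))"
      unfolding sum_distrib_left by (subst sum.swap) (simp only: mult.left_commute)
    also have "\<dots> = (ys ! l) j * (\<Sum>i<a. u i * E i l j) +
        (\<Sum>j\<in>{..<bs ! l} - {j}. (ys ! l) j * (\<Sum>i<a. u i * E i l j))"
      using j by (subst sum.remove[of _ j]) auto
    also have "(\<Sum>j\<in>{..<bs ! l} - {j}. (ys ! l) j * (\<Sum>i<a. u i * E i l j)) = 0"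
    proof (rule sum.neutral, rule ballI)
      fix j' assume "j' \<in> {..<bs ! l} - {j}"
      with u(2)[of "(l, j')"] l True show "(ys ! l) j' * (\<Sum>i<a. u i * E i l j') = 0" by simp
    qed
    finally show ?thesis using y0[OF l] True by simp
  qed
  define u' where "u' i = (if i < a then u i else 0)" for i
  have zs: "u' # ys \<in> multi_proj (a # bs)"
  proof -
    obtain i where "i < a" "u i \<noteq> 0" using u(1) by blast
    then have "u' i \<noteq> 0" by (simp add: u'_def)
    then have "u' \<noteq> (\<lambda>_. 0)" by metis
    then show ?thesis using ys by (simp add: Cons_in_multi_proj affine_space_def u'_def)
  qed
  \<comment> \<open>First-order variations of \<open>u'\<close> pair to zero with \<open>h\<close>
    because \<open>ys\<close> is a zero of all rows, those of \<open>ys\<close> by the choice of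
    \<open>u\<close>.\<close>
  have pair: "(\<Sum>K\<in>multi_indices (a # bs). h K * coord_monomial ((u' # ys)[l := w]) K) = 0"
    if "l < length (a # bs)" for l w
  proof (cases l)
    case 0
    have "(\<Sum>K\<in>multi_indices (a # bs). h K * coord_monomial ((u' # ys)[l := w]) K) =
        (\<Sum>i<a. w i * tensor_form bs h i ys)"
      by (simp add: 0 sum_multi_indices_Cons tensor_form_def sum_distrib_left mult.left_commute)
    then show ?thesis using form by simp
  next
    case (Suc m)
    then have m: "m < ?n" using that by simp
    have "(\<Sum>K\<in>multi_indices (a # bs). h K * coord_monomial ((u' # ys)[l := w]) K) =
        (\<Sum>i<a. u i * (\<Sum>J\<in>?M. h (i # J) * coord_monomial (ys[m := w]) J))"
      by (simp add: Suc sum_multi_indices_Cons sum_distrib_left mult.left_commute u'_def)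
    also have "\<dots> = (\<Sum>j<bs ! m. w j * (\<Sum>i<a. u i * E i m j))"
      unfolding E[OF m] sum_distrib_left by (subst sum.swap) (simp only: mult.left_commute)
    also have "\<dots> = 0" using uE[OF m] by simp
    finally show ?thesis .
  qed
  show ?thesis
  proof (rule bexI)
    show "segre_point (a # bs) (u' # ys) \<in> segre (a # bs)"
      unfolding segre_alt using zs by (rule imageI)
    show "\<forall>t\<in>tangent_space (multi_indices (a # bs)) (segre (a # bs)) (segre_point (a # bs) (u' # ys)).
        (\<Sum>K\<in>multi_indices (a # bs). h K * t K) = 0"
      using pairing_with_tangent_space[OF zs pair] by blast
  qed
qed

text \<open>The place argument asks only for the integer equations of Y. Mapped to the field, they
  belong to the vanishing ideal and hence hold on the closure.\<close>

lemma zariski_closure_Y_locus: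
  fixes A :: "nat list \<Rightarrow> 'k::alg_closed_field"
  assumes b: "\<forall>b\<in>set bs. b \<ge> 1" and A: "A \<in> zariski_closure (multi_indices (a # bs)) (Y_locus a bs)"
  shows "A \<in> Y_locus a bs"
proof (rule Y_locus_if_generic_vanishing[OF b])
  let ?V = "multi_indices (a # bs)"
  show "A \<in> affine_space ?V" using A by (simp add: zariski_closure_def zero_locus_def)
  fix F :: "(nat list, int) mpoly"
  assume F: "mvars F \<subseteq> ?V" "meval mconst (generic_tensor a bs) F = 0"
  have hom: "comm_ring_hom (\<lambda>c. mconst (of_int c) :: (nat list, 'k) mpoly)"
    by (rule comm_ring_hom_comp[OF comm_ring_hom_mconst comm_ring_hom_of_int])
  define F' :: "(nat list, 'k) mpoly" where "F' = meval (\<lambda>c. mconst (of_int c)) mvar F"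
  have "mvars F' \<subseteq> ?V"
    unfolding F'_def
  proof (rule comm_ring_hom.meval_mvars_subset[OF hom, where P = "\<lambda>q. mvars q \<subseteq> ?V"])
    fix v assume "v \<in> mvars F"
    then show "mvars (mvar v :: (nat list, 'k) mpoly) \<subseteq> ?V" using F(1) mvars_mvar[of v] by blast
  qed (simp_all add: mvars_subset_add mvars_subset_mult)
  moreover have eval: "meval id x F' = meval of_int x F" for x
    unfolding F'_def comm_ring_hom.hom_meval[OF comm_ring_hom.comm_ring_hom_meval[OF comm_ring_hom_id]]
    by (simp add: comm_ring_hom.meval_mconst[OF comm_ring_hom_id] comm_ring_hom.meval_mvar[OF comm_ring_hom_id])
  moreover have "meval of_int x F = 0" if "x \<in> Y_locus a bs" for x :: "nat list \<Rightarrow> 'k"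
    using generic_vanishing_imp[OF F(2) that] .
  ultimately have "F' \<in> vanishing_ideal ?V (Y_locus a bs)"
    by (simp add: vanishing_ideal_def mpoly_ring_def)
  then show "meval of_int A F = 0"
    using A eval by (auto simp: zariski_closure_def zero_locus_def)
qed

lemma infinite_UNIV_alg_closed: "infinite (UNIV :: 'k::alg_closed_field set)"
proof
  assume fin: "finite (UNIV :: 'k set)"
  let ?q = "\<Prod>a\<in>UNIV. [:- a, 1 :: 'k:]"
  have "degree ?q = card (UNIV :: 'k set)"
    using fin by (simp add: degree_prod_eq_sum_degree)
  moreover have "card (UNIV :: 'k set) > 0" using fin by (simp add: card_gt_0_iff)
  ultimately have "degree (?q + 1) > 0" by (subst degree_add_eq_left) simp_all
  then obtain x where "poly (?q + 1) x = 0" using alg_closed_imp_poly_has_root by blast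
  moreover have "poly ?q x = 0" using fin by (auto simp: poly_prod)
  ultimately show False by simp
qed

text \<open>The two preceding inclusions identify the tangent hyperplanes with Y, and Y is
  closed.\<close>

lemma dual_variety_segre_boundary:
  assumes b: "\<forall>b\<in>set bs. b \<ge> 1" and a: "a = 1 + (\<Sum>b\<leftarrow>bs. b - 1)"
  shows "dual_variety (multi_indices (a # bs)) (segre (a # bs)) =
    (Y_locus a bs :: (nat list \<Rightarrow> 'k::alg_closed_field) set)"
proof -
  let ?V = "multi_indices (a # bs)"
  let ?T = "{h \<in> affine_space ?V. \<exists>x\<in>segre (a # bs). \<forall>t\<in>tangent_space ?V (segre (a # bs)) x.
    (\<Sum>K\<in>?V. h K * t K) = (0 :: 'k)}"
  have aff: "Y_locus a bs \<subseteq> affine_space ?V" by (auto simp: Y_locus_def Z_locus_def)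
  have "?T = Y_locus a bs"
  proof (intro equalityI subsetI)
    fix h assume "h \<in> ?T"
    then show "h \<in> Y_locus a bs" using tangent_hyperplane_in_Y_locus[OF infinite_UNIV_alg_closed] by blast
  next
    fix h :: "nat list \<Rightarrow> 'k" assume h: "h \<in> Y_locus a bs"
    then show "h \<in> ?T" using Y_locus_tangent[OF a h] aff by blast
  qed
  moreover have "zariski_closure ?V (Y_locus a bs) = (Y_locus a bs :: (nat list \<Rightarrow> 'k) set)"
  proof (intro equalityI subsetI)
    fix A :: "nat list \<Rightarrow> 'k" assume "A \<in> Y_locus a bs"
    then show "A \<in> zariski_closure ?V (Y_locus a bs)"
      using aff by (auto simp: zariski_closure_def zero_locus_def vanishing_ideal_def)
  qed (rule zariski_closure_Y_locus[OF b])
  ultimately show ?thesis unfolding dual_variety_def by simp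
qed

section \<open>Zeros of the hyperdeterminant\<close>

text \<open>Factors of a nonzero polynomial use only its variables, by \<open>mvars_factor\<close>;
  so irreducibility passes from the subring to the ring of all polynomials.\<close>

lemma ring_irreducible_imp_irreducible:
  fixes D :: "('v::linorder, int) mpoly"
  assumes "D \<in> carrier (mpoly_ring V)" "ring_irreducible\<^bsub>mpoly_ring V\<^esub> D"
  shows "irreducible D"
proof (rule Factorial_Ring.irreducibleI)
  let ?R = "mpoly_ring V :: ('v, int) mpoly ring"
  have D0: "D \<noteq> 0" and unit: "D \<notin> Units ?R"
    and proper: "\<And>b. mvars b \<subseteq> V \<Longrightarrow> properfactor ?R b D \<Longrightarrow> b \<in> Units ?R"
    using assms(2) unfolding ring_irreducible_def Divisibility.irreducible_def by (auto simp: mpoly_ring_def)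
  have DV: "mvars D \<subseteq> V" using assms(1) by (simp add: mpoly_ring_def)
  have Units: "x dvd 1" if "x \<in> Units ?R" for x
    using that by (auto simp: Units_def mpoly_ring_def intro: dvdI[of 1 x, OF sym])
  show "D \<noteq> 0" by (rule D0)
  show "\<not> D dvd 1"
  proof
    assume "D dvd 1"
    then obtain w where w: "1 = D * w" by (elim dvdE)
    then have "mvars w \<subseteq> V" using mvars_factor(2)[of D w] by simp
    with w DV have "D \<in> Units ?R" by (auto simp: Units_def mpoly_ring_def mult.commute intro!: bexI[of _ w])
    with unit show False by blast
  qed
  fix x y assume xy: "D = x * y"
  have vars: "mvars x \<subseteq> V" "mvars y \<subseteq> V"
    using mvars_factor[of x y] D0 DV xy by auto
  show "x dvd 1 \<or> y dvd 1"
  proof (cases "y dvd 1")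
    case False
    have "properfactor ?R x D"
      unfolding properfactor_def
    proof
      show "x divides\<^bsub>?R\<^esub> D" using vars xy by (auto simp: factor_def mpoly_ring_def)
      show "\<not> D divides\<^bsub>?R\<^esub> x"
      proof
        assume "D divides\<^bsub>?R\<^esub> x"
        then obtain z where "x = D * z" by (auto simp: factor_def mpoly_ring_def)
        then have "x * 1 = x * (y * z)" by (simp add: xy mult.assoc)
        then have "1 = y * z" using D0 xy by simp
        then show False using False by (metis dvd_triv_left)
      qed
    qed
    with proper vars(1) Units show ?thesis by blast
  qed simp
qed

definition zero_row :: "nat \<Rightarrow> (nat list, int) mpoly \<Rightarrow> (nat list, int) mpoly" where
  "zero_row i = meval mconst (\<lambda>w. if hd w = i then 0 else mvar w)"

lemma meval_zero_row:
  fixes x :: "nat list \<Rightarrow> 'r::comm_ring_1"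
  shows "meval of_int x (zero_row i F) = meval of_int (\<lambda>w. if hd w = i then 0 else x w) F"
proof -
  have "meval of_int x (zero_row i F) =
      meval (\<lambda>c. meval of_int x (mconst c)) (\<lambda>w. meval of_int x (if hd w = i then 0 else mvar w)) F"
    unfolding zero_row_def
    by (rule comm_ring_hom.hom_meval[OF comm_ring_hom.comm_ring_hom_meval[OF comm_ring_hom_of_int]])
  also have "\<dots> = meval of_int (\<lambda>w. if hd w = i then 0 else x w) F"
    by (intro arg_cong2[of _ _ _ _ "\<lambda>h x. meval h x F"] ext)
       (auto simp: comm_ring_hom.meval_mconst[OF comm_ring_hom_of_int]
          comm_ring_hom.meval_mvar[OF comm_ring_hom_of_int] comm_ring_hom.meval_0[OF comm_ring_hom_of_int])
  finally show ?thesis .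
qed

section \<open>The hyperdeterminant over arbitrary algebraically closed fields\<close>

locale boundary_hyperdet =
  fixes bs :: "nat list" and a' :: nat and D :: "(nat list, int) mpoly"
  assumes bs: "\<forall>b\<in>set bs. b \<ge> 1"
    and a': "a' = 1 + (\<Sum>b\<leftarrow>bs. b - 1)"
    and D: "is_hyperdeterminant (a' # bs) D"
begin

abbreviation V :: "nat list set" where
  "V \<equiv> multi_indices (a' # bs)"

lemma D_vars: "mvars D \<subseteq> V"
  using D by (simp add: is_hyperdeterminant_def mpoly_ring_def)

lemma D_irreducible: "irreducible D"
  using D ring_irreducible_imp_irreducible unfolding is_hyperdeterminant_def by blast

text \<open>A constant irreducible \<open>D\<close> would be divisible by a prime number, against
  the normalization.\<close>

lemma D_nonconst: "mvars D \<noteq> {}"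
proof
  assume "mvars D = {}"
  then obtain k where k: "D = mconst k" using mvars_empty_conv by blast
  have "k \<noteq> 0" "\<not> k dvd 1"
    using D_irreducible k mconst_unit[of k] by (auto simp only: Factorial_Ring.irreducible_def mconst_0)
  then obtain p where p: "Factorial_Ring.prime p" "p dvd k"
    using prime_divisor_exists by blast
  then obtain c where "k = p * c" by (elim dvdE)
  then have "(mconst p) divides\<^bsub>mpoly_ring V\<^esub> D"
    by (auto simp: k factor_def mpoly_ring_def mconst_mult intro!: exI[of _ "mconst c"])
  with p(1) D show False unfolding is_hyperdeterminant_def by blast
qed

lemma D_complex_zeros:
  "A \<in> affine_space V \<Longrightarrow> meval of_int A D = (0 :: complex) \<longleftrightarrow> A \<in> Y_locus a' bs"
  using D dual_variety_segre_boundary[OF bs a', where 'k = complex]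
  unfolding is_hyperdeterminant_def by blast

lemma Y_locus_affine: "A \<in> Y_locus a bs \<Longrightarrow> A \<in> affine_space (multi_indices (a # bs))"
  by (auto simp: Y_locus_def Z_locus_def)

text \<open>\<open>F\<close> vanishes on the complex points of Y, which are the zeros of
  \<open>D\<close>, so elimination gives divisibility over the integers.\<close>

lemma generic_vanishing_imp_D_dvd:
  assumes F: "mvars F \<subseteq> V" "meval mconst (generic_tensor a' bs) F = 0"
  shows "D dvd F"
proof -
  obtain v where "v \<in> mvars D" using D_nonconst by blast
  then show ?thesis
  proof (rule irreducible_dvd_if_vanishing[OF D_irreducible, where 'k = complex])
    fix x :: "nat list \<Rightarrow> complex"
    assume x: "meval of_int x D = 0"
    \<comment> \<open>The Nullstellensatz above quantifies over all assignments; entries outside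
      \<open>V\<close> are reset to land in \<open>affine_space\<close>.\<close>
    define x' where "x' w = (if w \<in> V then x w else 0)" for w
    have eq: "meval of_int x p = meval of_int x' p" if "mvars p \<subseteq> V" for p :: "(nat list, int) mpoly"
      using that by (intro meval_cong) (auto simp: x'_def)
    have "x' \<in> affine_space V" by (simp add: x'_def affine_space_def)
    moreover have "meval of_int x' D = 0" using x eq[OF D_vars] by simp
    ultimately have "x' \<in> Y_locus a' bs" using D_complex_zeros by blast
    then show "meval of_int x F = 0" using eq[OF F(1)] generic_vanishing_imp[OF F(2)] by simp
  qed
qed

text \<open>The passage to arbitrary characteristic: \<open>D\<close> divides every integer equation
  of Y, and is itself one by its complex zeros.\<close>

lemma D_zeros:
  fixes A :: "nat list \<Rightarrow> 'k::alg_closed_field"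
  assumes A: "A \<in> affine_space V"
  shows "meval of_int A D = 0 \<longleftrightarrow> A \<in> Y_locus a' bs"
proof
  assume D0: "meval of_int A D = 0"
  show "A \<in> Y_locus a' bs"
  proof (rule Y_locus_if_generic_vanishing[OF bs A])
    fix F :: "(nat list, int) mpoly"
    assume "mvars F \<subseteq> V" "meval mconst (generic_tensor a' bs) F = 0"
    then have "D dvd F" by (rule generic_vanishing_imp_D_dvd)
    then obtain q where "F = D * q" by (elim dvdE)
    then show "meval of_int A F = 0"
      using D0 by (simp add: comm_ring_hom.meval_mult[OF comm_ring_hom_of_int])
  qed
next
  assume "A \<in> Y_locus a' bs"
  moreover have "meval mconst (generic_tensor a' bs) D = 0"
    by (rule generic_vanishing_if[OF bs, where 'k = complex])
       (use D_complex_zeros Y_locus_affine in blast)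
  ultimately show "meval of_int A D = 0" using generic_vanishing_imp by blast
qed

text \<open>If some \<^term>\<open>a' - 1\<close> rows had no common zero, then \<^term>\<open>D\<close> would have no zeros as a
  polynomial in an entry of the remaining row.\<close>

lemma Y_locus_zero_row:
  "\<exists>i<a'. \<forall>A :: nat list \<Rightarrow> 'k::alg_closed_field.
     A \<in> affine_space V \<longrightarrow> (\<forall>J. A (i # J) = 0) \<longrightarrow> A \<in> Y_locus a' bs"
proof -
  obtain v where v: "v \<in> mvars D" using D_nonconst by blast
  with D_vars have "v \<in> V" by blast
  then obtain i J where iJ: "v = i # J" "i < a'" "J \<in> multi_indices bs"
    by (rule multi_indices_ConsE)
  define D0 where "D0 = zero_row i D"
  note D0_eval = meval_zero_row[of _ i D, folded D0_def]
  have "D0 = 0"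
  proof (rule ccontr)
    assume "D0 \<noteq> 0"
    moreover have "D \<noteq> 0" using D_nonconst by auto
    \<comment> \<open>At the chosen point \<open>D0\<close> must survive for the contradiction, and
      the leading coefficient must keep \<open>D\<close> nonconstant in \<open>v\<close>.\<close>
    ultimately have nz: "D0 * vlc v D \<noteq> 0" by simp
    have "\<exists>x :: nat list \<Rightarrow> complex. meval of_int x (D0 * vlc v D) \<noteq> 0"
      by (rule nonvanishing_point[OF comm_ring_hom_of_int _ infinite_UNIV_char_0 nz]) simp
    then obtain x :: "nat list \<Rightarrow> complex" where "meval of_int x (D0 * vlc v D) \<noteq> 0" by blast
    then have x: "meval of_int x D0 \<noteq> 0" "meval of_int x (vlc v D) \<noteq> 0"
      by (simp_all add: comm_ring_hom.meval_mult[OF comm_ring_hom_of_int])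
    obtain P where P: "\<And>i. coeff P i = meval of_int x (coeff (upoly v D) i)"
      "\<And>s. meval of_int (x(v := s)) D = poly P s"
      using comm_ring_hom.meval_upd[OF comm_ring_hom_of_int, of x v D] by blast
    have "coeff P (vdeg v D) \<noteq> 0" using x(2) by (simp add: P vdeg_def flip: vlc_def)
    moreover have "vdeg v D > 0" using v vdeg_eq_0_iff[of v D] by auto
    ultimately have "degree P > 0" using le_degree[of P "vdeg v D"] by linarith
    then obtain s where "poly P s = 0" using alg_closed_imp_poly_has_root by blast
    define y where "y w = (if w \<in> V then (x(v := s)) w else 0)" for w
    \<comment> \<open>Erasing row \<open>i\<close> keeps the common zero that the root
      \<open>s\<close> has provided, and it forgets \<open>s\<close>: so \<open>D0\<close> would
      vanish at \<open>x\<close>.\<close>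
    define y0 where "y0 w = (if hd w = i then 0 else y w)" for w
    have aff: "y \<in> affine_space V" "y0 \<in> affine_space V"
      by (simp_all add: y_def y0_def affine_space_def)
    have "meval of_int y D = meval of_int (x(v := s)) D"
      using D_vars by (intro meval_cong) (auto simp: y_def)
    then have "y \<in> Y_locus a' bs" using aff D_complex_zeros P(2) \<open>poly P s = 0\<close> by simp
    then obtain ys where ys: "(y, ys) \<in> Z_locus a' bs" by (auto simp: Y_locus_def)
    have "tensor_form bs y0 k ys = 0" if "k < a'" for k
    proof (cases "k = i")
      case False
      then have "tensor_form bs y0 k ys = tensor_form bs y k ys" by (simp add: tensor_form_def y0_def)
      with ys that show ?thesis by (auto simp: Z_locus_def)
    qed (simp add: tensor_form_def y0_def)
    then have "(y0, ys) \<in> Z_locus a' bs" using ys aff by (auto simp: Z_locus_def)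
    then have "y0 \<in> Y_locus a' bs" unfolding Y_locus_def by force
    then have "meval of_int y0 D = 0" using aff D_complex_zeros by blast
    also have "meval of_int y0 D = meval of_int (\<lambda>w. if hd w = i then 0 else x w) D"
      using D_vars by (intro meval_cong) (auto simp: y0_def y_def iJ)
    finally show False using x(1) by (simp add: D0_eval)
  qed
  have "A \<in> Y_locus a' bs" if A: "A \<in> affine_space V" "\<forall>J. A (i # J) = 0" for A :: "nat list \<Rightarrow> 'k"
  proof -
    have "meval of_int A D = meval of_int (\<lambda>w. if hd w = i then 0 else A w) D"
    proof (rule meval_cong)
      fix w assume "w \<in> mvars D"
      then have "w \<in> V" using D_vars by blast
      then show "A w = (if hd w = i then 0 else A w)"
        using A(2) by (elim multi_indices_ConsE) auto
    qed
    also have "\<dots> = meval of_int A D0" by (simp add: D0_eval)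
    also have "\<dots> = 0" using \<open>D0 = 0\<close> by (simp add: comm_ring_hom.meval_0[OF comm_ring_hom_of_int])
    finally show ?thesis using D_zeros[OF A(1)] by simp
  qed
  with iJ(2) show ?thesis by blast
qed

lemma Y_locus_few_rows:
  fixes A :: "nat list \<Rightarrow> 'k::alg_closed_field"
  assumes a: "a < a'" and A: "A \<in> affine_space (multi_indices (a # bs))"
  shows "A \<in> Y_locus a bs"
proof -
  obtain i where i: "i < a'" "\<And>B :: nat list \<Rightarrow> 'k. B \<in> affine_space V \<Longrightarrow> (\<forall>J. B (i # J) = 0) \<Longrightarrow> B \<in> Y_locus a' bs"
    using Y_locus_zero_row[where 'k = 'k] by blast
  \<comment> \<open>A zero row is inserted at position \<open>i\<close>. The rows of
    \<open>A\<close> from \<open>a\<close> on are zero, which pads \<open>B\<close> to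
    \<open>a'\<close> rows.\<close>
  define B where "B w = (case w of [] \<Rightarrow> 0 | k # J \<Rightarrow> if k < i then A (k # J) else if k = i then 0 else A ((k - 1) # J))" for w
  have A0: "A (k # J) = 0" if "k \<ge> a \<or> J \<notin> multi_indices bs" for k J
    using A that by (auto simp: affine_space_def)
  have "B \<in> affine_space V"
    unfolding affine_space_def
  proof (intro CollectI allI impI)
    fix w assume "w \<notin> V"
    then show "B w = 0" using a i(1) by (cases w) (auto simp: B_def intro!: A0)
  qed
  moreover have "\<forall>J. B (i # J) = 0" by (simp add: B_def)
  ultimately have "B \<in> Y_locus a' bs" by (rule i(2))
  then obtain ys where ys: "(B, ys) \<in> Z_locus a' bs" by (auto simp: Y_locus_def)
  have "tensor_form bs A k ys = 0" if "k < a" for k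
  proof -
    let ?k = "if k < i then k else Suc k"
    have "tensor_form bs B ?k ys = 0" using ys that a by (auto simp: Z_locus_def)
    moreover have "tensor_form bs B ?k ys = tensor_form bs A k ys"
      by (simp add: tensor_form_def B_def)
    ultimately show ?thesis by simp
  qed
  then have "(A, ys) \<in> Z_locus a bs" using ys A by (auto simp: Z_locus_def)
  then show ?thesis unfolding Y_locus_def by force
qed

end

section \<open>Elimination of rows\<close>

definition mon_index :: "nat list \<Rightarrow> (nat \<times> nat) set" where
  "mon_index bs = (SIGMA l:{..<length bs}. {..<bs ! l})"

definition mon_exponents :: "nat list \<Rightarrow> nat \<Rightarrow> (nat \<times> nat \<Rightarrow> nat) set" where
  "mon_exponents bs e = {\<nu>. (\<forall>x. x \<notin> mon_index bs \<longrightarrow> \<nu> x = 0) \<and>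
     (\<forall>l<length bs. (\<Sum>j<bs ! l. \<nu> (l, j)) = e)}"

definition mon_eval :: "nat list \<Rightarrow> (nat \<times> nat \<Rightarrow> nat) \<Rightarrow> (nat \<Rightarrow> 'k::comm_ring_1) list \<Rightarrow> 'k" where
  "mon_eval bs \<nu> ys = (\<Prod>(l, j)\<in>mon_index bs. (ys ! l) j ^ \<nu> (l, j))"

text \<open>Functions instead of formal polynomials, since only the number of available monomials
  enters the count below.\<close>

definition multihom :: "nat list \<Rightarrow> nat \<Rightarrow> ((nat \<Rightarrow> 'k::comm_ring_1) list \<Rightarrow> 'k) \<Rightarrow> bool" where
  "multihom bs e g \<longleftrightarrow> (\<exists>c. \<forall>ys. length ys = length bs \<longrightarrow>
     g ys = (\<Sum>\<nu>\<in>mon_exponents bs e. c \<nu> * mon_eval bs \<nu> ys))"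

lemma finite_mon_index [simp]: "finite (mon_index bs)"
  by (simp add: mon_index_def)

text \<open>In every factor the exponent of coordinate 0 is determined by the others, because the
  total is \<open>e\<close>; the free exponents range over e + 1 values.\<close>

lemma mon_exponents_bound:
  assumes b: "\<forall>b\<in>set bs. b \<ge> 1"
  shows "finite (mon_exponents bs e)"
    and "card (mon_exponents bs e) \<le> (e + 1) ^ (\<Sum>b\<leftarrow>bs. b - 1)"
proof -
  let ?n = "length bs"
  let ?I = "SIGMA l:{..<?n}. {1..<bs ! l}"
  let ?r = "\<lambda>\<nu>. restrict \<nu> ?I"
  let ?P = "PiE ?I (\<lambda>_. {..e})"
  have "card ?I = (\<Sum>l<?n. bs ! l - 1)" by (simp add: card_SigmaI)
  also have "\<dots> = (\<Sum>b\<leftarrow>bs. b - 1)" by (simp add: sum_list_sum_nth atLeast0LessThan)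
  finally have cardP: "card ?P = (e + 1) ^ (\<Sum>b\<leftarrow>bs. b - 1)" by (simp add: card_PiE)
  have finP: "finite ?P" by (intro finite_PiE) auto
  have sub: "?r ` mon_exponents bs e \<subseteq> ?P"
  proof
    fix f assume "f \<in> ?r ` mon_exponents bs e"
    then obtain \<nu> where \<nu>: "\<nu> \<in> mon_exponents bs e" "f = ?r \<nu>" by blast
    have "\<nu> (l, j) \<le> e" if "l < ?n" "j < bs ! l" for l j
      using \<nu>(1) that member_le_sum[of j "{..<bs ! l}" "\<lambda>j. \<nu> (l, j)"] by (auto simp: mon_exponents_def)
    then show "f \<in> ?P" unfolding \<nu>(2) by (intro PiE_I) auto
  qed
  have inj: "inj_on ?r (mon_exponents bs e)"
  proof (rule inj_onI)
    fix \<mu> \<nu> assume *: "\<mu> \<in> mon_exponents bs e" "\<nu> \<in> mon_exponents bs e" "?r \<mu> = ?r \<nu>"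
    have pos: "\<mu> (l, j) = \<nu> (l, j)" if "l < ?n" "1 \<le> j" "j < bs ! l" for l j
      using fun_cong[OF *(3), of "(l, j)"] that by simp
    have "\<mu> (l, j) = \<nu> (l, j)" for l j
    proof (cases "(l, j) \<in> mon_index bs")
      case True
      then have l: "l < ?n" "j < bs ! l" by (auto simp: mon_index_def)
      show ?thesis
      proof (cases "j = 0")
        case True
        have "(\<Sum>j<bs ! l. \<mu> (l, j)) = (\<Sum>j<bs ! l. \<nu> (l, j))"
          using *(1,2) l(1) by (simp add: mon_exponents_def)
        moreover have "(\<Sum>j\<in>{..<bs ! l} - {0}. \<mu> (l, j)) = (\<Sum>j\<in>{..<bs ! l} - {0}. \<nu> (l, j))"
          by (rule sum.cong) (use pos l in auto)
        ultimately show ?thesis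
          using l(2) True by (simp add: sum.remove[of "{..<bs ! l}" 0])
      qed (use pos l in simp)
    next
      case False
      then show ?thesis using *(1,2) by (simp add: mon_exponents_def)
    qed
    then show "\<mu> = \<nu>" by auto
  qed
  show "finite (mon_exponents bs e)" by (rule inj_on_finite[OF inj sub finP])
  show "card (mon_exponents bs e) \<le> (e + 1) ^ (\<Sum>b\<leftarrow>bs. b - 1)"
    using card_inj_on_le[OF inj sub finP] by (simp only: cardP)
qed

lemma multihom_one: "multihom bs 0 (\<lambda>_. 1)"
proof -
  have zero: "\<nu> x = 0" if \<nu>: "\<nu> \<in> mon_exponents bs 0" for \<nu> x
  proof (cases "x \<in> mon_index bs")
    case True
    then obtain l j where x: "x = (l, j)" "l < length bs" "j < bs ! l" by (auto simp: mon_index_def)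
    then have "(\<Sum>j<bs ! l. \<nu> (l, j)) = 0" using \<nu> by (simp add: mon_exponents_def)
    then show ?thesis using x by simp
  next
    case False
    with \<nu> show ?thesis unfolding mon_exponents_def by blast
  qed
  have "mon_exponents bs 0 = {\<lambda>_. 0}"
  proof (intro equalityI subsetI)
    fix \<nu> assume "\<nu> \<in> mon_exponents bs 0"
    then have "\<nu> = (\<lambda>_. 0)" using zero by blast
    then show "\<nu> \<in> {\<lambda>_. 0}" by simp
  qed (simp add: mon_exponents_def)
  then show ?thesis
    unfolding multihom_def by (intro exI[of _ "\<lambda>_. 1"]) (simp add: mon_eval_def)
qed

lemma multihom_mult_form:
  assumes b: "\<forall>b\<in>set bs. b \<ge> 1" and g: "multihom bs e g"
  shows "multihom bs (Suc e) (\<lambda>ys. g ys * tensor_form bs A i ys)"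
proof -
  let ?n = "length bs" and ?M = "multi_indices bs"
  obtain c where c: "\<And>ys. length ys = ?n \<Longrightarrow> g ys = (\<Sum>\<nu>\<in>mon_exponents bs e. c \<nu> * mon_eval bs \<nu> ys)"
    using g unfolding multihom_def by blast
  \<comment> \<open>The exponents of \<open>coord_monomial ys J\<close>, of degree one in every
    factor.\<close>
  define \<delta> where "\<delta> J = (\<lambda>(l, j). if l < ?n \<and> j = J ! l then 1 else 0 :: nat)" for J :: "nat list"
  define T where "T = (\<lambda>(\<nu>, J) x. \<nu> x + \<delta> J x :: nat)"
  define S where "S = mon_exponents bs e \<times> ?M"
  have T: "T ` S \<subseteq> mon_exponents bs (Suc e)"
  proof
    fix \<mu> assume "\<mu> \<in> T ` S"
    then obtain \<nu> J where *: "\<nu> \<in> mon_exponents bs e" "J \<in> ?M" "\<mu> = (\<lambda>x. \<nu> x + \<delta> J x)"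
      by (auto simp: S_def T_def)
    have "(\<Sum>j<bs ! l. \<delta> J (l, j)) = 1" if "l < ?n" for l
      using multi_indicesD(2)[OF *(2)] that by (simp add: \<delta>_def)
    moreover have "\<delta> J x = 0" if "x \<notin> mon_index bs" for x
      using multi_indicesD(2)[OF *(2)] that by (cases x) (auto simp: \<delta>_def mon_index_def)
    ultimately show "\<mu> \<in> mon_exponents bs (Suc e)"
      using *(1) by (simp add: *(3) mon_exponents_def sum.distrib)
  qed
  have eval: "mon_eval bs (T (\<nu>, J)) ys = mon_eval bs \<nu> ys * coord_monomial ys J"
    if "J \<in> ?M" "length ys = ?n" for \<nu> J and ys :: "(nat \<Rightarrow> 'a) list"
  proof -
    have "(\<Prod>(l, j)\<in>mon_index bs. (ys ! l) j ^ \<delta> J (l, j)) = (\<Prod>l<?n. \<Prod>j<bs ! l. (ys ! l) j ^ \<delta> J (l, j))"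
      unfolding mon_index_def by (subst prod.Sigma) auto
    also have "\<dots> = (\<Prod>l<?n. \<Prod>j<bs ! l. if j = J ! l then (ys ! l) (J ! l) else 1)"
      by (intro prod.cong) (auto simp: \<delta>_def)
    also have "\<dots> = coord_monomial ys J"
      using multi_indicesD[OF that(1)] by (simp add: coord_monomial_def)
    finally have "(\<Prod>(l, j)\<in>mon_index bs. (ys ! l) j ^ \<delta> J (l, j)) = coord_monomial ys J" .
    then show ?thesis
      by (simp add: mon_eval_def T_def power_add prod.distrib case_prod_unfold)
  qed
  \<comment> \<open>Pairs with the same product monomial are merged.\<close>
  define c' where "c' \<mu> = (\<Sum>x\<in>{x \<in> S. T x = \<mu>}. c (fst x) * A (i # snd x))" for \<mu>
  have finS: "finite S" unfolding S_def using mon_exponents_bound(1)[OF b] by simp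
  show ?thesis
    unfolding multihom_def
  proof (intro exI[of _ c'] allI impI)
    fix ys :: "(nat \<Rightarrow> 'a) list" assume len: "length ys = ?n"
    have "g ys * tensor_form bs A i ys = (\<Sum>x\<in>S. c (fst x) * A (i # snd x) * mon_eval bs (T x) ys)"
      unfolding c[OF len] tensor_form_def sum_product S_def sum.cartesian_product
      by (rule sum.cong) (auto simp: eval len mult_ac)
    also have "\<dots> = (\<Sum>\<mu>\<in>mon_exponents bs (Suc e). \<Sum>x\<in>{x \<in> S. T x = \<mu>}. c (fst x) * A (i # snd x) * mon_eval bs (T x) ys)"
      by (rule sum.group[OF finS mon_exponents_bound(1)[OF b] T, symmetric])
    also have "\<dots> = (\<Sum>\<mu>\<in>mon_exponents bs (Suc e). c' \<mu> * mon_eval bs \<mu> ys)"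
      unfolding c'_def sum_distrib_right by (intro sum.cong) auto
    finally show "g ys * tensor_form bs A i ys = (\<Sum>\<mu>\<in>mon_exponents bs (Suc e). c' \<mu> * mon_eval bs \<mu> ys)" .
  qed
qed

lemma multihom_mult_form_power:
  assumes b: "\<forall>b\<in>set bs. b \<ge> 1" and g: "multihom bs e g"
  shows "multihom bs (e + k) (\<lambda>ys. g ys * tensor_form bs A i ys ^ k)"
proof (induction k)
  case (Suc k)
  from multihom_mult_form[OF b Suc, of A i] show ?case by (simp add: mult_ac)
qed (use g in simp)

lemma multihom_prod_forms:
  assumes b: "\<forall>b\<in>set bs. b \<ge> 1"
  shows "multihom bs (\<Sum>i<m. u i) (\<lambda>ys. \<Prod>i<m. tensor_form bs A i ys ^ u i)"
proof (induction m)
  case (Suc m)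
  from multihom_mult_form_power[OF b Suc, of "u m" A m] show ?case by simp
qed (simp add: multihom_one)

lemma digits_expansion:
  fixes w Q m :: nat
  assumes "w < Q ^ m"
  shows "(\<Sum>i<m. (w div Q ^ i mod Q) * Q ^ i) = w"
  using assms
proof (induction m arbitrary: w)
  case (Suc m)
  have "w div Q < Q ^ m"
    using Suc.prems by (simp add: less_mult_imp_div_less mult.commute)
  then have "(\<Sum>i<m. (w div Q div Q ^ i mod Q) * Q ^ i) * Q = (w div Q) * Q"
    by (simp only: Suc.IH)
  moreover have "(\<Sum>i<m. (w div Q ^ Suc i mod Q) * Q ^ Suc i) =
      (\<Sum>i<m. (w div Q div Q ^ i mod Q) * Q ^ i) * Q"
    unfolding sum_distrib_right by (rule sum.cong) (simp_all add: div_mult2_eq mult_ac)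
  ultimately have "(\<Sum>i<m. (w div Q ^ Suc i mod Q) * Q ^ Suc i) = w div Q * Q" by simp
  then show ?case by (subst sum.lessThan_Suc_shift) simp
qed simp

text \<open>More than \<open>dim P + 1\<close> forms satisfy a homogeneous algebraic relation, because there are too
  few monomials in the coordinates. A point \<open>c\<close> not satisfying the relation is not in the image of
  \<open>P\<close> under the forms, and projecting from \<open>c\<close> preserves the absence of common zeros. To find
  \<open>c\<close>, the exponents are read as digits in base \<open>Q\<close>.\<close>

lemma Y_locus_eliminate_row:
  fixes A :: "nat list \<Rightarrow> 'k::field"
  assumes inf: "infinite (UNIV :: 'k set)" and b: "\<forall>b\<in>set bs. b \<ge> 1"
    and m: "(\<Sum>b\<leftarrow>bs. b - 1) < m"
    and A: "A \<in> affine_space (multi_indices (Suc m # bs))" "A \<notin> Y_locus (Suc m) bs"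
  shows "\<exists>c. \<forall>ys\<in>multi_proj bs. \<exists>k<m. tensor_form bs A k ys \<noteq> c k * tensor_form bs A m ys"
proof -
  let ?N = "\<Sum>b\<leftarrow>bs. b - 1" and ?f = "tensor_form bs A"
  \<comment> \<open>The constants make the count work: digits in base \<open>Q\<close> are at most
    \<open>q\<close>, so \<open>m\<close> of them add up to at most \<open>e\<close>. With N the sum
    of the b - 1, (e + 1)^N \<le> (m Q)^N = q Q^N < Q^(N + 1) \<le> Q^m.\<close>
  define q where "q = m ^ ?N"
  define Q where "Q = Suc q"
  define e where "e = m * q"
  define u where "u w i = w div Q ^ i mod Q" for w i
  have u_le: "(\<Sum>i<m. u w i) \<le> e" for w
  proof -
    have "(\<Sum>i<m. u w i) \<le> (\<Sum>i<m. q)"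
      by (intro sum_mono) (simp add: u_def Q_def less_Suc_eq_le[symmetric])
    then show ?thesis by (simp add: e_def)
  qed
  \<comment> \<open>The products of the first \<open>m\<close> forms with the digits of
    \<open>w\<close> as exponents, padded by the last form to the common degree
    \<open>e\<close>.\<close>
  define g where "g w ys = (\<Prod>i<m. ?f i ys ^ u w i) * ?f m ys ^ (e - (\<Sum>i<m. u w i))" for w ys
  have g_hom: "multihom bs e (g w)" for w
    using multihom_mult_form_power[OF b multihom_prod_forms[OF b, of "u w" m A], of "e - (\<Sum>i<m. u w i)" A m] u_le[of w]
    by (simp add: g_def[abs_def])
  have "\<forall>w. \<exists>c. \<forall>ys. length ys = length bs \<longrightarrow>
      g w ys = (\<Sum>\<nu>\<in>mon_exponents bs e. c \<nu> * mon_eval bs \<nu> ys)"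
    using g_hom unfolding multihom_def by blast
  from choice[OF this] obtain c where c: "\<And>w ys. length ys = length bs \<Longrightarrow>
      g w ys = (\<Sum>\<nu>\<in>mon_exponents bs e. c w \<nu> * mon_eval bs \<nu> ys)" by blast
  have "card (mon_exponents bs e) \<le> (e + 1) ^ ?N" by (rule mon_exponents_bound(2)[OF b])
  also have "\<dots> \<le> (m * Q) ^ ?N" using m by (intro power_mono) (auto simp: e_def Q_def)
  also have "\<dots> = q * Q ^ ?N" by (simp only: power_mult_distrib q_def)
  also have "\<dots> < Q * Q ^ ?N" by (rule mult_strict_right_mono) (simp_all add: Q_def)
  also have "\<dots> = Q ^ Suc ?N" by simp
  also have "\<dots> \<le> Q ^ m" using m by (intro power_increasing) (auto simp: Q_def)
  finally have "card (mon_exponents bs e) < card {..<Q ^ m}" by simp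
  then obtain \<rho> where \<rho>: "\<exists>w\<in>{..<Q ^ m}. \<rho> w \<noteq> 0"
    "\<And>\<nu>. \<nu> \<in> mon_exponents bs e \<Longrightarrow> (\<Sum>w<Q ^ m. \<rho> w * c w \<nu>) = 0"
    using homogeneous_system_nontrivial_solution[OF mon_exponents_bound(1)[OF b], of "{..<Q ^ m}" e c] by auto
  have relation: "(\<Sum>w<Q ^ m. \<rho> w * g w ys) = 0" if "length ys = length bs" for ys
  proof -
    have "(\<Sum>w<Q ^ m. \<rho> w * g w ys) = (\<Sum>\<nu>\<in>mon_exponents bs e. (\<Sum>w<Q ^ m. \<rho> w * c w \<nu>) * mon_eval bs \<nu> ys)"
      unfolding c[OF that] sum_distrib_left sum_distrib_right by (subst sum.swap) (simp add: mult_ac)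
    then show ?thesis using \<rho>(2) by simp
  qed
  \<comment> \<open>Kronecker substitution: when the k-th variable becomes s^(Q^k), the product for
    \<open>w\<close> turns into s^w. So the relation becomes a nonzero univariate
    polynomial.\<close>
  define p where "p = (\<Sum>w<Q ^ m. monom (\<rho> w) w)"
  have coeff_p: "coeff p w = \<rho> w" if "w < Q ^ m" for w
    using that by (simp add: p_def coeff_sum)
  then have "p \<noteq> 0" using \<rho>(1) by force
  then have "finite {s. poly p s = 0}" by (rule poly_roots_finite)
  with inf obtain s where s: "poly p s \<noteq> 0" by (metis (full_types) UNIV_eq_I mem_Collect_eq)
  show ?thesis
  proof (rule exI[of _ "\<lambda>i. s ^ (Q ^ i)"], rule ballI, rule ccontr)
    fix ys :: "(nat \<Rightarrow> 'k) list" assume ys: "ys \<in> multi_proj bs"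
    assume "\<not> (\<exists>k<m. ?f k ys \<noteq> s ^ (Q ^ k) * ?f m ys)"
    then have f: "?f k ys = s ^ (Q ^ k) * ?f m ys" if "k < m" for k using that by blast
    have g: "g w ys = s ^ w * ?f m ys ^ e" if w: "w < Q ^ m" for w
    proof -
      have "(\<Prod>i<m. ?f i ys ^ u w i) = (\<Prod>i<m. s ^ (u w i * Q ^ i) * ?f m ys ^ u w i)"
        by (intro prod.cong) (auto simp: f power_mult_distrib mult.commute simp flip: power_mult)
      also have "\<dots> = s ^ (\<Sum>i<m. u w i * Q ^ i) * ?f m ys ^ (\<Sum>i<m. u w i)"
        by (simp add: prod.distrib power_sum)
      also have "(\<Sum>i<m. u w i * Q ^ i) = w" unfolding u_def by (rule digits_expansion[OF w])
      finally have "g w ys = s ^ w * (?f m ys ^ (\<Sum>i<m. u w i) * ?f m ys ^ (e - (\<Sum>i<m. u w i)))"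
        by (simp add: g_def mult.assoc)
      then show ?thesis using u_le[of w] by (simp flip: power_add)
    qed
    have "length ys = length bs" using ys by (simp add: multi_proj_def)
    then have "0 = (\<Sum>w<Q ^ m. \<rho> w * g w ys)" using relation by simp
    also have "\<dots> = poly p s * ?f m ys ^ e"
      by (simp add: g p_def poly_sum poly_monom sum_distrib_right mult.assoc)
    \<comment> \<open>As s is not a root of \<open>p\<close>, the last form vanishes at
      \<open>ys\<close>, and by proportionality all the others do.\<close>
    finally have fm: "?f m ys = 0" using s by auto
    have "?f k ys = 0" if "k < Suc m" for k
      using that f fm by (cases "k = m") auto
    then have "(A, ys) \<in> Z_locus (Suc m) bs" using A(1) ys by (simp add: Z_locus_def)
    then show False using A(2) unfolding Y_locus_def by force
  qed
qed

section \<open>Linear combinations of rows\<close>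

definition combine_rows :: "nat \<Rightarrow> nat \<Rightarrow> nat list \<Rightarrow> (nat \<Rightarrow> nat \<Rightarrow> 'k::comm_ring_1) \<Rightarrow> (nat list \<Rightarrow> 'k) \<Rightarrow> nat list \<Rightarrow> 'k" where
  "combine_rows a' a bs C A w =
     (if w \<in> multi_indices (a' # bs) then \<Sum>i<a. C (hd w) i * A (i # tl w) else 0)"

lemma combine_rows_affine: "combine_rows a' a bs C A \<in> affine_space (multi_indices (a' # bs))"
  by (simp add: combine_rows_def affine_space_def)

lemma tensor_form_combine_rows:
  assumes "k < a'"
  shows "tensor_form bs (combine_rows a' a bs C A) k ys = (\<Sum>i<a. C k i * tensor_form bs A i ys)"
proof -
  have "tensor_form bs (combine_rows a' a bs C A) k ys =
      (\<Sum>J\<in>multi_indices bs. \<Sum>i<a. C k i * (A (i # J) * coord_monomial ys J))"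
    using assms by (simp add: tensor_form_def combine_rows_def sum_distrib_right mult.assoc)
  then show ?thesis
    unfolding tensor_form_def sum_distrib_left by (subst sum.swap) simp
qed

lemma Y_locus_combine_rows:
  assumes "A \<in> Y_locus a bs"
  shows "combine_rows a' a bs C A \<in> Y_locus a' bs"
proof -
  obtain ys where ys: "(A, ys) \<in> Z_locus a bs" using assms by (auto simp: Y_locus_def)
  then have "(combine_rows a' a bs C A, ys) \<in> Z_locus a' bs"
    by (auto simp: Z_locus_def combine_rows_affine tensor_form_combine_rows)
  then show ?thesis unfolding Y_locus_def by force
qed

text \<open>The rows are eliminated from the last one down. The identity block in the first
  \<open>a'\<close> columns persists throughout and will give full rank.\<close>

lemma Y_locus_general_rows:
  fixes A :: "nat list \<Rightarrow> 'k::field"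
  assumes inf: "infinite (UNIV :: 'k set)" and b: "\<forall>b\<in>set bs. b \<ge> 1"
    and a': "a' = 1 + (\<Sum>b\<leftarrow>bs. b - 1)" and a: "a' \<le> a"
    and A: "A \<in> affine_space (multi_indices (a # bs))" "A \<notin> Y_locus a bs"
  shows "\<exists>C. (\<forall>k<a'. \<forall>i<a'. C k i = (if i = k then 1 else 0)) \<and> combine_rows a' a bs C A \<notin> Y_locus a' bs"
  using a A
proof (induction a arbitrary: A rule: dec_induct)
  case base
  have "combine_rows a' a' bs (\<lambda>k i. if i = k then 1 else 0) A = A"
  proof
    fix w show "combine_rows a' a' bs (\<lambda>k i. if i = k then 1 else 0) A w = A w"
    proof (cases "w \<in> multi_indices (a' # bs)")
      case True
      then obtain k J where w: "w = k # J" "k < a'" by (rule multi_indices_ConsE)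
      have "(\<Sum>i<a'. (if i = k then 1 else 0) * A (i # J)) = (\<Sum>i<a'. if i = k then A (k # J) else 0)"
        by (rule sum.cong) auto
      with True w show ?thesis by (simp add: combine_rows_def)
    next
      case False
      with base(1) show ?thesis by (simp add: combine_rows_def affine_space_def)
    qed
  qed
  with base(2) show ?case by (intro exI[of _ "\<lambda>k i. if i = k then 1 else 0"]) simp
next
  case (step m)
  have "(\<Sum>b\<leftarrow>bs. b - 1) < m" using a' step.hyps by simp
  from Y_locus_eliminate_row[OF inf b this step.prems] obtain c
    where c: "\<forall>ys\<in>multi_proj bs. \<exists>k<m. tensor_form bs A k ys \<noteq> c k * tensor_form bs A m ys" by blast
  \<comment> \<open>The projection from the point (c, 1): row \<open>m\<close> is subtracted
    \<open>c k\<close> times from row \<open>k\<close>.\<close>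
  define E where "E k i = (if i = k then 1 else if i = m then - c k else 0)" for k i
  define B where "B = combine_rows m (Suc m) bs E A"
  have E_sum: "(\<Sum>i<Suc m. E k i * x i) = x k - c k * x m" if "k < m" for k and x :: "nat \<Rightarrow> 'k"
  proof -
    have "(\<Sum>i<m. E k i * x i) = (\<Sum>i<m. if i = k then x k else 0)"
      by (rule sum.cong) (auto simp: E_def)
    then show ?thesis using that by (simp add: E_def)
  qed
  have "B \<notin> Y_locus m bs"
  proof
    assume "B \<in> Y_locus m bs"
    then obtain ys where ys: "ys \<in> multi_proj bs" "\<And>k. k < m \<Longrightarrow> tensor_form bs B k ys = 0"
      by (auto simp: Y_locus_def Z_locus_def)
    then have "tensor_form bs A k ys = c k * tensor_form bs A m ys" if "k < m" for k
      using that E_sum[OF that, of "\<lambda>i. tensor_form bs A i ys"]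
      by (simp add: B_def tensor_form_combine_rows del: sum.lessThan_Suc)
    with c ys(1) show False by blast
  qed
  moreover have "B \<in> affine_space (multi_indices (m # bs))"
    unfolding B_def by (rule combine_rows_affine)
  ultimately obtain C where C: "\<forall>k<a'. \<forall>i<a'. C k i = (if i = k then 1 else 0)"
      "combine_rows a' m bs C B \<notin> Y_locus a' bs"
    using step.IH[of B] by blast
  \<comment> \<open>The matrix product of \<open>C\<close> and \<open>E\<close>. Its first
    \<open>a'\<close> columns are those of \<open>C\<close>, since \<open>a'\<close> \<le>
    \<open>m\<close>.\<close>
  define C' where "C' k i = (\<Sum>j<m. C k j * E j i)" for k i
  have "C' k i = C k i" if "i < a'" for k i
  proof -
    have "C' k i = (\<Sum>j<m. if j = i then C k i else 0)"
      unfolding C'_def using that step.hyps by (intro sum.cong) (auto simp: E_def)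
    then show ?thesis using that step.hyps by simp
  qed
  then have "\<forall>k<a'. \<forall>i<a'. C' k i = (if i = k then 1 else 0)" using C(1) by simp
  moreover have "combine_rows a' (Suc m) bs C' A = combine_rows a' m bs C B"
  proof
    fix w show "combine_rows a' (Suc m) bs C' A w = combine_rows a' m bs C B w"
    proof (cases "w \<in> multi_indices (a' # bs)")
      case True
      then obtain k J where w: "w = k # J" "k < a'" "J \<in> multi_indices bs" by (rule multi_indices_ConsE)
      have "(\<Sum>i<Suc m. C' k i * A (i # J)) = (\<Sum>j<m. C k j * (\<Sum>i<Suc m. E j i * A (i # J)))"
        unfolding C'_def sum_distrib_left sum_distrib_right
        by (subst sum.swap) (simp only: mult.assoc)
      also have "\<dots> = (\<Sum>j<m. C k j * B (j # J))"
        using w(3) by (intro sum.cong) (auto simp: B_def combine_rows_def)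
      finally show ?thesis using True w(1) by (simp add: combine_rows_def)
    qed (simp add: combine_rows_def)
  qed
  ultimately show ?case using C(2) by (intro exI[of _ C']) simp
qed

section \<open>The ideal of the hyperdeterminants of the subtensors\<close>

lemma rank_eq_if_unit_columns:
  fixes C :: "'k::field mat"
  assumes C: "C \<in> carrier_mat n m" and unit: "\<And>i. i < n \<Longrightarrow> i < m \<and> col C i = unit_vec n i"
  shows "vec_space.rank n C = n"
proof -
  interpret vec_space "TYPE('k)" n .
  have "set (unit_vecs n) \<subseteq> set (cols C)"
  proof
    fix v assume "v \<in> set (unit_vecs n :: 'k vec list)"
    then obtain i where i: "i < n" "v = unit_vec n i" by (auto simp: unit_vecs_def)
    with unit[of i] C have "cols C ! i = v" "i < length (cols C)" by (simp_all add: cols_nth)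
    then show "v \<in> set (cols C)" using nth_mem by blast
  qed
  then have "span (set (unit_vecs n)) \<subseteq> span (set (cols C))" by (rule span_is_monotone)
  moreover have "span (set (cols C)) \<subseteq> carrier_vec n"
    using C cols_dim[of C] span_closed by fastforce
  ultimately have span: "span (set (cols C)) = carrier_vec n"
    using span_unit_vecs_is_carrier by auto
  have carrier: "vs (carrier_vec n) = V" by (simp add: module_vec_def)
  show ?thesis unfolding rank_def span carrier by (rule dim_is_n)
qed

text \<open>The polynomials vanishing at \<open>A\<close> form an ideal, so testing the generators
  suffices. Each generator evaluates at \<open>A\<close> to \<open>D\<close> at a combination of the
  rows of \<open>A\<close>.\<close>

lemma subtensor_zero_locus:
  fixes A :: "nat list \<Rightarrow> 'k::field" and D :: "(nat list, int) mpoly"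
  assumes D: "mvars D \<subseteq> multi_indices (a' # bs)"
  shows "A \<in> zero_locus (multi_indices (a # bs)) (hyperdet_ideal a a' bs D) \<longleftrightarrow>
    A \<in> affine_space (multi_indices (a # bs)) \<and>
    (\<forall>C\<in>carrier_mat a' a. vec_space.rank a' C = a' \<longrightarrow>
      meval of_int (combine_rows a' a bs (\<lambda>k i. C $$ (k, i)) A) D = 0)"
proof -
  let ?V = "multi_indices (a # bs)" and ?R = "mpoly_ring (multi_indices (a # bs)) :: (nat list, 'k) mpoly ring"
  let ?S = "{meval of_int \<phi> D | \<phi>. \<phi> \<in> subtensors a a'} :: (nat list, 'k) mpoly set"
  interpret R: cring ?R by (rule cring_mpoly_ring)
  interpret e: comm_ring_hom "meval id A"
    by (rule comm_ring_hom.comm_ring_hom_meval[OF comm_ring_hom_id])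
  have sub_vars: "mvars (subtensor a C (k # J) :: (nat list, 'k) mpoly) \<subseteq> ?V"
    if "J \<in> multi_indices bs" for C k J
  proof -
    have "mvars (mvar (i # J) :: (nat list, 'k) mpoly) \<subseteq> ?V" if "i < a" for i
      using mvars_mvar[of "i # J"] that \<open>J \<in> multi_indices bs\<close> by auto
    then show ?thesis
      unfolding subtensor.simps by (intro mvars_subset_sum mvars_subset_mult) simp_all
  qed
  have of_int_mconst: "(of_int c :: (nat list, 'k) mpoly) = mconst (of_int c)" for c
    by (simp add: mconst_def)
  have S_carrier: "?S \<subseteq> carrier ?R"
  proof
    fix p assume "p \<in> ?S"
    then obtain C where p: "p = meval of_int (subtensor a C) D" by (auto simp: subtensors_def)
    have "mvars p \<subseteq> ?V"
      unfolding p
    proof (rule comm_ring_hom.meval_mvars_subset[OF comm_ring_hom_of_int, where P = "\<lambda>q. mvars q \<subseteq> ?V"])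
      fix v assume "v \<in> mvars D"
      with D have "v \<in> multi_indices (a' # bs)" by blast
      then show "mvars (subtensor a C v) \<subseteq> ?V" by (elim multi_indices_ConsE) (simp only: sub_vars)
    next
      fix c show "mvars (of_int c :: (nat list, 'k) mpoly) \<subseteq> ?V"
        unfolding of_int_mconst by simp
    qed (simp_all add: mvars_subset_add mvars_subset_mult)
    then show "p \<in> carrier ?R" by (simp add: mpoly_ring_def)
  qed
  have eval: "meval id A (meval of_int (subtensor a C) D) =
      meval of_int (combine_rows a' a bs (\<lambda>k i. C $$ (k, i)) A) D" for C
  proof -
    have "meval id A (meval of_int (subtensor a C) D) = meval of_int (\<lambda>w. meval id A (subtensor a C w)) D"
      unfolding e.hom_meval of_int_mconst
      by (simp add: comm_ring_hom.meval_mconst[OF comm_ring_hom_id])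
    also have "\<dots> = meval of_int (combine_rows a' a bs (\<lambda>k i. C $$ (k, i)) A) D"
    proof (rule meval_cong)
      fix w assume "w \<in> mvars D"
      with D have "w \<in> multi_indices (a' # bs)" by blast
      then show "meval id A (subtensor a C w) = combine_rows a' a bs (\<lambda>k i. C $$ (k, i)) A w"
        by (elim multi_indices_ConsE)
           (simp add: combine_rows_def e.hom_sum e.hom_mult
             comm_ring_hom.meval_mconst[OF comm_ring_hom_id] comm_ring_hom.meval_mvar[OF comm_ring_hom_id])
    qed
    finally show ?thesis .
  qed
  let ?I = "{p \<in> carrier ?R. meval id A p = 0}"
  have "ideal ?I ?R"
  proof (rule idealI)
    show "Ring.ring ?R" by (rule R.ring_axioms)
  next
    show "subgroup ?I (add_monoid ?R)"
    proof (rule R.add.subgroupI)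
      fix p assume p: "p \<in> ?I"
      have "\<ominus>\<^bsub>?R\<^esub> p = - p"
        by (rule R.minus_equality[OF _ _ _]) (use p in \<open>simp_all add: mpoly_ring_def mvars_uminus\<close>)
      with p show "\<ominus>\<^bsub>?R\<^esub> p \<in> ?I" by (simp add: mpoly_ring_def mvars_uminus e.hom_uminus)
    qed (auto simp: mpoly_ring_def e.hom_add mvars_subset_add intro!: exI[of _ 0])
  qed (auto simp: mpoly_ring_def e.hom_mult mvars_subset_mult)
  then have "hyperdet_ideal a a' bs D \<subseteq> ?I" if "\<forall>p\<in>?S. meval id A p = 0"
    unfolding hyperdet_ideal_def by (rule R.genideal_minimal) (use that S_carrier in blast)
  moreover have "?S \<subseteq> hyperdet_ideal a a' bs D"
    unfolding hyperdet_ideal_def by (rule R.genideal_self[OF S_carrier])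
  ultimately have "(\<forall>p\<in>hyperdet_ideal a a' bs D. meval id A p = 0) \<longleftrightarrow> (\<forall>p\<in>?S. meval id A p = 0)"
    by blast
  also have "\<dots> \<longleftrightarrow> (\<forall>C\<in>carrier_mat a' a. vec_space.rank a' C = a' \<longrightarrow>
      meval of_int (combine_rows a' a bs (\<lambda>k i. C $$ (k, i)) A) D = 0)"
    unfolding eval[symmetric] subtensors_def by blast
  finally show ?thesis by (simp add: zero_locus_def)
qed

theorem theorem1p6:
  fixes a a' :: nat and bs :: "nat list" and D :: "(nat list, int) mpoly"
  assumes "a \<ge> 1" and "\<forall>b\<in>set bs. b \<ge> 1"
    and "a' = 1 + (\<Sum>b\<leftarrow>bs. b - 1)"
    and "is_hyperdeterminant (a' # bs) D"
  shows "zero_locus (multi_indices (a # bs)) (hyperdet_ideal a a' bs D) =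
    (Y_locus a bs :: (nat list \<Rightarrow> 'k::alg_closed_field) set)"
proof -
  interpret boundary_hyperdet bs a' D by (rule boundary_hyperdet.intro) (fact assms)+
  let ?comb = "\<lambda>C. combine_rows a' a bs (\<lambda>k i. C $$ (k, i))"
  show ?thesis
  proof (intro equalityI subsetI)
    fix A :: "nat list \<Rightarrow> 'k"
    assume "A \<in> Y_locus a bs"
    then have "meval of_int (?comb C A) D = 0" for C
      using D_zeros[OF combine_rows_affine] Y_locus_combine_rows by blast
    then show "A \<in> zero_locus (multi_indices (a # bs)) (hyperdet_ideal a a' bs D)"
      using Y_locus_affine[OF \<open>A \<in> Y_locus a bs\<close>] unfolding subtensor_zero_locus[OF D_vars] by blast
  next
    fix A :: "nat list \<Rightarrow> 'k"
    assume "A \<in> zero_locus (multi_indices (a # bs)) (hyperdet_ideal a a' bs D)"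
    then have A: "A \<in> affine_space (multi_indices (a # bs))"
      and van: "\<And>C. C \<in> carrier_mat a' a \<Longrightarrow> vec_space.rank a' C = a' \<Longrightarrow> meval of_int (?comb C A) D = 0"
      unfolding subtensor_zero_locus[OF D_vars] by blast+
    show "A \<in> Y_locus a bs"
    \<comment> \<open>With \<open>a < a'\<close> there are no subtensors and the ideal is zero, so Y
      must be shown to be the whole space.\<close>
    proof (cases "a < a'")
      case True
      then show ?thesis using A by (rule Y_locus_few_rows)
    next
      case False
      show ?thesis
      proof (rule ccontr)
        assume "A \<notin> Y_locus a bs"
        with Y_locus_general_rows[OF infinite_UNIV_alg_closed bs a' _ A] False
        obtain C where C: "\<And>k i. k < a' \<Longrightarrow> i < a' \<Longrightarrow> C k i = (if i = k then 1 else 0)"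
          "combine_rows a' a bs C A \<notin> Y_locus a' bs" by force
        define M where "M = mat a' a (\<lambda>(k, i). C k i)"
        have M: "M \<in> carrier_mat a' a" by (simp add: M_def)
        \<comment> \<open>The identity block makes \<open>M\<close> a matrix of a subtensor, to
          which the hypothesis on the ideal applies.\<close>
        have "vec_space.rank a' M = a'"
        proof (rule rank_eq_if_unit_columns[OF M])
          fix i assume "i < a'"
          with False C(1) show "i < a \<and> col M i = unit_vec a' i"
            by (auto simp: M_def unit_vec_def intro!: eq_vecI)
        qed
        with M have "meval of_int (?comb M A) D = 0" by (rule van)
        moreover have "?comb M A = combine_rows a' a bs C A"
        proof
          fix w show "?comb M A w = combine_rows a' a bs C A w"
            by (cases "w \<in> multi_indices (a' # bs)")
               (auto simp: combine_rows_def M_def elim!: multi_indices_ConsE intro!: sum.cong)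
        qed
        ultimately show False using C(2) D_zeros[OF combine_rows_affine] by metis
      qed
    qed
  qed
qed

end
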